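(* Let $(h_j)_j$ be positive numbers with $h_j=o(2^{-j})$ as $j\to\infty$. Let $\Phi=\{\sigma_\eta\}_\eta$ be the Parseval frame of shearlets of $L^2(\mathbb{R}^2)$ defined using the Meyer wavelet and let $f_j=P_{\mathbb{R}^2\setminus\mathcal{M}_{h_j}}\,w\mathcal{L}_j$. There exist thresholds $\beta_j>0$ such that, with $\mathcal{T}_j=\{\eta:|\langle f_j,\sigma_\eta\rangle|\ge\beta_j\}$ and the one-step hard thresholding reconstruction $$L_j=\Phi\,\mathbb{1}_{\mathcal{T}_j}\Phi^\ast f_j ,$$ one has $$\frac{\|L_j-w\mathcal{L}_j\|_2}{\|w\mathcal{L}_j\|_2}\to 0,\qquad j\to\infty .$$
   Context: Fourier transform: $\hat f(\xi)=\int f(x)e^{-2\pi i\langle x,\xi\rangle}dx$; $\check f$ (or $f^\vee$) is the inverse transform. Meyer functions. Fix $\nu\in C^\infty(\mathbb{R})$ with $\nu(x)+\nu(1-x)=1$ for all $x$, $\nu(x)=0$ for $x\le 0$, $\nu(x)=1$ for $x\ge1$. Let $W(\xi)=e^{-16\pi i\xi/3}\sin[\frac{\pi}{2}\nu(16|\xi|-1)]$ for $\frac1{16}\le|\xi|\le\frac18$, $W(\xi)=e^{-16\pi i\xi/3}\cos[\frac{\pi}{2}\nu(8|\xi|-1)]$ for $\frac18\le|\xi|\le\frac14$, $W(\xi)=0$ otherwise; and $\hat\phi(\xi)=1$ for $|\xi|\le\frac1{16}$, $\hat\phi(\xi)=\cos[\frac{\pi}{2}\nu(16|\xi|-1)]$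 for $\frac1{16}\le|\xi|\le\frac18$, $\hat\phi(\xi)=0$ otherwise. For $\xi=(\xi_1,\xi_2)$ set $W^v(\xi)=\hat\phi(\xi_1)W(\xi_2)$, $W^h(\xi)=W(\xi_1)\hat\phi(\xi_2)$, $W^d(\xi)=W(\xi_1)W(\xi_2)$. Shearlet system. Let $\hat\varphi(\xi)=\hat\phi(\xi_1)\hat\phi(\xi_2)$ and $\mathcal{W}(\xi)=\sqrt{|\hat\varphi(2^{-2}\xi)|^2-|\hat\varphi(\xi)|^2}$. Let $V\in L^2(\mathbb{R})\cap C^\infty(\mathbb{R})$ with $\operatorname{supp}V\subseteq[-1,1]$ and $\sum_{k=-1}^1|V(u+k)|^2=1$ for $u\in[-1,1]$; $V^h(\xi)=V(\xi_2/\xi_1)$, $V^v(\xi)=V(\xi_1/\xi_2)$. Let $A_a^h=\begin{pmatrix}a^2&0\\0&a\end{pmatrix}$, $A_a^v=\begin{pmatrix}a&0\\0&a^2\end{pmatrix}$, $S_s^h=\begin{pmatrix}1&s\\0&1\end{pmatrix}$, $S_s^v=\begin{pmatrix}1&0\\ s&1\end{pmatrix}$; $\xi$ is a row vector. The system consists of: $\varphi(\cdot-k)$, $k\in\mathbb{Z}^2$; the elements $\sigma^\iota_{j,\ell,k}$ ($\iota\in\{h,v\}$, $j\ge0$, $|\ell|<2^j$, $k\in\mathbb{Z}^2$) with $\hat\sigma^\iota_{j,\ell,k}(\xi)=2^{-3j/2}\mathcal{W}(2^{-2j}\xi)V^\iota(\xi A^\iota_{2^{-j}}S^\iota_{-\ell})e^{2\pi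 i\langle\xi A^\iota_{2^{-j}}S^\iota_{-\ell},k\rangle}$; and the "seam" elements $\sigma_{j,\ell,k}$ ($j\ge0$, $\ell=\pm2^j$, $k\in\mathbb{Z}^2$) with, for $j=0$, $\hat\sigma_{0,\ell,k}(\xi)=\mathcal{W}(\xi)V(\frac{\xi_2}{\xi_1}-\ell)e^{2\pi i\langle\xi,k\rangle}$ if $|\xi_2/\xi_1|\le1$ and $\mathcal{W}(\xi)V(\frac{\xi_1}{\xi_2}-\ell)e^{2\pi i\langle\xi,k\rangle}$ if $|\xi_2/\xi_1|>1$; for $j\ge1$, $\hat\sigma_{j,\ell,k}(\xi)=2^{-\frac32j-\frac12}\mathcal{W}(2^{-2j}\xi)V(2^j\frac{\xi_2}{\xi_1}-\ell)e^{\pi i\langle\xi A^h_{2^{-j}}S^h_{-\ell},k\rangle}$ if $|\xi_2/\xi_1|\le1$ and $2^{-\frac32j-\frac12}\mathcal{W}(2^{-2j}\xi)V(2^j\frac{\xi_1}{\xi_2}-\ell)e^{\pi i\langle\xi A^h_{2^{-j}}S^h_{-\ell},k\rangle}$ if $|\xi_2/\xi_1|>1$. It is a known result (Guo–Labate) that this system is a Parseval frame for $L^2(\mathbb{R}^2)$ of $C^\infty$ band-limited functions. All elements of the system are denoted $\sigma_\eta$ for a common index $\eta$; $\Phi^\ast x=(\langle x,\sigma_\eta\rangle)_\eta$, $\Phi c=\sum_\eta c_\eta\sigma_\eta$, and $\mathbb{1}_{\mathcal{T}}$ restricts a sequence to the index set $\mathcal{T}$ (zero elsewhere). Image model. $\rho>0$,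 and $w:\mathbb{R}\to[0,1]$ is a smooth function supported in $[-\rho,\rho]$, not identically zero. $w\mathcal{L}$ is the tempered distribution on $\mathbb{R}^2$ given on Schwartz functions by $\langle w\mathcal{L},g\rangle=\int_{-\rho}^\rho w(x_1)g(x_1,0)\,dx_1$. Let $F_j(\xi)=\sum_{\iota\in\{h,v,d\}}\big(W^\iota(2^{-2j}\xi)+W^\iota(2^{-2j-1}\xi)\big)$ and $w\mathcal{L}_j=w\mathcal{L}\star\check F_j$, i.e. $\widehat{w\mathcal{L}_j}(\xi)=\hat w(\xi_1)F_j(\xi)$. Mask. $\mathcal{M}_h=\mathbb{1}_{\{|x_1|\le h\}}$; $P_{\mathbb{R}^2\setminus\mathcal{M}_h}$ is the orthogonal projection of $L^2(\mathbb{R}^2)$ given by multiplication with $1-\mathcal{M}_h$. Standing assumption: $\rho$ is sufficiently large, in particular much larger than $h_j$ (so $h_j<\rho$). *)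

theory Defs
  imports "HOL-Analysis.Analysis" "HOL-Library.Landau_Symbols"
begin

section \<open>Function spaces and the Fourier transform\<close>

definition smooth :: "(real \<Rightarrow> 'a::real_normed_vector) \<Rightarrow> bool" where
  "smooth f \<longleftrightarrow>
     (\<exists>D. D 0 = f \<and> (\<forall>n x. (D n has_vector_derivative D (Suc n) x) (at x)))"

definition supp :: "('a::topological_space \<Rightarrow> 'b::zero) \<Rightarrow> 'a set" where
  "supp f = closure {x. f x \<noteq> 0}"

text \<open>Elements of \<open>L\<^sup>2\<close> are represented by (Borel) functions. The norm below is defined
  through the Bochner integral, so it is only meaningful for functions satisfying \<open>L2\<close>.\<close>

definition L2 :: "('a::euclidean_space \<Rightarrow> complex) \<Rightarrow> bool" where
  "L2 f \<longleftrightarrow> f \<in> borel_measurable lborel \<and> integrable lborel (\<lambda>x. (cmod (f x))\<^sup>2)"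

definition L2_norm :: "('a::euclidean_space \<Rightarrow> complex) \<Rightarrow> real" where
  "L2_norm f = sqrt (LINT x|lborel. (cmod (f x))\<^sup>2)"

definition L2_inner :: "('a::euclidean_space \<Rightarrow> complex) \<Rightarrow> ('a \<Rightarrow> complex) \<Rightarrow> complex" where
  "L2_inner f g = (LINT x|lborel. f x * cnj (g x))"

text \<open>Unconditional convergence in \<open>L\<^sup>2\<close> of a family indexed by \<open>I\<close>; the sum \<open>g\<close> is determined
  up to a null set.\<close>

definition has_L2_sum ::
  "('i \<Rightarrow> 'a::euclidean_space \<Rightarrow> complex) \<Rightarrow> 'i set \<Rightarrow> ('a \<Rightarrow> complex) \<Rightarrow> bool" where
  "has_L2_sum u I g \<longleftrightarrow> (\<forall>i\<in>I. L2 (u i)) \<and> L2 g \<and>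
     ((\<lambda>F. L2_norm (\<lambda>x. (\<Sum>i\<in>F. u i x) - g x)) \<longlongrightarrow> 0) (finite_subsets_at_top I)"

text \<open>Inverse of the transform \<open>f \<mapsto> (\<lambda>\<xi>. \<integral> f x * exp (- 2 * pi * \<i> * (x \<bullet> \<xi>)) dx)\<close>. Below it is
  only applied to bounded functions of bounded support.\<close>

definition inv_fourier :: "('a::euclidean_space \<Rightarrow> complex) \<Rightarrow> 'a \<Rightarrow> complex" where
  "inv_fourier g x = (LINT \<xi>|lborel. g \<xi> * cis (2 * pi * (x \<bullet> \<xi>)))"


section \<open>Meyer functions\<close>

definition meyer_W :: "(real \<Rightarrow> real) \<Rightarrow> real \<Rightarrow> complex" where
  "meyer_W \<nu> \<xi> =
     (if 1/16 \<le> \<bar>\<xi>\<bar> \<and> \<bar>\<xi>\<bar> \<le> 1/8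
        then cis (- (16 * pi * \<xi> / 3)) * of_real (sin (pi / 2 * \<nu> (16 * \<bar>\<xi>\<bar> - 1)))
      else if 1/8 \<le> \<bar>\<xi>\<bar> \<and> \<bar>\<xi>\<bar> \<le> 1/4
        then cis (- (16 * pi * \<xi> / 3)) * of_real (cos (pi / 2 * \<nu> (8 * \<bar>\<xi>\<bar> - 1)))
      else 0)"

definition meyer_phi_hat :: "(real \<Rightarrow> real) \<Rightarrow> real \<Rightarrow> real" where
  "meyer_phi_hat \<nu> \<xi> =
     (if \<bar>\<xi>\<bar> \<le> 1/16 then 1
      else if 1/16 \<le> \<bar>\<xi>\<bar> \<and> \<bar>\<xi>\<bar> \<le> 1/8 then cos (pi / 2 * \<nu> (16 * \<bar>\<xi>\<bar> - 1))
      else 0)"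

datatype meyer_dir = MH | MV | MD

fun meyer_W2 :: "(real \<Rightarrow> real) \<Rightarrow> meyer_dir \<Rightarrow> real \<times> real \<Rightarrow> complex" where
  "meyer_W2 \<nu> MV (\<xi>1, \<xi>2) = of_real (meyer_phi_hat \<nu> \<xi>1) * meyer_W \<nu> \<xi>2"
| "meyer_W2 \<nu> MH (\<xi>1, \<xi>2) = meyer_W \<nu> \<xi>1 * of_real (meyer_phi_hat \<nu> \<xi>2)"
| "meyer_W2 \<nu> MD (\<xi>1, \<xi>2) = meyer_W \<nu> \<xi>1 * meyer_W \<nu> \<xi>2"


section \<open>The shearlet system\<close>

definition scaling_hat :: "(real \<Rightarrow> real) \<Rightarrow> real \<times> real \<Rightarrow> real" where
  "scaling_hat \<nu> \<xi> = meyer_phi_hat \<nu> (fst \<xi>) * meyer_phi_hat \<nu> (snd \<xi>)"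

definition corona :: "(real \<Rightarrow> real) \<Rightarrow> real \<times> real \<Rightarrow> real" where
  "corona \<nu> \<xi> = sqrt (\<bar>scaling_hat \<nu> ((1/4) *\<^sub>R \<xi>)\<bar>\<^sup>2 - \<bar>scaling_hat \<nu> \<xi>\<bar>\<^sup>2)"

datatype cone = Hor | Ver

text \<open>Division by zero only concerns the null set where a coordinate of \<open>\<xi>\<close> vanishes; the
  functions on the frequency side matter only up to null sets.\<close>

fun cone_V :: "(real \<Rightarrow> complex) \<Rightarrow> cone \<Rightarrow> real \<times> real \<Rightarrow> complex" where
  "cone_V V Hor (\<xi>1, \<xi>2) = V (\<xi>2 / \<xi>1)"
| "cone_V V Ver (\<xi>1, \<xi>2) = V (\<xi>1 / \<xi>2)"

text \<open>A real \<open>2 \<times> 2\<close> matrix is the pair of its rows; \<open>row_mult\<close> multiplies a row vector by a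
  matrix from the right.\<close>

type_synonym mat2 = "(real \<times> real) \<times> (real \<times> real)"

fun row_mult :: "real \<times> real \<Rightarrow> mat2 \<Rightarrow> real \<times> real" (infixl \<open>\<lhd>\<close> 70) where
  "(x, y) \<lhd> ((a, b), (c, d)) = (x * a + y * c, x * b + y * d)"

fun dilation :: "cone \<Rightarrow> real \<Rightarrow> mat2" where
  "dilation Hor a = ((a\<^sup>2, 0), (0, a))"
| "dilation Ver a = ((a, 0), (0, a\<^sup>2))"

fun shear :: "cone \<Rightarrow> real \<Rightarrow> mat2" where
  "shear Hor s = ((1, s), (0, 1))"
| "shear Ver s = ((1, 0), (s, 1))"

definition shear_coord :: "cone \<Rightarrow> nat \<Rightarrow> int \<Rightarrow> real \<times> real \<Rightarrow> real \<times> real" where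
  "shear_coord \<iota> j l \<xi> = \<xi> \<lhd> dilation \<iota> (2 powr (- real j)) \<lhd> shear \<iota> (- of_int l)"

definition lattice :: "int \<times> int \<Rightarrow> real \<times> real" where
  "lattice k = (of_int (fst k), of_int (snd k))"

definition cone_shearlet_hat ::
  "(real \<Rightarrow> real) \<Rightarrow> (real \<Rightarrow> complex) \<Rightarrow> cone \<Rightarrow> nat \<Rightarrow> int \<Rightarrow> int \<times> int \<Rightarrow> real \<times> real \<Rightarrow> complex" where
  "cone_shearlet_hat \<nu> V \<iota> j l k \<xi> =
     of_real (2 powr (- (3 * real j / 2)) * corona \<nu> (2 powr (- 2 * real j) *\<^sub>R \<xi>))
     * cone_V V \<iota> (shear_coord \<iota> j l \<xi>)
     * cis (2 * pi * (shear_coord \<iota> j l \<xi> \<bullet> lattice k))"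

definition seam_V :: "(real \<Rightarrow> complex) \<Rightarrow> nat \<Rightarrow> int \<Rightarrow> real \<times> real \<Rightarrow> complex" where
  "seam_V V j l \<xi> =
     (if \<bar>snd \<xi> / fst \<xi>\<bar> \<le> 1 then V (2 ^ j * (snd \<xi> / fst \<xi>) - of_int l)
      else V (2 ^ j * (fst \<xi> / snd \<xi>) - of_int l))"

text \<open>For \<open>j \<ge> 1\<close> the modulation uses the horizontal matrices on both pieces of a seam element.\<close>

definition seam_shearlet_hat ::
  "(real \<Rightarrow> real) \<Rightarrow> (real \<Rightarrow> complex) \<Rightarrow> nat \<Rightarrow> int \<Rightarrow> int \<times> int \<Rightarrow> real \<times> real \<Rightarrow> complex" where
  "seam_shearlet_hat \<nu> V j l k \<xi> =
     (if j = 0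
      then of_real (corona \<nu> \<xi>) * seam_V V 0 l \<xi> * cis (2 * pi * (\<xi> \<bullet> lattice k))
      else of_real (2 powr (- (3 * real j / 2) - 1/2) * corona \<nu> (2 powr (- 2 * real j) *\<^sub>R \<xi>))
           * seam_V V j l \<xi>
           * cis (pi * (shear_coord Hor j l \<xi> \<bullet> lattice k)))"

datatype shearlet_index =
    Coarse "int \<times> int"
  | Cone cone nat int "int \<times> int"
  | Seam nat int "int \<times> int"

definition shearlet_indices :: "shearlet_index set" where
  "shearlet_indices =
     {Coarse k | k. True}
     \<union> {Cone \<iota> j l k | \<iota> j l k. \<bar>l\<bar> < 2 ^ j}
     \<union> {Seam j l k | j l k. l = 2 ^ j \<or> l = - (2 ^ j)}"

fun shearlet ::
  "(real \<Rightarrow> real) \<Rightarrow> (real \<Rightarrow> complex) \<Rightarrow> shearlet_index \<Rightarrow> real \<times> real \<Rightarrow> complex" where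
  "shearlet \<nu> V (Coarse k) x = inv_fourier (\<lambda>\<xi>. of_real (scaling_hat \<nu> \<xi>)) (x - lattice k)"
| "shearlet \<nu> V (Cone \<iota> j l k) x = inv_fourier (cone_shearlet_hat \<nu> V \<iota> j l k) x"
| "shearlet \<nu> V (Seam j l k) x = inv_fourier (seam_shearlet_hat \<nu> V j l k) x"

definition analysis ::
  "(real \<Rightarrow> real) \<Rightarrow> (real \<Rightarrow> complex) \<Rightarrow> (real \<times> real \<Rightarrow> complex) \<Rightarrow> shearlet_index \<Rightarrow> complex" where
  "analysis \<nu> V f \<eta> = L2_inner f (shearlet \<nu> V \<eta>)"

text \<open>\<open>is_synthesis \<nu> V c g\<close>: the series of \<open>c \<eta> * shearlet \<nu> V \<eta>\<close> over all indices
  converges in \<open>L\<^sup>2\<close> to \<open>g\<close>.\<close>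

definition is_synthesis ::
  "(real \<Rightarrow> real) \<Rightarrow> (real \<Rightarrow> complex) \<Rightarrow> (shearlet_index \<Rightarrow> complex) \<Rightarrow> (real \<times> real \<Rightarrow> complex) \<Rightarrow> bool" where
  "is_synthesis \<nu> V c g \<longleftrightarrow> has_L2_sum (\<lambda>\<eta> x. c \<eta> * shearlet \<nu> V \<eta> x) shearlet_indices g"

definition restrict_seq :: "'i set \<Rightarrow> ('i \<Rightarrow> complex) \<Rightarrow> 'i \<Rightarrow> complex" where
  "restrict_seq T c \<eta> = (if \<eta> \<in> T then c \<eta> else 0)"

definition threshold_set ::
  "(real \<Rightarrow> real) \<Rightarrow> (real \<Rightarrow> complex) \<Rightarrow> (real \<times> real \<Rightarrow> complex) \<Rightarrow> real \<Rightarrow> shearlet_index set" where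
  "threshold_set \<nu> V f \<beta> = {\<eta> \<in> shearlet_indices. cmod (L2_inner f (shearlet \<nu> V \<eta>)) \<ge> \<beta>}"


section \<open>Image model and mask\<close>

definition line_dist :: "real \<Rightarrow> (real \<Rightarrow> real) \<Rightarrow> (real \<times> real \<Rightarrow> complex) \<Rightarrow> complex" where
  "line_dist \<rho> w g = (LINT x1:{-\<rho>..\<rho>}|lborel. of_real (w x1) * g (x1, 0))"

definition band_filter :: "(real \<Rightarrow> real) \<Rightarrow> nat \<Rightarrow> real \<times> real \<Rightarrow> complex" where
  "band_filter \<nu> j \<xi> =
     (\<Sum>\<iota>\<in>{MH, MV, MD}. meyer_W2 \<nu> \<iota> (2 powr (- 2 * real j) *\<^sub>R \<xi>)
                        + meyer_W2 \<nu> \<iota> (2 powr (- 2 * real j - 1) *\<^sub>R \<xi>))"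

text \<open>Convolution of the distribution \<open>line_dist \<rho> w\<close> with the Schwartz function
  \<open>inv_fourier (band_filter \<nu> j)\<close>.\<close>

definition filtered_line ::
  "(real \<Rightarrow> real) \<Rightarrow> real \<Rightarrow> (real \<Rightarrow> real) \<Rightarrow> nat \<Rightarrow> real \<times> real \<Rightarrow> complex" where
  "filtered_line \<nu> \<rho> w j x = line_dist \<rho> w (\<lambda>y. inv_fourier (band_filter \<nu> j) (x - y))"

definition mask :: "real \<Rightarrow> (real \<times> real) set" where
  "mask h = {x. \<bar>fst x\<bar> \<le> h}"

definition proj_known :: "real \<Rightarrow> (real \<times> real \<Rightarrow> complex) \<Rightarrow> real \<times> real \<Rightarrow> complex" where
  "proj_known h f x = (1 - indicator (mask h) x) * f x"

end

theory Submission
  imports Defs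
begin

text \<open>
  The threshold is only required to be positive, and this makes the theorem a statement about the
  frame operator. As the threshold tends to zero, hard thresholding of \<open>f j\<close> tends to the full frame
  series of \<open>f j\<close>, so for a small enough threshold \<open>L j\<close> is as close to the frame operator applied
  to \<open>f j\<close> as desired (\<open>hard_thresholding\<close>). It remains to see that the frame operator nearly
  reproduces the filtered line \<open>wL j\<close>, and that \<open>f j\<close> and \<open>wL j\<close> are close. In both cases close means
  small compared with the norm of \<open>wL j\<close>, whose square \<open>energy (wL j)\<close> grows like \<open>4 ^ j\<close>.

  The spectrum of \<open>wL j\<close> is \<open>what (fst \<xi>) * band_filter \<nu> j \<xi>\<close>, with \<open>what\<close> the transform of \<open>w\<close>.
  Since \<open>what\<close> is square-integrable, all but a vanishing fraction of the energy lies at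
  \<open>\<bar>fst \<xi>\<bar> < 4 ^ j / 32\<close>. There the band filter depends on the second variable only, so up to a small
  error \<open>wL j\<close> is a tensor product of \<open>w\<close> with a function of energy of order \<open>4 ^ j\<close>. A vertical strip
  of width \<open>2 * h j\<close> contains a fraction of the energy that vanishes with \<open>h j\<close>, so \<open>f j\<close> is close to
  \<open>wL j\<close> (\<open>energy_masked_line_le\<close>).

  On the frequency side the shearlets are windows modulated by the characters of a lattice, and each
  window fits into a fundamental cell. Fourier series on the cell turn the frame operator into
  multiplication by the weighted sum of the squares of the windows (\<open>frame_series_converges\<close>). These
  squares sum to one almost everywhere. The weights are one except on the seam tiles with \<open>j \<ge> 1\<close>, where the stated
  normalisation gives two; there the frame operator is not the identity. The seams lie around the
  diagonals, where \<open>fst \<xi>\<close> is of order \<open>4 ^ j\<close> on the support of the band filter, so they meet only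
  the vanishing fraction of the energy of \<open>wL j\<close> (\<open>energy_line_on_seam_cone\<close>). The part of \<open>f j\<close> removed
  by the mask is not band-limited, but the frame bounds control its coefficients.

  Plancherel's theorem is derived from Fourier series: the values of the transform of \<open>g\<close> on a
  translated lattice are Fourier coefficients of a modulation of \<open>g\<close>, and averaging Parseval's
  identity over the translations gives the integral of the squared transform over the plane.
\<close>

section \<open>Square-integrable functions\<close>

lemma borel_measurable_cnj [measurable]: "cnj \<in> borel_measurable borel"
  by (intro borel_measurable_continuous_onI continuous_intros)

lemma borel_measurable_cis [measurable]: "cis \<in> borel_measurable borel"
  by (intro borel_measurable_continuous_onI continuous_intros)

definition energy :: "('a::euclidean_space \<Rightarrow> complex) \<Rightarrow> real" where
  "energy f = (LINT x|lborel. (cmod (f x))\<^sup>2)"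

lemma energy_nonneg [simp]: "0 \<le> energy f"
  by (simp add: energy_def)

lemma L2_norm_eq_sqrt_energy: "L2_norm f = sqrt (energy f)"
  by (simp add: L2_norm_def energy_def)

lemma L2_measurable [measurable_dest]: "L2 f \<Longrightarrow> f \<in> borel_measurable borel"
  by (simp add: L2_def)

lemma L2_square_integrable: "L2 f \<Longrightarrow> integrable lborel (\<lambda>x. (cmod (f x))\<^sup>2)"
  by (simp add: L2_def)

lemma cmod_add_square_le: "(cmod (a + b))\<^sup>2 \<le> 2 * (cmod a)\<^sup>2 + 2 * (cmod b)\<^sup>2"
proof -
  have "(cmod (a + b))\<^sup>2 \<le> (cmod a + cmod b)\<^sup>2"
    by (intro power_mono norm_triangle_ineq norm_ge_zero)
  also have "\<dots> \<le> 2 * (cmod a)\<^sup>2 + 2 * (cmod b)\<^sup>2"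
    using zero_le_power2[of "cmod a - cmod b"] by (simp add: power2_eq_square algebra_simps)
  finally show ?thesis .
qed

lemma L2_zero [simp]: "L2 (\<lambda>x. 0)"
  by (simp add: L2_def)

lemma L2_add:
  assumes "L2 f" "L2 g" shows "L2 (\<lambda>x. f x + g x)"
proof -
  note [measurable] = L2_measurable[OF assms(1)] L2_measurable[OF assms(2)]
  have "integrable lborel (\<lambda>x. (cmod (f x + g x))\<^sup>2)"
  proof (rule Bochner_Integration.integrable_bound)
    show "integrable lborel (\<lambda>x. 2 * (cmod (f x))\<^sup>2 + 2 * (cmod (g x))\<^sup>2)"
      using assms by (auto simp: L2_def)
  qed (auto simp: cmod_add_square_le)
  then show ?thesis by (simp add: L2_def)
qed

lemma L2_mult_const: "L2 f \<Longrightarrow> L2 (\<lambda>x. c * f x)"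
  by (auto simp: L2_def norm_mult power_mult_distrib)

lemma L2_diff: "L2 f \<Longrightarrow> L2 g \<Longrightarrow> L2 (\<lambda>x. f x - g x)"
  using L2_add[of f "\<lambda>x. - 1 * g x"] L2_mult_const[of g "- 1"] by simp

lemma L2_sum: "(\<And>i. i \<in> I \<Longrightarrow> L2 (f i)) \<Longrightarrow> L2 (\<lambda>x. \<Sum>i\<in>I. f i x)"
  by (induction I rule: infinite_finite_induct) (auto intro: L2_add)

lemma L2_dominated:
  assumes "L2 g" "f \<in> borel_measurable borel" "\<And>x. cmod (f x) \<le> C * cmod (g x)"
  shows "L2 f"
proof -
  note [measurable] = assms(2)
  have "integrable lborel (\<lambda>x. (cmod (f x))\<^sup>2)"
  proof (rule Bochner_Integration.integrable_bound)
    show "integrable lborel (\<lambda>x. C\<^sup>2 * (cmod (g x))\<^sup>2)"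
      using assms(1) by (auto simp: L2_def)
    show "AE x in lborel. norm ((cmod (f x))\<^sup>2) \<le> norm (C\<^sup>2 * (cmod (g x))\<^sup>2)"
      using assms(3) by (auto simp flip: power_mult_distrib intro!: power_mono)
  qed simp
  then show ?thesis by (simp add: L2_def)
qed

lemma energy_add_le:
  assumes "L2 f" "L2 g"
  shows "energy (\<lambda>x. f x + g x) \<le> 2 * energy f + 2 * energy g"
proof -
  have "energy (\<lambda>x. f x + g x) \<le> (LINT x|lborel. 2 * (cmod (f x))\<^sup>2 + 2 * (cmod (g x))\<^sup>2)"
    unfolding energy_def
    using assms L2_add[OF assms] by (intro integral_mono) (auto simp: L2_def cmod_add_square_le)
  also have "\<dots> = 2 * energy f + 2 * energy g"
    using assms by (simp add: energy_def L2_def)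
  finally show ?thesis .
qed

lemma energy_mult_const: "energy (\<lambda>x. c * f x) = (cmod c)\<^sup>2 * energy f"
  by (simp add: energy_def norm_mult power_mult_distrib)

lemma energy_diff_le:
  assumes "L2 f" "L2 g"
  shows "energy (\<lambda>x. f x - g x) \<le> 2 * energy f + 2 * energy g"
  using energy_add_le[OF assms(1) L2_mult_const[OF assms(2), of "-1"]]
    energy_mult_const[of "-1" g] by simp

lemma energy_mono:
  assumes "L2 g" "f \<in> borel_measurable borel" "\<And>x. cmod (f x) \<le> cmod (g x)"
  shows "energy f \<le> energy g"
  unfolding energy_def
  using L2_dominated[OF assms(1,2), of 1] assms
  by (intro integral_mono) (auto simp: L2_def intro!: power_mono)

lemma energy_sum_le:
  assumes "finite I" "\<And>i. i \<in> I \<Longrightarrow> L2 (f i)"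
  shows "energy (\<lambda>x. \<Sum>i\<in>I. f i x) \<le> card I * (\<Sum>i\<in>I. energy (f i))"
proof -
  have "energy (\<lambda>x. \<Sum>i\<in>I. f i x) \<le> (LINT x|lborel. card I * (\<Sum>i\<in>I. (cmod (f i x))\<^sup>2))"
    unfolding energy_def
  proof (intro integral_mono)
    show "integrable lborel (\<lambda>x. (cmod (\<Sum>i\<in>I. f i x))\<^sup>2)"
      using L2_sum[of I f] assms by (auto simp: L2_def)
    show "integrable lborel (\<lambda>x. card I * (\<Sum>i\<in>I. (cmod (f i x))\<^sup>2))"
      using assms by (auto simp: L2_def)
    fix x
    have "(cmod (\<Sum>i\<in>I. f i x))\<^sup>2 \<le> (\<Sum>i\<in>I. 1 * cmod (f i x))\<^sup>2"
      by (intro power_mono) (auto intro: norm_sum)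
    also have "\<dots> \<le> (\<Sum>i\<in>I. 1\<^sup>2) * (\<Sum>i\<in>I. (cmod (f i x))\<^sup>2)"
      by (rule Cauchy_Schwarz_ineq_sum)
    finally show "(cmod (\<Sum>i\<in>I. f i x))\<^sup>2 \<le> card I * (\<Sum>i\<in>I. (cmod (f i x))\<^sup>2)" by simp
  qed
  also have "\<dots> = card I * (\<Sum>i\<in>I. energy (f i))"
    using assms by (simp add: energy_def L2_def)
  finally show ?thesis .
qed

lemma nn_integral_eq_energy:
  assumes "L2 f"
  shows "(\<integral>\<^sup>+x. ennreal ((cmod (f x))\<^sup>2) \<partial>lborel) = ennreal (energy f)"
  using assms by (simp add: nn_integral_eq_integral L2_def energy_def)

lemma L2I_nn_integral:
  assumes "f \<in> borel_measurable borel"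
    and "(\<integral>\<^sup>+x. ennreal ((cmod (f x))\<^sup>2) \<partial>lborel) = ennreal e" "0 \<le> e"
  shows "L2 f" "energy f = e"
proof -
  note [measurable] = assms(1)
  have "integrable lborel (\<lambda>x. (cmod (f x))\<^sup>2)"
    using assms by (intro integrableI_nn_integral_finite[where x = e]) auto
  then show "L2 f" by (simp add: L2_def)
  then show "energy f = e"
    using assms nn_integral_eq_energy[of f] by simp
qed

subsection \<open>The inner product\<close>

lemma integrable_inner:
  assumes "L2 f" "L2 g"
  shows "integrable lborel (\<lambda>x. f x * cnj (g x))"
proof (rule Bochner_Integration.integrable_bound)
  note [measurable] = L2_measurable[OF assms(1)] L2_measurable[OF assms(2)]
  show "integrable lborel (\<lambda>x. (cmod (f x))\<^sup>2 + (cmod (g x))\<^sup>2)"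
    using assms by (auto simp: L2_def)
  show "(\<lambda>x. f x * cnj (g x)) \<in> borel_measurable lborel" by simp
  have "cmod a * cmod b \<le> (cmod a)\<^sup>2 + (cmod b)\<^sup>2" for a b
    using sum_squares_bound[of "cmod a" "cmod b"] mult_nonneg_nonneg[OF norm_ge_zero[of a] norm_ge_zero[of b]]
    by linarith
  then show "AE x in lborel. norm (f x * cnj (g x)) \<le> norm ((cmod (f x))\<^sup>2 + (cmod (g x))\<^sup>2)"
    by (simp add: norm_mult)
qed

lemma L2_inner_diff_left:
  "L2 f \<Longrightarrow> L2 g \<Longrightarrow> L2 k \<Longrightarrow> L2_inner (\<lambda>x. f x - g x) k = L2_inner f k - L2_inner g k"
  by (simp add: L2_inner_def left_diff_distrib integrable_inner)

lemma L2_inner_mult_left: "L2_inner (\<lambda>x. c * f x) g = c * L2_inner f g"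
  by (simp add: L2_inner_def mult.assoc)

lemma L2_inner_commute: "L2_inner g f = cnj (L2_inner f g)"
proof -
  have "cnj (L2_inner f g) = (LINT x|lborel. cnj (f x * cnj (g x)))"
    unfolding L2_inner_def by (rule Bochner_Integration.integral_cnj[symmetric])
  then show ?thesis by (simp add: L2_inner_def mult.commute)
qed

lemma L2_inner_mult_right: "L2_inner f (\<lambda>x. c * g x) = cnj c * L2_inner f g"
  by (simp add: L2_inner_commute[of f] L2_inner_mult_left)

lemma L2_inner_sum_left:
  assumes "\<And>i. i \<in> I \<Longrightarrow> L2 (f i)" "L2 g"
  shows "L2_inner (\<lambda>x. \<Sum>i\<in>I. f i x) g = (\<Sum>i\<in>I. L2_inner (f i) g)"
  using assms by (simp add: L2_inner_def sum_distrib_right integrable_inner)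

lemma L2_inner_sum_right:
  assumes "\<And>i. i \<in> I \<Longrightarrow> L2 (g i)" "L2 f"
  shows "L2_inner f (\<lambda>x. \<Sum>i\<in>I. g i x) = (\<Sum>i\<in>I. L2_inner f (g i))"
  by (simp add: L2_inner_commute[of f] L2_inner_sum_left assms)

lemma L2_inner_self: "L2_inner f f = of_real (energy f)"
proof -
  have "L2_inner f f = (LINT x|lborel. complex_of_real ((cmod (f x))\<^sup>2))"
    unfolding L2_inner_def by (simp only: complex_norm_square)
  then show ?thesis by (simp only: energy_def integral_complex_of_real)
qed

lemma energy_add:
  assumes "L2 f" "L2 g"
  shows "energy (\<lambda>x. f x + g x) = energy f + energy g + 2 * Re (L2_inner f g)"
proof -
  have "(cmod (a + b))\<^sup>2 = (cmod a)\<^sup>2 + (cmod b)\<^sup>2 + 2 * Re (a * cnj b)" for a b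
    by (simp only: cmod_power2) (simp add: power2_eq_square algebra_simps)
  then have "energy (\<lambda>x. f x + g x)
      = (LINT x|lborel. (cmod (f x))\<^sup>2 + (cmod (g x))\<^sup>2 + 2 * Re (f x * cnj (g x)))"
    by (simp add: energy_def)
  also have "\<dots> = energy f + energy g + 2 * (LINT x|lborel. Re (f x * cnj (g x)))"
    using assms integrable_inner[OF assms]
    by (simp add: energy_def L2_def del: times_complex.sel)
  also have "(LINT x|lborel. Re (f x * cnj (g x))) = Re (L2_inner f g)"
    unfolding L2_inner_def by (rule integral_Re[OF integrable_inner[OF assms]])
  finally show ?thesis .
qed

lemma energy_diff:
  assumes "L2 f" "L2 g"
  shows "energy (\<lambda>x. f x - g x) = energy f + energy g - 2 * Re (L2_inner f g)"
  using energy_add[OF assms(1) L2_mult_const[OF assms(2), of "-1"]]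
    energy_mult_const[of "-1" g] L2_inner_mult_right[of f "-1" g] by simp

text \<open>Pythagoras: among all coefficients the Fourier coefficients give the best approximation, and
  enlarging the index set improves it.\<close>

lemma energy_diff_orthonormal:
  assumes F: "finite F" and e: "\<And>i. i \<in> F \<Longrightarrow> L2 (e i)" and f: "L2 f"
    and on: "\<And>i k. i \<in> F \<Longrightarrow> k \<in> F \<Longrightarrow> L2_inner (e i) (e k) = (if i = k then 1 else 0)"
  shows "energy (\<lambda>x. f x - (\<Sum>i\<in>F. c i * e i x))
       = energy f - (\<Sum>i\<in>F. (cmod (L2_inner f (e i)))\<^sup>2)
         + (\<Sum>i\<in>F. (cmod (c i - L2_inner f (e i)))\<^sup>2)"
proof -
  let ?s = "\<lambda>x. \<Sum>i\<in>F. c i * e i x"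
  have ce: "L2 (\<lambda>x. c i * e i x)" if "i \<in> F" for i
    using e[OF that] by (rule L2_mult_const)
  have s: "L2 ?s" by (intro L2_sum ce)
  have "of_real (energy ?s) = (\<Sum>i\<in>F. \<Sum>k\<in>F. c i * (cnj (c k) * L2_inner (e i) (e k)))"
    using e ce s
    by (simp add: L2_inner_self[symmetric] L2_inner_sum_left L2_inner_sum_right
        L2_inner_mult_left L2_inner_mult_right L2_sum sum_distrib_left)
  also have "\<dots> = (\<Sum>i\<in>F. \<Sum>k\<in>F. if i = k then c i * cnj (c i) else 0)"
    by (intro sum.cong refl) (auto simp: on)
  also have "\<dots> = of_real (\<Sum>i\<in>F. (cmod (c i))\<^sup>2)"
    using F by (simp add: complex_norm_square[symmetric])
  finally have es: "energy ?s = (\<Sum>i\<in>F. (cmod (c i))\<^sup>2)"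
    by (simp only: of_real_eq_iff)
  have fs: "L2_inner f ?s = (\<Sum>i\<in>F. cnj (c i) * L2_inner f (e i))"
    using ce f by (simp add: L2_inner_sum_right L2_inner_mult_right)
  have pt: "(cmod a)\<^sup>2 - 2 * Re (cnj a * b) = (cmod (a - b))\<^sup>2 - (cmod b)\<^sup>2" for a b
    by (simp only: cmod_power2) (simp add: power2_eq_square algebra_simps)
  have "energy (\<lambda>x. f x - ?s x) = energy f + (\<Sum>i\<in>F. (cmod (c i))\<^sup>2 - 2 * Re (cnj (c i) * L2_inner f (e i)))"
    by (simp only: energy_diff[OF f s] es fs Re_sum sum_subtractf sum_distrib_left)
  then show ?thesis by (simp only: pt sum_subtractf)
qed

section \<open>Bounded functions of bounded support and their inverse Fourier transform\<close>

text \<open>The transform is only applied to functions of this kind, for which it is an absolutely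
  convergent integral and Fubini's theorem is applicable.\<close>

definition tame :: "('a::euclidean_space \<Rightarrow> complex) \<Rightarrow> bool" where
  "tame g \<longleftrightarrow> g \<in> borel_measurable borel \<and> bounded (range g) \<and> bounded {x. g x \<noteq> 0}"

lemma tame_measurable [measurable_dest]: "tame g \<Longrightarrow> g \<in> borel_measurable borel"
  by (simp add: tame_def)

lemma tameE:
  assumes "tame g"
  obtains M R where "M > 0" "R > 0" "\<And>x. cmod (g x) \<le> M" "\<And>x. g x \<noteq> 0 \<Longrightarrow> norm x \<le> R"
  using assms unfolding tame_def bounded_pos by blast

lemma tameI:
  assumes "g \<in> borel_measurable borel" "\<And>x. cmod (g x) \<le> M" "\<And>x. g x \<noteq> 0 \<Longrightarrow> norm x \<le> R"
  shows "tame g"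
  using assms unfolding tame_def bounded_iff by blast

lemma tame_mult:
  assumes "tame g" "f \<in> borel_measurable borel" "\<And>x. cmod (f x) \<le> M"
  shows "tame (\<lambda>x. f x * g x)"
proof -
  obtain N R where *: "N > 0" "R > 0" "\<And>x. cmod (g x) \<le> N" "\<And>x. g x \<noteq> 0 \<Longrightarrow> norm x \<le> R"
    using tameE[OF assms(1)] by metis
  note [measurable] = tame_measurable[OF assms(1)] assms(2)
  show ?thesis
  proof (rule tameI[where M = "M * N" and R = R])
    fix x
    have "cmod (f x) * cmod (g x) \<le> M * N"
      using assms(3)[of x] * order_trans[OF norm_ge_zero assms(3)[of x]] by (intro mult_mono) auto
    then show "cmod (f x * g x) \<le> M * N" by (simp add: norm_mult)
  qed (use * in auto)
qed

lemma tame_mult_right: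
  assumes "tame g" "f \<in> borel_measurable borel" "\<And>x. cmod (f x) \<le> M"
  shows "tame (\<lambda>x. g x * f x)"
  using tame_mult[OF assms] by (simp add: mult.commute)

lemma tame_zero [simp]: "tame (\<lambda>x. 0)"
  by (rule tameI[where M = 0 and R = 0]) auto

lemma tame_const_mult: "tame g \<Longrightarrow> tame (\<lambda>x. c * g x)"
  by (rule tame_mult[where M = "cmod c"]) auto

lemma tame_add:
  assumes "tame f" "tame g" shows "tame (\<lambda>x. f x + g x)"
proof -
  obtain N R where *: "\<And>x. cmod (g x) \<le> N" "\<And>x. g x \<noteq> 0 \<Longrightarrow> norm x \<le> R"
    using tameE[OF assms(2)] by metis
  obtain N' R' where **: "\<And>x. cmod (f x) \<le> N'" "\<And>x. f x \<noteq> 0 \<Longrightarrow> norm x \<le> R'"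
    using tameE[OF assms(1)] by metis
  note [measurable] = tame_measurable[OF assms(1)] tame_measurable[OF assms(2)]
  show ?thesis
  proof (rule tameI[where M = "N' + N" and R = "max R R'"])
    fix x
    show "cmod (f x + g x) \<le> N' + N"
      using *(1)[of x] **(1)[of x] norm_triangle_ineq[of "f x" "g x"] by linarith
    show "norm x \<le> max R R'" if "f x + g x \<noteq> 0"
      using that *(2)[of x] **(2)[of x] by (cases "f x = 0") fastforce+
  qed auto
qed

lemma tame_diff: "tame f \<Longrightarrow> tame g \<Longrightarrow> tame (\<lambda>x. f x - g x)"
  using tame_add[of f "\<lambda>x. - 1 * g x"] tame_const_mult[of g "- 1"] by simp

lemma tame_sum: "(\<And>i. i \<in> I \<Longrightarrow> tame (f i)) \<Longrightarrow> tame (\<lambda>x. \<Sum>i\<in>I. f i x)"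
  by (induction I rule: infinite_finite_induct) (auto intro: tame_add)

lemma tame_integrable:
  assumes "tame g" shows "integrable lborel g"
proof -
  obtain M R where *: "\<And>x. cmod (g x) \<le> M" "\<And>x. g x \<noteq> 0 \<Longrightarrow> norm x \<le> R"
    using tameE[OF assms] by metis
  note [measurable] = tame_measurable[OF assms(1)]
  show ?thesis
  proof (rule integrableI_bounded_set[where A = "cball 0 R" and B = M])
    show "emeasure lborel (cball (0::'a) R) < \<infinity>" by (rule emeasure_lborel_cball_finite)
    show "AE x in lborel. x \<in> cball 0 R \<longrightarrow> norm (g x) \<le> M" using * by auto
    show "AE x in lborel. x \<notin> cball 0 R \<longrightarrow> g x = 0" using * by fastforce
  qed auto
qed

lemma tame_cnj:
  assumes "tame g" shows "tame (\<lambda>x. cnj (g x))"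
proof -
  obtain M R where *: "\<And>x. cmod (g x) \<le> M" "\<And>x. g x \<noteq> 0 \<Longrightarrow> norm x \<le> R"
    using tameE[OF assms] by metis
  note [measurable] = tame_measurable[OF assms(1)]
  show ?thesis
    by (rule tameI[where M = M and R = R]) (use * in auto)
qed

lemma tame_L2:
  assumes "tame g" shows "L2 g"
proof -
  obtain M R where *: "\<And>x. cmod (g x) \<le> M" "\<And>x. g x \<noteq> 0 \<Longrightarrow> norm x \<le> R"
    using tameE[OF assms] by metis
  note [measurable] = tame_measurable[OF assms(1)]
  have "integrable lborel (\<lambda>x. cmod (cnj (g x) * g x))"
    using tame_mult[OF assms, of "\<lambda>x. cnj (g x)" M] * by (intro integrable_norm tame_integrable) auto
  then show ?thesis by (simp add: L2_def norm_mult power2_eq_square)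
qed

lemma tame_transform_integrable:
  assumes "tame g" shows "integrable lborel (\<lambda>\<xi>. g \<xi> * cis (2 * pi * (x \<bullet> \<xi>)))"
  using assms
  by (intro tame_integrable tame_mult_right[where M = 1])
    (auto intro!: borel_measurable_continuous_onI continuous_intros)

lemma inv_fourier_add:
  "tame f \<Longrightarrow> tame g \<Longrightarrow> inv_fourier (\<lambda>\<xi>. f \<xi> + g \<xi>) x = inv_fourier f x + inv_fourier g x"
  by (simp add: inv_fourier_def distrib_right tame_transform_integrable)

lemma inv_fourier_diff:
  "tame f \<Longrightarrow> tame g \<Longrightarrow> inv_fourier (\<lambda>\<xi>. f \<xi> - g \<xi>) x = inv_fourier f x - inv_fourier g x"
  by (simp add: inv_fourier_def left_diff_distrib tame_transform_integrable)

lemma inv_fourier_mult_const: "inv_fourier (\<lambda>\<xi>. c * g \<xi>) x = c * inv_fourier g x"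
  by (simp add: inv_fourier_def mult.assoc)

lemma inv_fourier_sum:
  "(\<And>i. i \<in> I \<Longrightarrow> tame (f i)) \<Longrightarrow> inv_fourier (\<lambda>\<xi>. \<Sum>i\<in>I. f i \<xi>) x = (\<Sum>i\<in>I. inv_fourier (f i) x)"
  by (simp add: inv_fourier_def sum_distrib_right tame_transform_integrable)

lemma inv_fourier_measurable [measurable (raw)]:
  assumes "g \<in> borel_measurable borel"
  shows "inv_fourier g \<in> borel_measurable borel"
proof -
  note [measurable] = assms
  have "(\<lambda>x. LINT \<xi>|lborel. g \<xi> * cis (2 * pi * (x \<bullet> \<xi>))) \<in> borel_measurable borel"
    by (rule lborel.borel_measurable_lebesgue_integral) measurable
  then show ?thesis by (simp add: inv_fourier_def[abs_def])
qed

section \<open>Fourier series on the unit cell\<close>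

definition unit_cell :: "(real \<times> real) set" where
  "unit_cell = {y. \<bar>fst y\<bar> \<le> 1/2 \<and> \<bar>snd y\<bar> \<le> 1/2}"

definition character :: "int \<times> int \<Rightarrow> real \<times> real \<Rightarrow> complex" where
  "character k y = cis (2 * pi * (y \<bullet> lattice k))"

text \<open>Cutting the characters off outside the cell makes them an orthonormal system of
  square-integrable functions on the plane, so that the cell needs no measure of its own.\<close>

definition cell_mode :: "int \<times> int \<Rightarrow> real \<times> real \<Rightarrow> complex" where
  "cell_mode k y = indicator unit_cell y * character k y"

lemma unit_cell_eq_cbox: "unit_cell = cbox (-1/2, -1/2) (1/2, 1/2)"
  unfolding unit_cell_def cbox_Pair_eq by (auto simp: abs_le_iff)

lemma unit_cell_eq_Times: "unit_cell = {-1/2..1/2} \<times> {-1/2..1/2}"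
  unfolding unit_cell_def by (auto simp: abs_le_iff)

lemma unit_cell_sets [measurable]: "unit_cell \<in> sets borel"
  unfolding unit_cell_eq_cbox by simp

lemma norm_le_of_unit_cell: "y \<in> unit_cell \<Longrightarrow> norm y \<le> 1"
proof -
  assume "y \<in> unit_cell"
  moreover have "norm y \<le> \<bar>fst y\<bar> + \<bar>snd y\<bar>"
    using norm_Pair_le[of "fst y" "snd y"] by simp
  ultimately show ?thesis by (auto simp: unit_cell_def)
qed

lemma integrable_unit_cell: "integrable lborel (indicator unit_cell :: _ \<Rightarrow> real)"
  using emeasure_lborel_cbox_finite unfolding unit_cell_eq_cbox
  by (intro integrable_real_indicator) auto

lemma measure_unit_cell: "(LINT y|lborel. indicator unit_cell y) = (1::real)"
  unfolding unit_cell_eq_cbox by (simp add: content_Pair)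

lemma character_measurable [measurable]: "character k \<in> borel_measurable borel"
  unfolding character_def[abs_def]
  by (intro borel_measurable_continuous_onI continuous_intros)

lemma norm_character [simp]: "cmod (character k y) = 1"
  by (simp add: character_def)

lemma character_add: "character (k + l) y = character k y * character l y"
  by (simp add: character_def lattice_def cis_mult inner_prod_def algebra_simps)

lemma character_zero: "character 0 y = 1"
  by (simp add: character_def lattice_def inner_prod_def)

lemma cnj_character: "cnj (character k y) = character (- k) y"
  by (simp add: character_def lattice_def cis_cnj inner_prod_def algebra_simps)

lemma tame_cell: "f \<in> borel_measurable borel \<Longrightarrow> (\<And>y. cmod (f y) \<le> M) \<Longrightarrow>
    tame (\<lambda>y. indicator unit_cell y * f y)"
  using norm_le_of_unit_cell order_trans[OF norm_ge_zero, of "f _" M]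
  by (intro tameI[where M = M and R = 1]) (auto simp: indicator_def)

lemma tame_cell_mode [simp]: "tame (cell_mode k)"
  unfolding cell_mode_def[abs_def] by (intro tame_cell[where M = 1]) auto

lemma L2_cell_mode [simp]: "L2 (cell_mode k)"
  by (simp add: tame_L2)

lemma integral_cis_period:
  "(LINT x|lborel. indicator {-1/2..1/2} x * cis (2 * pi * of_int n * x)) = (if n = 0 then 1 else 0)"
proof (cases "n = 0")
  case True
  have "(LINT x|lborel. complex_of_real (indicator {-1/2..1/2::real} x)) = 1"
    unfolding integral_complex_of_real by simp
  with True show ?thesis by (simp add: of_real_indicator)
next
  case False
  define F where "F = (\<lambda>x::real. cis (2 * pi * of_int n * x) / (2 * pi * of_int n * \<i>))"
  have "(F has_vector_derivative cis (2 * pi * of_int n * x)) (at x within A)" for x A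
    unfolding F_def cis_conv_exp using False
    by (auto intro!: derivative_eq_intros has_vector_derivative_real_field simp: field_simps)
  then have "(\<integral>x. indicator {-1/2..1/2} x *\<^sub>R cis (2 * pi * of_int n * x) \<partial>lborel) = F (1/2) - F (-1/2)"
    by (intro integral_FTC_Icc) (auto intro!: continuous_intros)
  also have "F (1/2) - F (-1/2) = 0"
  proof -
    have "cis (pi * of_int n) = cis (- (pi * of_int n) + 2 * pi * of_int n)"
      by simp
    also have "\<dots> = cis (- (pi * of_int n))"
      by (simp only: cis_mult[symmetric] cis_multiple_2pi[OF Ints_of_int]) simp
    finally show ?thesis by (simp add: F_def)
  qed
  moreover have "indicator {-1/2..1/2} x *\<^sub>R z = indicator {-1/2..1/2} x * z" for x :: real and z :: complex
    by (auto simp: indicator_def)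
  ultimately show ?thesis using False by (simp only: if_False)
qed

lemma integral_cell_character:
  "(LINT y|lborel. indicator unit_cell y * character k y) = (if k = 0 then 1 else 0)"
proof -
  have I: "integrable (lborel \<Otimes>\<^sub>M lborel) (\<lambda>y. indicator unit_cell y * character k y)"
    using tame_integrable[OF tame_cell_mode[of k]]
    by (simp add: lborel_prod cell_mode_def[abs_def])
  have "(LINT y|lborel. indicator unit_cell y * character k y)
      = (LINT a|lborel. LINT b|lborel. indicator unit_cell (a, b) * character k (a, b))"
    using lborel_pair.integral_fst'[OF I] by (simp add: lborel_prod)
  also have "\<dots> = (LINT a|lborel. LINT b|lborel. (indicator {-1/2..1/2} a * cis (2 * pi * of_int (fst k) * a))
      * (indicator {-1/2..1/2} b * cis (2 * pi * of_int (snd k) * b)))"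
    by (intro Bochner_Integration.integral_cong refl)
      (auto simp: unit_cell_eq_Times indicator_times character_def lattice_def inner_prod_def
        cis_mult algebra_simps)
  also have "\<dots> = (LINT a|lborel. indicator {-1/2..1/2} a * cis (2 * pi * of_int (fst k) * a))
      * (LINT b|lborel. indicator {-1/2..1/2} b * cis (2 * pi * of_int (snd k) * b))"
    by (simp only: integral_mult_right_zero integral_mult_left_zero)
  also have "\<dots> = (if k = 0 then 1 else 0)"
    unfolding integral_cis_period by (auto simp: prod_eq_iff)
  finally show ?thesis .
qed

lemma cell_mode_orthonormal: "L2_inner (cell_mode k) (cell_mode l) = (if k = l then 1 else 0)"
proof -
  have "L2_inner (cell_mode k) (cell_mode l)
      = (LINT y|lborel. indicator unit_cell y * character (k - l) y)"
    unfolding L2_inner_def cell_mode_def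
    by (intro Bochner_Integration.integral_cong refl)
      (auto simp: cnj_character character_add[symmetric] indicator_def)
  then show ?thesis by (auto simp: integral_cell_character)
qed

lemma energy_cell_diff_modes:
  assumes "L2 h" "finite F"
  shows "energy (\<lambda>y. h y - (\<Sum>k\<in>F. c k * cell_mode k y))
       = energy h - (\<Sum>k\<in>F. (cmod (L2_inner h (cell_mode k)))\<^sup>2)
         + (\<Sum>k\<in>F. (cmod (c k - L2_inner h (cell_mode k)))\<^sup>2)"
  by (rule energy_diff_orthonormal) (use assms in \<open>auto simp: cell_mode_orthonormal\<close>)

subsection \<open>Trigonometric polynomials are uniformly dense\<close>

inductive trig_poly :: "(real \<times> real \<Rightarrow> complex) \<Rightarrow> bool" where
  character: "trig_poly (\<lambda>y. c * character k y)"
| add: "trig_poly p \<Longrightarrow> trig_poly q \<Longrightarrow> trig_poly (\<lambda>y. p y + q y)"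

lemma trig_poly_const: "trig_poly (\<lambda>y. c)"
  using trig_poly.character[of c 0] by (simp add: character_zero)

lemma trig_poly_cmult: "trig_poly p \<Longrightarrow> trig_poly (\<lambda>y. c * p y)"
proof (induction rule: trig_poly.induct)
  case (character d k)
  then show ?case using trig_poly.character[of "c * d" k] by (simp add: mult.assoc)
qed (auto simp: distrib_left intro: trig_poly.add)

lemma trig_poly_mult: "trig_poly p \<Longrightarrow> trig_poly q \<Longrightarrow> trig_poly (\<lambda>y. p y * q y)"
proof (induction rule: trig_poly.induct)
  case (character c k)
  from character.prems show ?case
  proof (induction rule: trig_poly.induct)
    case (character d l)
    then show ?case
      using trig_poly.character[of "c * d" "k + l"] by (simp add: character_add ac_simps)
  qed (auto simp: distrib_left intro: trig_poly.add)
qed (auto simp: distrib_right intro: trig_poly.add)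

lemma trig_poly_sum_of_characters:
  "trig_poly p \<Longrightarrow> \<exists>F c. finite F \<and> p = (\<lambda>y. \<Sum>k\<in>F. c k * character k y)"
proof (induction rule: trig_poly.induct)
  case (character c k)
  show ?case by (rule exI[of _ "{k}"], rule exI[of _ "\<lambda>_. c"]) simp
next
  case (add p q)
  then obtain F c G d where *: "finite F" "p = (\<lambda>y. \<Sum>k\<in>F. c k * character k y)"
    "finite G" "q = (\<lambda>y. \<Sum>k\<in>G. d k * character k y)" by blast
  let ?e = "\<lambda>k. (if k \<in> F then c k else 0) + (if k \<in> G then d k else 0)"
  have "p y + q y = (\<Sum>k\<in>F \<union> G. ?e k * character k y)" for y
  proof -
    have "p y = (\<Sum>k\<in>F \<union> G. (if k \<in> F then c k else 0) * character k y)"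
      using * by (auto intro!: sum.mono_neutral_cong_left)
    moreover have "q y = (\<Sum>k\<in>F \<union> G. (if k \<in> G then d k else 0) * character k y)"
      using * by (auto intro!: sum.mono_neutral_cong_left)
    ultimately show ?thesis by (simp add: distrib_right sum.distrib)
  qed
  then show ?case
    using * by (intro exI[of _ "F \<union> G"] exI[of _ ?e]) auto
qed

definition torus_map :: "real \<times> real \<Rightarrow> complex \<times> complex" where
  "torus_map y = (cis (2 * pi * fst y), cis (2 * pi * snd y))"

lemma trig_poly_cos: "trig_poly (\<lambda>y. of_real (cos (2 * pi * fst y)))"
    "trig_poly (\<lambda>y. of_real (cos (2 * pi * snd y)))"
    "trig_poly (\<lambda>y. of_real (sin (2 * pi * fst y)))"
    "trig_poly (\<lambda>y. of_real (sin (2 * pi * snd y)))"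
proof -
  have c: "of_real (cos t) = 1/2 * cis t + 1/2 * cis (- t)"
    and s: "of_real (sin t) = (- \<i> / 2) * cis t + (\<i> / 2) * cis (- t)" for t
    by (auto simp: complex_eq_iff)
  have fst: "cis (2 * pi * fst y) = character (1, 0) y" "cis (- (2 * pi * fst y)) = character (- 1, 0) y"
    and snd: "cis (2 * pi * snd y) = character (0, 1) y" "cis (- (2 * pi * snd y)) = character (0, - 1) y"
    for y by (auto simp: character_def lattice_def inner_prod_def)
  show "trig_poly (\<lambda>y. of_real (cos (2 * pi * fst y)))"
    "trig_poly (\<lambda>y. of_real (cos (2 * pi * snd y)))"
    "trig_poly (\<lambda>y. of_real (sin (2 * pi * fst y)))"
    "trig_poly (\<lambda>y. of_real (sin (2 * pi * snd y)))"
    unfolding c s fst snd by (intro trig_poly.intros)+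
qed

lemma trig_poly_real_polynomial:
  "real_polynomial_function f \<Longrightarrow> trig_poly (\<lambda>y. of_real (f (torus_map y)))"
proof (induction rule: real_polynomial_function.induct)
  case (linear f)
  interpret f: bounded_linear f by fact
  define a b c d where "a = f (1, 0)" and "b = f (\<i>, 0)" and "c = f (0, 1)" and "d = f (0, \<i>)"
  have f_eq: "f (z, w) = Re z * a + Im z * b + (Re w * c + Im w * d)" for z w
  proof -
    have zw: "(z, w) = Re z *\<^sub>R (1, 0) + Im z *\<^sub>R (\<i>, 0) + (Re w *\<^sub>R (0, 1) + Im w *\<^sub>R (0, \<i>))"
      by (simp add: complex_eq_iff)
    show ?thesis
      by (subst zw) (simp only: f.add f.scaleR real_scaleR_def a_def b_def c_def d_def)
  qed
  have "(\<lambda>y. complex_of_real (f (torus_map y)))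
      = (\<lambda>y. (of_real a * of_real (cos (2 * pi * fst y)) + of_real b * of_real (sin (2 * pi * fst y)))
        + (of_real c * of_real (cos (2 * pi * snd y)) + of_real d * of_real (sin (2 * pi * snd y))))"
    by (simp add: torus_map_def f_eq mult.commute)
  then show ?case by (simp only:) (intro trig_poly.add trig_poly_cmult trig_poly_cos)
qed (auto intro: trig_poly_const trig_poly.add trig_poly_mult)

text \<open>A function on the cell that vanishes on the boundary is the pull-back of a function on the
  torus; since the cell is compact, continuity descends, and the Stone-Weierstrass theorem
  applies on the torus.\<close>

lemma trig_poly_dense:
  assumes cont: "continuous_on unit_cell h" and e: "e > 0"
    and bdry: "\<And>y. y \<in> unit_cell \<Longrightarrow> \<bar>fst y\<bar> = 1/2 \<or> \<bar>snd y\<bar> = 1/2 \<Longrightarrow> h y = 0"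
  obtains p where "trig_poly p" "\<And>y. y \<in> unit_cell \<Longrightarrow> cmod (h y - p y) < e"
proof -
  define X where "X = torus_map ` unit_cell"
  define H where "H = (\<lambda>z. h (inv_into unit_cell torus_map z))"
  have cmp: "compact unit_cell" by (simp add: unit_cell_eq_cbox)
  have ct: "continuous_on A torus_map" for A
    unfolding torus_map_def by (intro continuous_intros)
  have X: "compact X" unfolding X_def by (rule compact_continuous_image[OF ct cmp])
  have 1: "a = b \<or> (\<bar>a\<bar> = 1/2 \<and> \<bar>b\<bar> = 1/2)"
    if "cis (2 * pi * a) = cis (2 * pi * b)" "\<bar>a\<bar> \<le> 1/2" "\<bar>b\<bar> \<le> 1/2" for a b :: real
  proof -
    have "sin (2 * pi * a) = sin (2 * pi * b) \<and> cos (2 * pi * a) = cos (2 * pi * b)"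
      using that(1) by (simp add: complex_eq_iff)
    then obtain n :: int where "2 * pi * a = 2 * pi * b + 2 * pi * n"
      unfolding sin_cos_eq_iff by blast
    then have "2 * pi * a = 2 * pi * (b + n)" by (simp add: algebra_simps)
    then have n: "a = b + n" by simp
    then have "\<bar>real_of_int n\<bar> \<le> 1" using that by linarith
    then have "n \<in> {-1, 0, 1}" by auto
    then show ?thesis using n that(2,3) by auto
  qed
  have eq: "h y = h y'" if "torus_map y = torus_map y'" "y \<in> unit_cell" "y' \<in> unit_cell" for y y'
  proof (cases "y = y'")
    case False
    have "fst y = fst y' \<or> (\<bar>fst y\<bar> = 1/2 \<and> \<bar>fst y'\<bar> = 1/2)"
      "snd y = snd y' \<or> (\<bar>snd y\<bar> = 1/2 \<and> \<bar>snd y'\<bar> = 1/2)"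
      using that unfolding torus_map_def unit_cell_def by (intro 1; simp)+
    then show ?thesis using False that bdry[of y] bdry[of y'] by (auto simp: prod_eq_iff)
  qed simp
  have Ht: "H (torus_map y) = h y" if "y \<in> unit_cell" for y
    unfolding H_def using that
    by (intro eq) (auto intro!: f_inv_into_f inv_into_into)
  have "continuous_on X H"
    unfolding continuous_on_closed_vimage[OF compact_imp_closed[OF X]]
  proof (intro allI impI)
    fix B :: "complex set" assume "closed B"
    then have "closed (h -` B \<inter> unit_cell)"
      using cont compact_imp_closed[OF cmp] continuous_on_closed_vimage by blast
    then have "compact (unit_cell \<inter> (h -` B \<inter> unit_cell))"
      using cmp by (intro compact_Int_closed)
    then have "compact (torus_map ` (unit_cell \<inter> (h -` B \<inter> unit_cell)))"
      by (rule compact_continuous_image[OF ct])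
    also have "torus_map ` (unit_cell \<inter> (h -` B \<inter> unit_cell)) = H -` B \<inter> X"
      using Ht by (auto simp: X_def)
    finally show "closed (H -` B \<inter> X)" by (rule compact_imp_closed)
  qed
  then obtain g where g: "polynomial_function g" "\<And>z. z \<in> X \<Longrightarrow> cmod (H z - g z) < e"
    using Stone_Weierstrass_polynomial_function[OF X _ e, of H] by blast
  have "trig_poly (\<lambda>y. of_real (Re (g (torus_map y))) + \<i> * of_real (Im (g (torus_map y))))"
    using g(1) trig_poly_real_polynomial[of "Re \<circ> g"] trig_poly_real_polynomial[of "Im \<circ> g"]
    by (intro trig_poly.add trig_poly_cmult)
      (auto simp: polynomial_function_def bounded_linear_Re bounded_linear_Im)
  then have "trig_poly (\<lambda>y. g (torus_map y))"
    by (simp add: complex_eq[symmetric])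
  moreover have "cmod (h y - g (torus_map y)) < e" if "y \<in> unit_cell" for y
    using g(2)[of "torus_map y"] that by (simp add: X_def Ht)
  ultimately show ?thesis by (rule that)
qed

subsection \<open>Mean-square convergence of Fourier series\<close>

text \<open>A measurable function is an almost everywhere limit of continuous functions. Clamping their
  values gives a common bound for dominated convergence, and cut-off functions that tend to one
  inside the cell make them vanish on its boundary, as the passage to the torus requires.\<close>

lemma continuous_approximation_on_cell:
  assumes h: "tame h" and supp: "\<And>y. y \<notin> unit_cell \<Longrightarrow> h y = 0" and e: "e > 0"
  obtains g where "continuous_on UNIV g" "tame g" "energy (\<lambda>y. h y - g y) < e"
    "\<And>y. \<bar>fst y\<bar> \<ge> 1/2 \<or> \<bar>snd y\<bar> \<ge> 1/2 \<Longrightarrow> g y = 0"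
proof -
  obtain M where M: "M > 0" "\<And>y. cmod (h y) \<le> M"
    using tameE[OF h] by metis
  note [measurable] = tame_measurable[OF h]
  have "h measurable_on UNIV"
    by (rule lebesgue_measurable_imp_measurable_on) (auto intro!: measurable_completion)
  then obtain N g where N: "negligible N" and gc: "\<And>n. continuous_on UNIV (g n)"
    and lim: "\<And>x. x \<notin> N \<Longrightarrow> (\<lambda>n. g n x) \<longlonglongrightarrow> h x"
    unfolding measurable_on_def by auto
  define clamp where "clamp = (\<lambda>z. Complex (max (- M) (min M (Re z))) (max (- M) (min M (Im z))))"
  define chi where "chi = (\<lambda>n::nat. \<lambda>y::real \<times> real. min 1 (real n * (max 0 (1/2 - \<bar>fst y\<bar>) * max 0 (1/2 - \<bar>snd y\<bar>))))"
  define G where "G = (\<lambda>n y. of_real (chi n y) * clamp (g n y))"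
  have cc: "continuous_on A clamp" for A
    unfolding clamp_def Complex_eq by (intro continuous_intros)
  have clampM: "cmod (clamp z) \<le> 2 * M" for z
    using cmod_le[of "clamp z"] M(1) unfolding clamp_def complex.sel by linarith
  have clamp_id: "clamp z = z" if "cmod z \<le> M" for z
    using that abs_Re_le_cmod[of z] abs_Im_le_cmod[of z] M(1)
    by (auto simp: clamp_def complex_eq_iff)
  have chi01: "0 \<le> chi n y" "chi n y \<le> 1" for n y by (auto simp: chi_def)
  have Gc: "continuous_on UNIV (G n)" for n
    unfolding G_def chi_def
    by (intro continuous_intros continuous_on_compose2[OF cc gc]) auto
  have [measurable]: "G n \<in> borel_measurable borel" for n
    using Gc by (rule borel_measurable_continuous_onI)
  have G0: "G n y = 0" if "\<bar>fst y\<bar> \<ge> 1/2 \<or> \<bar>snd y\<bar> \<ge> 1/2" for n y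
    using that by (auto simp: G_def chi_def)
  have Gout: "G n y = 0" if "y \<notin> unit_cell" for n y
    using that by (intro G0) (auto simp: unit_cell_def)
  have Gb: "cmod (G n y) \<le> 2 * M" for n y
    using mult_mono[OF chi01(2)[of n y] clampM[of "g n y"]] chi01 M(1)
    by (simp add: G_def norm_mult)
  have Gt: "tame (G n)" for n
  proof (rule tameI[where M = "2 * M" and R = 1])
    show "norm y \<le> 1" if "G n y \<noteq> 0" for y
      using that Gout norm_le_of_unit_cell by metis
  qed (use Gb in auto)
  define bd :: "(real \<times> real) set" where "bd = cbox (-1/2, -1/2) (1/2, 1/2) - box (-1/2, -1/2) (1/2, 1/2)"
  have "negligible (N \<union> bd)"
    using N negligible_frontier_interval unfolding bd_def by (intro negligible_Un) auto
  then have "AE y in lebesgue. y \<notin> N \<union> bd"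
    by (intro AE_not_in) (simp add: negligible_iff_null_sets)
  then have "AE y in lebesgue. (\<lambda>n. (cmod (h y - G n y))\<^sup>2) \<longlonglongrightarrow> (cmod (h y - h y))\<^sup>2"
  proof (rule AE_mp, intro AE_I2 impI)
    fix y assume y: "y \<notin> N \<union> bd"
    have "(\<lambda>n. G n y) \<longlonglongrightarrow> h y"
    proof (cases "y \<in> unit_cell")
      case False
      then show ?thesis using supp Gout by simp
    next
      case True
      then have "y \<in> box (-1/2, -1/2) (1/2, 1/2)"
        using y by (auto simp: unit_cell_eq_cbox bd_def)
      then have "y \<in> {-1/2<..<1/2} \<times> {-1/2<..<1/2}"
        by (auto simp: mem_box Basis_prod_def mem_Times_iff inner_prod_def)
      then have *: "0 < max 0 (1/2 - \<bar>fst y\<bar>) * max 0 (1/2 - \<bar>snd y\<bar>)" (is "0 < ?r")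
        by (intro mult_pos_pos) (auto simp: abs_if)
      obtain m where m: "1 / ?r \<le> real m"
        using real_arch_simple by blast
      have "eventually (\<lambda>n. 1 / ?r \<le> real n) sequentially"
        by (intro eventually_sequentiallyI[of m] order_trans[OF m]) simp
      then have "eventually (\<lambda>n. chi n y = 1) sequentially"
        by (rule eventually_mono) (use * in \<open>simp only: chi_def pos_divide_le_eq min_absorb1\<close>)
      then have "(\<lambda>n. chi n y) \<longlonglongrightarrow> 1"
        by (rule tendsto_eventually)
      moreover have "(\<lambda>n. clamp (g n y)) \<longlonglongrightarrow> clamp (h y)"
        using cc[of UNIV] lim[of y] y
        by (intro continuous_on_tendsto_compose[of UNIV clamp]) auto
      ultimately have "(\<lambda>n. G n y) \<longlonglongrightarrow> of_real 1 * clamp (h y)"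
        unfolding G_def by (intro tendsto_intros)
      then show ?thesis using clamp_id M(2) by simp
    qed
    then show "(\<lambda>n. (cmod (h y - G n y))\<^sup>2) \<longlonglongrightarrow> (cmod (h y - h y))\<^sup>2"
      by (intro tendsto_intros)
  qed
  then have ae: "AE y in lborel. (\<lambda>n. (cmod (h y - G n y))\<^sup>2) \<longlonglongrightarrow> 0"
    by (subst (asm) AE_completion_iff) auto
  have "(\<lambda>n. energy (\<lambda>y. h y - G n y)) \<longlonglongrightarrow> (LINT y|(lborel::(real\<times>real) measure). 0)"
    unfolding energy_def
  proof (rule integral_dominated_convergence[where w = "\<lambda>y. (3 * M)\<^sup>2 * indicator unit_cell y"])
    show "integrable lborel (\<lambda>y. (3 * M)\<^sup>2 * indicator unit_cell y :: real)"
      by (intro integrable_mult_right integrable_unit_cell)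
    show "AE y in lborel. norm ((cmod (h y - G n y))\<^sup>2) \<le> (3 * M)\<^sup>2 * indicator unit_cell y" for n
    proof (rule AE_I2)
      fix y
      have "cmod (h y - G n y) \<le> 3 * M"
        using norm_triangle_ineq4[of "h y" "G n y"] M(2)[of y] Gb[of n y] by linarith
      then have "(cmod (h y - G n y))\<^sup>2 \<le> (3 * M)\<^sup>2" by (intro power_mono) auto
      then show "norm ((cmod (h y - G n y))\<^sup>2) \<le> (3 * M)\<^sup>2 * indicator unit_cell y"
        using supp[of y] Gout[of y n] by (auto simp: indicator_def)
    qed
  qed (use ae in auto)
  then have "eventually (\<lambda>n. energy (\<lambda>y. h y - G n y) < e) sequentially"
    using e by (intro order_tendstoD(2)[of _ 0]) auto
  then obtain n where "energy (\<lambda>y. h y - G n y) < e"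
    by (auto simp: eventually_sequentially)
  then show ?thesis using that[of "G n"] Gc Gt G0 by blast
qed

abbreviation fourier_sum :: "(real \<times> real \<Rightarrow> complex) \<Rightarrow> (int \<times> int) set \<Rightarrow> real \<times> real \<Rightarrow> complex" where
  "fourier_sum h F y \<equiv> \<Sum>k\<in>F. L2_inner h (cell_mode k) * cell_mode k y"

text \<open>The Fourier sums are best approximations and improve as the index set grows. It is therefore
  enough to find one trigonometric polynomial close to \<open>h\<close>.\<close>

theorem fourier_series_converges:
  assumes h: "tame h" and supp: "\<And>y. y \<notin> unit_cell \<Longrightarrow> h y = 0"
  shows "((\<lambda>F. energy (\<lambda>y. h y - fourier_sum h F y)) \<longlongrightarrow> 0)
    (finite_subsets_at_top UNIV)"
proof (rule tendstoI)
  fix e :: real assume e: "e > 0"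
  obtain g where g: "continuous_on UNIV g" "tame g" "energy (\<lambda>y. h y - g y) < e / 4"
    "\<And>y. \<bar>fst y\<bar> \<ge> 1/2 \<or> \<bar>snd y\<bar> \<ge> 1/2 \<Longrightarrow> g y = 0"
    using continuous_approximation_on_cell[OF h supp, of "e / 4"] e by auto
  obtain p where p: "trig_poly p" "\<And>y. y \<in> unit_cell \<Longrightarrow> cmod (g y - p y) < sqrt (e / 5)"
  proof (rule trig_poly_dense[of g "sqrt (e / 5)"])
    show "g y = 0" if "\<bar>fst y\<bar> = 1/2 \<or> \<bar>snd y\<bar> = 1/2" for y using that by (intro g(4)) auto
  qed (use g e in \<open>auto intro: continuous_on_subset\<close>)
  obtain F0 c where F0: "finite F0" and pc: "p = (\<lambda>y. \<Sum>k\<in>F0. c k * character k y)"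
    using trig_poly_sum_of_characters[OF p(1)] by blast
  define P where "P = (\<lambda>y. \<Sum>k\<in>F0. c k * cell_mode k y)"
  have Pp: "P y = indicator unit_cell y * p y" for y
    by (simp add: P_def pc cell_mode_def sum_distrib_left ac_simps)
  have tP: "tame P" unfolding P_def by (intro tame_sum tame_const_mult tame_cell_mode)
  have "energy (\<lambda>y. g y - P y) \<le> (LINT y|lborel. e / 5 * indicator unit_cell y)"
    unfolding energy_def
  proof (rule integral_mono)
    show "integrable lborel (\<lambda>y. (cmod (g y - P y))\<^sup>2)"
      using tame_L2[OF tame_diff[OF g(2) tP]] by (simp add: L2_def)
    show "integrable lborel (\<lambda>y. e / 5 * indicator unit_cell y :: real)"
      by (intro integrable_mult_right integrable_unit_cell)
    show "(cmod (g y - P y))\<^sup>2 \<le> e / 5 * indicator unit_cell y" for y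
    proof (cases "y \<in> unit_cell")
      case True
      then have "(cmod (g y - p y))\<^sup>2 \<le> (sqrt (e / 5))\<^sup>2"
        using p(2)[of y] by (intro power_mono) auto
      then show ?thesis using True e by (simp add: Pp)
    next
      case False
      then show ?thesis using g(4)[of y] by (simp add: Pp) (auto simp: unit_cell_def)
    qed
  qed
  also have "\<dots> = e / 5" using measure_unit_cell by simp
  finally have gP: "energy (\<lambda>y. g y - P y) \<le> e / 5" .
  have "energy (\<lambda>y. h y - P y) \<le> 2 * energy (\<lambda>y. h y - g y) + 2 * energy (\<lambda>y. g y - P y)"
    using energy_add_le[of "\<lambda>y. h y - g y" "\<lambda>y. g y - P y"] h g(2) tP
    by (simp add: tame_L2 tame_diff)
  also have "\<dots> < e" using g(3) gP e by simp
  finally have hP: "energy (\<lambda>y. h y - P y) < e" .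
  have hL: "L2 h" using h by (rule tame_L2)
  show "eventually (\<lambda>F. dist (energy (\<lambda>y. h y - fourier_sum h F y)) 0 < e)
    (finite_subsets_at_top UNIV)"
    unfolding eventually_finite_subsets_at_top
  proof (intro exI[of _ F0] conjI allI impI)
    fix F assume F: "finite F \<and> F0 \<subseteq> F \<and> F \<subseteq> (UNIV :: (int \<times> int) set)"
    have "energy (\<lambda>y. h y - fourier_sum h F y)
        = energy h - (\<Sum>k\<in>F. (cmod (L2_inner h (cell_mode k)))\<^sup>2)"
      using F by (simp add: energy_cell_diff_modes[OF hL])
    also have "\<dots> \<le> energy h - (\<Sum>k\<in>F0. (cmod (L2_inner h (cell_mode k)))\<^sup>2)"
      using F by (auto intro!: sum_mono2)
    also have "\<dots> \<le> energy (\<lambda>y. h y - P y)"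
      unfolding P_def energy_cell_diff_modes[OF hL F0] by (simp add: sum_nonneg)
    finally show "dist (energy (\<lambda>y. h y - fourier_sum h F y)) 0 < e"
      using hP by simp
  qed (use F0 in auto)
qed

theorem parseval_cell:
  assumes h: "tame h" and supp: "\<And>y. y \<notin> unit_cell \<Longrightarrow> h y = 0"
  shows "(\<integral>\<^sup>+k. ennreal ((cmod (L2_inner h (cell_mode k)))\<^sup>2) \<partial>count_space UNIV) = ennreal (energy h)"
proof -
  let ?c = "\<lambda>k. (cmod (L2_inner h (cell_mode k)))\<^sup>2"
  have "((\<lambda>F. energy h - (energy (\<lambda>y. h y - fourier_sum h F y)))
      \<longlongrightarrow> energy h - 0) (finite_subsets_at_top UNIV)"
    by (intro tendsto_intros fourier_series_converges assms)
  moreover have "eventually (\<lambda>F. energy h - (energy (\<lambda>y. h y - fourier_sum h F y))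
      = sum ?c F) (finite_subsets_at_top UNIV)"
    by (rule eventually_finite_subsets_at_top_weakI)
      (simp add: energy_cell_diff_modes[OF tame_L2[OF h]])
  ultimately have "(sum ?c \<longlongrightarrow> energy h) (finite_subsets_at_top UNIV)"
    unfolding diff_zero by (rule Lim_transform_eventually)
  then have hs: "(?c has_sum energy h) UNIV"
    by (simp add: has_sum_def)
  define b where "b = from_nat_into (UNIV :: (int \<times> int) set)"
  have b: "bij_betw b UNIV UNIV"
    unfolding b_def
    by (rule bij_betw_from_nat_into) (auto simp: finite_prod infinite_UNIV_char_0)
  have "((\<lambda>n. ?c (b n)) has_sum energy h) UNIV"
    using has_sum_reindex_bij_betw[OF b, of ?c "energy h"] hs by simp
  then have "(\<lambda>n. ?c (b n)) sums energy h"
    by (rule has_sum_imp_sums)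
  then have "(\<Sum>n. ennreal (?c (b n))) = ennreal (energy h)"
    by (intro suminf_ennreal_eq) auto
  then show ?thesis
    by (subst nn_integral_bij_count_space[OF b, symmetric]) (simp add: nn_integral_count_space_nat)
qed

section \<open>Plancherel's theorem\<close>

subsection \<open>Linear changes of variable\<close>

lemma borel_measurable_fst_borel [measurable]: "fst \<in> borel_measurable (borel :: ('a::second_countable_topology \<times> 'b::second_countable_topology) measure)"
  and borel_measurable_snd_borel [measurable]: "snd \<in> borel_measurable (borel :: ('a::second_countable_topology \<times> 'b::second_countable_topology) measure)"
  by (intro borel_measurable_continuous_onI continuous_intros)+

text \<open>\<open>B\<close> multiplies areas by \<open>d\<close>. With nonnegative integrals no integrability has to be known
  before the substitution.\<close>

definition scales_area :: "(real \<times> real \<Rightarrow> real \<times> real) \<Rightarrow> real \<Rightarrow> bool" where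
  "scales_area B d \<longleftrightarrow> B \<in> borel_measurable borel \<and> 0 < d \<and>
     (\<forall>f \<in> borel_measurable borel.
        (\<integral>\<^sup>+x. f (B x) \<partial>lborel) = ennreal (1 / d) * (\<integral>\<^sup>+x. f x \<partial>lborel))"

lemma scales_area_measurable [measurable_dest]: "scales_area B d \<Longrightarrow> B \<in> borel_measurable borel"
  by (simp add: scales_area_def)

lemma scales_area_nn_integral:
  "scales_area B d \<Longrightarrow> f \<in> borel_measurable borel \<Longrightarrow>
    (\<integral>\<^sup>+x. f (B x) \<partial>lborel) = ennreal (1 / d) * (\<integral>\<^sup>+x. f x \<partial>lborel)"
  by (simp add: scales_area_def)

lemma scales_area_distr:
  assumes "scales_area B d"
  shows "distr lborel borel B = density lborel (\<lambda>_. ennreal (1 / d))"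
proof (rule measure_eqI)
  fix A assume "A \<in> sets (distr lborel borel B)"
  then have [measurable]: "A \<in> sets borel" by simp
  note [measurable] = scales_area_measurable[OF assms]
  have "emeasure (distr lborel borel B) A = (\<integral>\<^sup>+x. indicator A (B x) \<partial>lborel)"
    by (simp add: nn_integral_distr nn_integral_indicator[symmetric] del: nn_integral_indicator)
  also have "\<dots> = ennreal (1 / d) * (\<integral>\<^sup>+x. indicator A x \<partial>lborel)"
    using assms by (simp add: scales_area_def)
  also have "\<dots> = emeasure (density lborel (\<lambda>_. ennreal (1 / d))) A"
    by (simp add: emeasure_density nn_integral_cmult)
  finally show "emeasure (distr lborel borel B) A = emeasure (density lborel (\<lambda>_. ennreal (1 / d))) A" .
qed simp

lemma scales_area_integral:
  fixes f :: "real \<times> real \<Rightarrow> 'b::{banach, second_countable_topology}"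
  assumes "scales_area B d" "f \<in> borel_measurable borel"
  shows "(LINT x|lborel. f (B x)) = (1 / d) *\<^sub>R (LINT x|lborel. f x)"
proof -
  note [measurable] = scales_area_measurable[OF assms(1)] assms(2)
  have "(LINT x|lborel. f (B x)) = integral\<^sup>L (distr lborel borel B) f"
    by (simp add: integral_distr)
  also have "\<dots> = (LINT x|lborel. (1 / d) *\<^sub>R f x)"
    unfolding scales_area_distr[OF assms(1)] using assms(1)
    by (subst integral_density) (auto simp: scales_area_def)
  finally show ?thesis by simp
qed

lemma scales_area_energy:
  assumes "scales_area B d" "f \<in> borel_measurable borel"
  shows "energy (\<lambda>x. f (B x)) = energy f / d"
  unfolding energy_def
  using scales_area_integral[OF assms(1), of "\<lambda>x. (cmod (f x))\<^sup>2"] assms(2) by simp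

lemma nn_integral_plane:
  fixes f :: "real \<times> real \<Rightarrow> ennreal"
  assumes "f \<in> borel_measurable borel"
  shows "(\<integral>\<^sup>+z. f z \<partial>lborel) = (\<integral>\<^sup>+x. \<integral>\<^sup>+y. f (x, y) \<partial>lborel \<partial>lborel)"
    and "(\<integral>\<^sup>+z. f z \<partial>lborel) = (\<integral>\<^sup>+y. \<integral>\<^sup>+x. f (x, y) \<partial>lborel \<partial>lborel)"
  using lborel.nn_integral_fst[of f lborel] lborel_pair.nn_integral_snd[of f] assms
  by (simp_all add: lborel_prod)

lemma nn_integral_affine_substitution:
  fixes c :: real
  assumes [measurable]: "f \<in> borel_measurable borel" and c: "c \<noteq> 0"
  shows "(\<integral>\<^sup>+x. f (t + c * x) \<partial>lborel) = ennreal (1 / \<bar>c\<bar>) * (\<integral>\<^sup>+x. f x \<partial>lborel)"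
  using c by (subst nn_integral_real_affine[OF assms, of t])
    (simp add: mult.assoc[symmetric] ennreal_mult[symmetric])

lemma scales_area_shear:
  assumes "a \<noteq> 0" "b \<noteq> 0"
  shows "scales_area (\<lambda>z. (a * fst z, c * fst z + b * snd z)) \<bar>a * b\<bar>" (is ?L)
    and "scales_area (\<lambda>z. (c * snd z + a * fst z, b * snd z)) \<bar>a * b\<bar>" (is ?U)
proof -
  have inv: "ennreal (1 / \<bar>a\<bar>) * ennreal (1 / \<bar>b\<bar>) = ennreal (1 / \<bar>a * b\<bar>)"
    by (simp add: ennreal_mult[symmetric] abs_mult)
  have L: "(\<integral>\<^sup>+z. f (a * fst z, c * fst z + b * snd z) \<partial>lborel)
      = ennreal (1 / \<bar>a * b\<bar>) * (\<integral>\<^sup>+x. f x \<partial>lborel)"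
    if [measurable]: "f \<in> borel_measurable borel" for f
  proof -
    have "(\<lambda>z. (a * fst z, c * fst z + b * snd z)) \<in> borel_measurable borel"
      by (intro borel_measurable_continuous_onI continuous_intros)
    then have meas: "(\<lambda>z. f (a * fst z, c * fst z + b * snd z)) \<in> borel_measurable borel"
      by (rule measurable_compose) (rule that)
    have "(\<integral>\<^sup>+z. f (a * fst z, c * fst z + b * snd z) \<partial>lborel)
        = (\<integral>\<^sup>+x. \<integral>\<^sup>+y. f (a * x, c * x + b * y) \<partial>lborel \<partial>lborel)"
      by (subst nn_integral_plane(1)[OF meas]) simp
    also have "\<dots> = (\<integral>\<^sup>+x. ennreal (1 / \<bar>b\<bar>) * (\<integral>\<^sup>+y. f (0 + a * x, y) \<partial>lborel) \<partial>lborel)"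
      using assms by (intro nn_integral_cong) (subst nn_integral_affine_substitution, auto)
    also have "\<dots> = ennreal (1 / \<bar>b\<bar>) * (\<integral>\<^sup>+x. (\<integral>\<^sup>+y. f (0 + a * x, y) \<partial>lborel) \<partial>lborel)"
      by (rule nn_integral_cmult) simp
    also have "(\<integral>\<^sup>+x. (\<integral>\<^sup>+y. f (0 + a * x, y) \<partial>lborel) \<partial>lborel)
        = ennreal (1 / \<bar>a\<bar>) * (\<integral>\<^sup>+x. (\<integral>\<^sup>+y. f (x, y) \<partial>lborel) \<partial>lborel)"
      using assms by (intro nn_integral_affine_substitution) auto
    also have "(\<integral>\<^sup>+x. (\<integral>\<^sup>+y. f (x, y) \<partial>lborel) \<partial>lborel) = (\<integral>\<^sup>+z. f z \<partial>lborel)"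
      by (subst nn_integral_plane(1)) auto
    finally show ?thesis by (simp only: inv[symmetric] mult_ac)
  qed
  then show ?L using assms unfolding scales_area_def
    by (auto intro!: borel_measurable_continuous_onI continuous_intros)
  have "(\<integral>\<^sup>+z. f (c * snd z + a * fst z, b * snd z) \<partial>lborel)
      = ennreal (1 / \<bar>a * b\<bar>) * (\<integral>\<^sup>+x. f x \<partial>lborel)"
    if [measurable]: "f \<in> borel_measurable borel" for f
  proof -
    have "(\<lambda>z. (c * snd z + a * fst z, b * snd z)) \<in> borel_measurable borel"
      by (intro borel_measurable_continuous_onI continuous_intros)
    then have meas: "(\<lambda>z. f (c * snd z + a * fst z, b * snd z)) \<in> borel_measurable borel"
      by (rule measurable_compose) (rule that)
    have "(\<integral>\<^sup>+z. f (c * snd z + a * fst z, b * snd z) \<partial>lborel)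
        = (\<integral>\<^sup>+y. \<integral>\<^sup>+x. f (c * y + a * x, b * y) \<partial>lborel \<partial>lborel)"
      by (subst nn_integral_plane(2)[OF meas]) simp
    also have "\<dots> = (\<integral>\<^sup>+y. ennreal (1 / \<bar>a\<bar>) * (\<integral>\<^sup>+x. f (x, 0 + b * y) \<partial>lborel) \<partial>lborel)"
      using assms by (intro nn_integral_cong) (subst nn_integral_affine_substitution, auto)
    also have "\<dots> = ennreal (1 / \<bar>a\<bar>) * (\<integral>\<^sup>+y. (\<integral>\<^sup>+x. f (x, 0 + b * y) \<partial>lborel) \<partial>lborel)"
      by (rule nn_integral_cmult) simp
    also have "(\<integral>\<^sup>+y. (\<integral>\<^sup>+x. f (x, 0 + b * y) \<partial>lborel) \<partial>lborel)
        = ennreal (1 / \<bar>b\<bar>) * (\<integral>\<^sup>+y. (\<integral>\<^sup>+x. f (x, y) \<partial>lborel) \<partial>lborel)"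
      using assms by (intro nn_integral_affine_substitution) auto
    also have "(\<integral>\<^sup>+y. (\<integral>\<^sup>+x. f (x, y) \<partial>lborel) \<partial>lborel) = (\<integral>\<^sup>+z. f z \<partial>lborel)"
      by (subst nn_integral_plane(2)) auto
    finally show ?thesis by (simp only: inv[symmetric] mult_ac)
  qed
  then show ?U using assms unfolding scales_area_def
    by (auto intro!: borel_measurable_continuous_onI continuous_intros)
qed

lemma scales_area_scaleR: "r > 0 \<Longrightarrow> scales_area (\<lambda>z. r *\<^sub>R z) (r\<^sup>2)"
  using scales_area_shear(1)[of r r 0] by (simp add: scaleR_prod_def power2_eq_square)

subsection \<open>The transform is an isometry\<close>

lemma nn_integral_lattice_tiling:
  assumes [measurable]: "f \<in> borel_measurable borel"
  shows "(\<integral>\<^sup>+x. f x \<partial>lborel)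
    = (\<integral>\<^sup>+t. indicator ({0..<1::real} \<times> {0..<1::real}) t * (\<integral>\<^sup>+k. f (t - lattice k) \<partial>count_space UNIV) \<partial>lborel)"
proof -
  let ?Q = "{0..<1::real} \<times> {0..<1::real}"
  have [measurable]: "?Q \<in> sets borel" by (intro borel_Times) auto
  have "(\<integral>\<^sup>+k. indicator ?Q (x + lattice k) * f x \<partial>count_space UNIV) = f x" for x
  proof -
    define k0 where "k0 = (- \<lfloor>fst x\<rfloor>, - \<lfloor>snd x\<rfloor>)"
    have "x + lattice k \<in> ?Q \<longleftrightarrow> k = k0" for k
      unfolding k0_def lattice_def
      by (cases x; cases k) (auto simp: floor_eq_iff, linarith+)
    then show ?thesis
      by (subst nn_integral_count_space'[where A = "{k0}"]) (auto simp: indicator_def)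
  qed
  then have "(\<integral>\<^sup>+x. f x \<partial>lborel) = (\<integral>\<^sup>+x. \<integral>\<^sup>+k. indicator ?Q (x + lattice k) * f x \<partial>count_space UNIV \<partial>lborel)"
    by simp
  also have "\<dots> = (\<integral>\<^sup>+k. \<integral>\<^sup>+x. indicator ?Q (x + lattice k) * f x \<partial>lborel \<partial>count_space UNIV)"
    by (rule nn_integral_count_space_nn_integral) auto
  also have "\<dots> = (\<integral>\<^sup>+k. \<integral>\<^sup>+t. indicator ?Q t * f (t - lattice k) \<partial>lborel \<partial>count_space UNIV)"
  proof (rule nn_integral_cong)
    fix k
    have "(\<integral>\<^sup>+t. indicator ?Q t * f (t - lattice k) \<partial>lborel)
        = (\<integral>\<^sup>+t. indicator ?Q t * f (t - lattice k) \<partial>distr lborel borel ((+) (lattice k)))"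
      by (simp add: lborel_distr_plus)
    also have "\<dots> = (\<integral>\<^sup>+x. indicator ?Q (x + lattice k) * f x \<partial>lborel)"
      by (subst nn_integral_distr) (auto simp: add.commute)
    finally show "(\<integral>\<^sup>+x. indicator ?Q (x + lattice k) * f x \<partial>lborel)
      = (\<integral>\<^sup>+t. indicator ?Q t * f (t - lattice k) \<partial>lborel)" by simp
  qed
  also have "\<dots> = (\<integral>\<^sup>+t. \<integral>\<^sup>+k. indicator ?Q t * f (t - lattice k) \<partial>count_space UNIV \<partial>lborel)"
    by (rule nn_integral_count_space_nn_integral[symmetric]) auto
  finally show ?thesis by (simp add: nn_integral_cmult)
qed

text \<open>The samples of the transform of \<open>g\<close> on a translated integer lattice are the Fourier
  coefficients of a modulation of \<open>g\<close>. By Parseval's identity their square sum is \<open>energy g\<close>,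
  whatever the translation, and averaging over the translations gives the integral over the plane.\<close>

lemma plancherel_on_cell:
  assumes g: "tame g" and supp: "\<And>y. y \<notin> unit_cell \<Longrightarrow> g y = 0"
  shows "(\<integral>\<^sup>+x. ennreal ((cmod (inv_fourier g x))\<^sup>2) \<partial>lborel) = ennreal (energy g)"
proof -
  note [measurable] = tame_measurable[OF g]
  have samples: "(\<integral>\<^sup>+k. ennreal ((cmod (inv_fourier g (t - lattice k)))\<^sup>2) \<partial>count_space UNIV) = ennreal (energy g)"
    for t
  proof -
    define h where "h = (\<lambda>y. g y * cis (2 * pi * (t \<bullet> y)))"
    have h: "tame h" unfolding h_def using g by (rule tame_mult_right[where M = 1]) auto
    have "L2_inner h (cell_mode k) = inv_fourier g (t - lattice k)" for k
    proof -
      have "h y * cnj (cell_mode k y) = g y * cis (2 * pi * ((t - lattice k) \<bullet> y))" for y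
        using supp[of y]
        by (auto simp: h_def cell_mode_def indicator_def character_def cis_cnj cis_mult
            inner_diff_left inner_commute algebra_simps)
      then show ?thesis by (simp add: L2_inner_def inv_fourier_def)
    qed
    moreover have "energy h = energy g" by (simp add: energy_def h_def norm_mult)
    ultimately show ?thesis using parseval_cell[OF h] supp by (simp add: h_def)
  qed
  have "(\<integral>\<^sup>+t. indicator ({0..<1::real} \<times> {0..<1::real}) t * ennreal (energy g) \<partial>lborel)
      = ennreal (energy g) * emeasure (lborel \<Otimes>\<^sub>M lborel) ({0..<1::real} \<times> {0..<1::real})"
    by (simp add: lborel_prod nn_integral_cmult_indicator mult.commute borel_Times)
  also have "emeasure (lborel \<Otimes>\<^sub>M lborel) ({0..<1::real} \<times> {0..<1::real}) = 1"
    by (subst lborel.emeasure_pair_measure_Times) auto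
  finally show ?thesis
    by (subst nn_integral_lattice_tiling) (auto simp: samples)
qed

text \<open>A dilation moves the bounded support of \<open>g\<close> into the unit cell.\<close>

theorem plancherel:
  fixes g :: "real \<times> real \<Rightarrow> complex"
  assumes g: "tame g"
  shows "L2 (inv_fourier g)" "energy (inv_fourier g) = energy g"
proof -
  obtain M R where M: "M > 0" "R > 0" "\<And>x. cmod (g x) \<le> M" "\<And>x. g x \<noteq> 0 \<Longrightarrow> norm x \<le> R"
    using tameE[OF g] by metis
  note [measurable] = tame_measurable[OF g]
  define N where "N = 2 * R"
  have N: "N > 0" using M by (simp add: N_def)
  define h where "h = (\<lambda>y. g (N *\<^sub>R y))"
  have supp: "h y = 0" if "y \<notin> unit_cell" for y
  proof (rule ccontr)
    assume "h y \<noteq> 0"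
    then have "norm (N *\<^sub>R y) \<le> R" unfolding h_def by (rule M(4))
    then have "norm y \<le> 1/2" using M(2) by (simp add: N_def)
    then show False using that norm_fst_le[of "fst y" "snd y"] norm_snd_le[of "snd y" "fst y"]
      by (auto simp: unit_cell_def)
  qed
  have h: "tame h"
  proof (rule tameI[where M = M and R = 1])
    show "norm y \<le> 1" if "h y \<noteq> 0" for y
      using that supp norm_le_of_unit_cell by metis
  qed (auto simp: h_def M)
  have T: "inv_fourier h (N *\<^sub>R x) = of_real (1 / N\<^sup>2) * inv_fourier g x" for x
  proof -
    have "inv_fourier h (N *\<^sub>R x) = (LINT y|lborel. g (N *\<^sub>R y) * cis (2 * pi * (x \<bullet> (N *\<^sub>R y))))"
      by (simp add: inv_fourier_def h_def)
    also have "\<dots> = (1 / N\<^sup>2) *\<^sub>R inv_fourier g x"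
      unfolding inv_fourier_def by (rule scales_area_integral[OF scales_area_scaleR[OF N]]) measurable
    finally show ?thesis by (simp add: scaleR_conv_of_real)
  qed
  have eh: "energy h = energy g / N\<^sup>2"
    unfolding h_def by (rule scales_area_energy[OF scales_area_scaleR[OF N]]) measurable
  have "ennreal (1 / N^4) * (\<integral>\<^sup>+x. ennreal ((cmod (inv_fourier g x))\<^sup>2) \<partial>lborel)
      = (\<integral>\<^sup>+x. ennreal ((cmod (inv_fourier h (N *\<^sub>R x)))\<^sup>2) \<partial>lborel)"
    using N by (subst nn_integral_cmult[symmetric])
      (auto simp: T norm_mult power_mult_distrib ennreal_mult[symmetric] norm_divide norm_power
        power_divide intro!: nn_integral_cong)
  also have "\<dots> = ennreal (1 / N\<^sup>2) * ennreal (energy h)"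
  proof -
    note [measurable] = tame_measurable[OF h]
    have "(\<lambda>x. ennreal ((cmod (inv_fourier h x))\<^sup>2)) \<in> borel_measurable borel" by measurable
    from scales_area_nn_integral[OF scales_area_scaleR[OF N] this] show ?thesis
      using plancherel_on_cell[OF h supp] by simp
  qed
  also have "\<dots> = ennreal (1 / N^4) * ennreal (energy g)"
    using N by (simp add: eh ennreal_mult[symmetric] power4_eq_xxxx power2_eq_square field_simps)
  finally have "(\<integral>\<^sup>+x. ennreal ((cmod (inv_fourier g x))\<^sup>2) \<partial>lborel) = ennreal (energy g)"
    using N by (simp add: ennreal_mult_cancel_left)
  from L2I_nn_integral[OF _ this] show "L2 (inv_fourier g)" "energy (inv_fourier g) = energy g"
    by auto
qed

text \<open>Polarization; the imaginary part comes from replacing \<open>g\<close> by \<open>\<i> g\<close>.\<close>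

lemma plancherel_inner:
  fixes f g :: "real \<times> real \<Rightarrow> complex"
  assumes f: "tame f" and g: "tame g"
  shows "L2_inner (inv_fourier f) (inv_fourier g) = L2_inner f g"
proof -
  have Re: "Re (L2_inner (inv_fourier f) (inv_fourier k)) = Re (L2_inner f k)" if k: "tame k" for k
  proof -
    have "energy (\<lambda>x. inv_fourier f x + inv_fourier k x) = energy (\<lambda>x. f x + k x)"
      using plancherel(2)[OF tame_add[OF f k]] by (simp add: inv_fourier_add[OF f k, abs_def])
    then show ?thesis
      by (simp add: energy_add plancherel f k tame_L2)
  qed
  have "Re (L2_inner (inv_fourier f) (inv_fourier (\<lambda>x. \<i> * g x))) = Re (L2_inner f (\<lambda>x. \<i> * g x))"
    by (intro Re tame_const_mult g)
  then have "Im (L2_inner (inv_fourier f) (inv_fourier g)) = Im (L2_inner f g)"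
    by (simp add: inv_fourier_mult_const[abs_def] L2_inner_mult_right)
  with Re[OF g] show ?thesis by (simp add: complex_eq_iff)
qed

subsection \<open>Tensor products and the one-dimensional transform\<close>

lemma tame_tensor:
  fixes p :: "'a::euclidean_space \<Rightarrow> complex" and q :: "'b::euclidean_space \<Rightarrow> complex"
  assumes "tame p" "tame q"
  shows "tame (\<lambda>z. p (fst z) * q (snd z))"
proof -
  obtain M R where *: "M > 0" "R > 0" "\<And>x. cmod (p x) \<le> M" "\<And>x. p x \<noteq> 0 \<Longrightarrow> norm x \<le> R"
    using tameE[OF assms(1)] by metis
  obtain M' R' where **: "M' > 0" "R' > 0" "\<And>x. cmod (q x) \<le> M'" "\<And>x. q x \<noteq> 0 \<Longrightarrow> norm x \<le> R'"
    using tameE[OF assms(2)] by metis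
  note [measurable] = tame_measurable[OF assms(1)] tame_measurable[OF assms(2)]
  show ?thesis
  proof (rule tameI[where M = "M * M'" and R = "R + R'"])
    show "cmod (p (fst z) * q (snd z)) \<le> M * M'" for z
      using *(1,3) **(1,3) by (auto simp: norm_mult intro!: mult_mono)
    show "norm z \<le> R + R'" if "p (fst z) * q (snd z) \<noteq> 0" for z
      using that *(4)[of "fst z"] **(4)[of "snd z"] norm_Pair_le[of "fst z" "snd z"] by auto
  qed auto
qed

lemma inv_fourier_tensor:
  fixes p q :: "real \<Rightarrow> complex"
  assumes "tame p" "tame q"
  shows "inv_fourier (\<lambda>z. p (fst z) * q (snd z)) x = inv_fourier p (fst x) * inv_fourier q (snd x)"
proof -
  have I: "integrable (lborel \<Otimes>\<^sub>M lborel) (\<lambda>\<xi>. p (fst \<xi>) * q (snd \<xi>) * cis (2 * pi * (x \<bullet> \<xi>)))"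
    using tame_transform_integrable[OF tame_tensor[OF assms]] by (simp add: lborel_prod)
  have "inv_fourier (\<lambda>z. p (fst z) * q (snd z)) x
      = (LINT a|lborel. LINT b|lborel. p a * q b * cis (2 * pi * (x \<bullet> (a, b))))"
    unfolding inv_fourier_def using lborel_pair.integral_fst'[OF I] by (simp add: lborel_prod)
  also have "\<dots> = (LINT a|lborel. LINT b|lborel. (p a * cis (2 * pi * (fst x * a))) * (q b * cis (2 * pi * (snd x * b))))"
    by (intro Bochner_Integration.integral_cong refl)
      (simp add: inner_prod_def cis_mult algebra_simps)
  also have "\<dots> = inv_fourier p (fst x) * inv_fourier q (snd x)"
    by (simp add: inv_fourier_def)
  finally show ?thesis .
qed

lemma nn_integral_tensor:
  fixes u v :: "real \<Rightarrow> ennreal"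
  assumes [measurable]: "u \<in> borel_measurable borel" "v \<in> borel_measurable borel"
  shows "(\<integral>\<^sup>+z. u (fst z) * v (snd z) \<partial>lborel) = (\<integral>\<^sup>+x. u x \<partial>lborel) * (\<integral>\<^sup>+y. v y \<partial>lborel)"
proof -
  have "(\<integral>\<^sup>+z. u (fst z) * v (snd z) \<partial>lborel) = (\<integral>\<^sup>+x. \<integral>\<^sup>+y. u x * v y \<partial>lborel \<partial>lborel)"
    by (subst nn_integral_plane(1)) auto
  then show ?thesis by (simp add: nn_integral_cmult nn_integral_multc)
qed

text \<open>The one-dimensional case follows from the plane by comparing both sides on \<open>p \<otimes> p\<close>.\<close>

theorem plancherel_real:
  fixes p :: "real \<Rightarrow> complex"
  assumes p: "tame p"
  shows "L2 (inv_fourier p)" "energy (inv_fourier p) = energy p"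
proof -
  note [measurable] = tame_measurable[OF p]
  let ?g = "\<lambda>z. p (fst z) * p (snd z)"
  let ?I = "\<integral>\<^sup>+x. ennreal ((cmod (inv_fourier p x))\<^sup>2) \<partial>lborel"
  have "?I * ?I = (\<integral>\<^sup>+z. ennreal ((cmod (inv_fourier ?g z))\<^sup>2) \<partial>lborel)"
    by (subst nn_integral_tensor[symmetric])
      (auto simp: inv_fourier_tensor[OF p p] norm_mult power_mult_distrib ennreal_mult
        intro!: nn_integral_cong)
  also have "\<dots> = (\<integral>\<^sup>+z. ennreal ((cmod (?g z))\<^sup>2) \<partial>lborel)"
    using plancherel[OF tame_tensor[OF p p]] tame_L2[OF tame_tensor[OF p p]]
    by (simp add: nn_integral_eq_energy)
  also have "\<dots> = (\<integral>\<^sup>+x. ennreal ((cmod (p x))\<^sup>2) \<partial>lborel) * (\<integral>\<^sup>+x. ennreal ((cmod (p x))\<^sup>2) \<partial>lborel)"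
    by (subst nn_integral_tensor[symmetric])
      (auto simp: norm_mult power_mult_distrib ennreal_mult intro!: nn_integral_cong)
  also have "\<dots> = ennreal (energy p) * ennreal (energy p)"
    by (simp add: nn_integral_eq_energy tame_L2 p)
  finally have sq: "?I * ?I = ennreal (energy p) * ennreal (energy p)" .
  then have "?I \<noteq> \<infinity>" by (auto simp: ennreal_mult[symmetric])
  then obtain r where r: "r \<ge> 0" "?I = ennreal r" by (cases ?I) auto
  then have "r * r = energy p * energy p"
    using sq by (simp add: ennreal_mult[symmetric])
  then have "r = energy p" using r(1) by (metis energy_nonneg power2_eq_imp_eq power2_eq_square)
  then have "?I = ennreal (energy p)" using r by simp
  from L2I_nn_integral[OF _ this] show "L2 (inv_fourier p)" "energy (inv_fourier p) = energy p"
    by auto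
qed

section \<open>Systems of modulated tiles\<close>

lemma scales_area_L2:
  fixes f :: "real \<times> real \<Rightarrow> complex"
  assumes "scales_area B d" "L2 f"
  shows "L2 (\<lambda>x. f (B x))"
proof (rule L2I_nn_integral(1))
  note [measurable] = scales_area_measurable[OF assms(1)] L2_measurable[OF assms(2)]
  show "(\<lambda>x. f (B x)) \<in> borel_measurable borel" by measurable
  have "(\<lambda>x. ennreal ((cmod (f x))\<^sup>2)) \<in> borel_measurable borel" by measurable
  from scales_area_nn_integral[OF assms(1) this]
  show "(\<integral>\<^sup>+x. ennreal ((cmod (f (B x)))\<^sup>2) \<partial>lborel) = ennreal (1 / d * energy f)"
    using assms(1) ennreal_mult[of "1 / d" "energy f"]
    by (simp add: nn_integral_eq_energy[OF assms(2)] scales_area_def)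
  show "0 \<le> 1 / d * energy f" using assms(1) by (simp add: scales_area_def)
qed

lemma energy_orthonormal_sum:
  assumes "finite F" "\<And>i. i \<in> F \<Longrightarrow> L2 (e i)"
    and "\<And>i k. i \<in> F \<Longrightarrow> k \<in> F \<Longrightarrow> L2_inner (e i) (e k) = (if i = k then 1 else 0)"
  shows "energy (\<lambda>x. \<Sum>i\<in>F. c i * e i x) = (\<Sum>i\<in>F. (cmod (c i))\<^sup>2)"
  using energy_diff_orthonormal[OF assms(1,2) L2_zero assms(3), of "\<lambda>i. - c i"]
  by (simp add: L2_inner_def energy_def sum_negf)

text \<open>Each tile \<open>\<tau>\<close> carries a window \<open>G \<tau>\<close> whose support is moved into the unit cell by the linear
  map \<open>B \<tau>\<close>; the elements are the windows modulated by the characters of the cell. The factor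
  \<open>\<kappa> \<tau>\<close> records the normalisation: with \<open>\<kappa> = 1\<close> on all tiles and windows whose squares sum to one
  the system is a Parseval frame.\<close>

locale tile_system =
  fixes I :: "'i set" and Tiles :: "'t set" and tile :: "'i \<Rightarrow> 't" and pos :: "'i \<Rightarrow> int \<times> int"
    and G :: "'t \<Rightarrow> real \<times> real \<Rightarrow> complex"
    and B B' :: "'t \<Rightarrow> real \<times> real \<Rightarrow> real \<times> real" and d \<kappa> :: "'t \<Rightarrow> real"
  assumes index_bij: "bij_betw (\<lambda>\<eta>. (tile \<eta>, pos \<eta>)) I (Tiles \<times> UNIV)"
    and window_tame: "\<tau> \<in> Tiles \<Longrightarrow> tame (G \<tau>)"
    and area: "\<tau> \<in> Tiles \<Longrightarrow> scales_area (B \<tau>) (d \<tau>)"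
    and inverse_measurable: "\<tau> \<in> Tiles \<Longrightarrow> B' \<tau> \<in> borel_measurable borel"
    and inverse_right: "\<tau> \<in> Tiles \<Longrightarrow> B \<tau> (B' \<tau> y) = y"
    and inverse_left: "\<tau> \<in> Tiles \<Longrightarrow> B' \<tau> (B \<tau> y) = y"
    and window_support: "\<tau> \<in> Tiles \<Longrightarrow> G \<tau> \<xi> \<noteq> 0 \<Longrightarrow> B \<tau> \<xi> \<in> unit_cell"
    and window_sum: "finite S \<Longrightarrow> S \<subseteq> Tiles \<Longrightarrow> (\<Sum>\<tau>\<in>S. (cmod (G \<tau> \<xi>))\<^sup>2) \<le> 1"
    and kappa: "\<tau> \<in> Tiles \<Longrightarrow> 0 < \<kappa> \<tau> \<and> \<kappa> \<tau> \<le> 2"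
begin

definition amp :: "'t \<Rightarrow> real" where
  "amp \<tau> = sqrt (\<kappa> \<tau> * d \<tau>)"

definition elem :: "'i \<Rightarrow> real \<times> real \<Rightarrow> complex" where
  "elem \<eta> \<xi> = of_real (amp (tile \<eta>)) * G (tile \<eta>) \<xi> * character (pos \<eta>) (B (tile \<eta>) \<xi>)"

definition atom :: "'i \<Rightarrow> real \<times> real \<Rightarrow> complex" where
  "atom \<eta> = inv_fourier (elem \<eta>)"

lemma tile_in: "\<eta> \<in> I \<Longrightarrow> tile \<eta> \<in> Tiles"
  using bij_betw_apply[OF index_bij] by auto

lemma index_inj: "\<eta> \<in> I \<Longrightarrow> \<eta>' \<in> I \<Longrightarrow> tile \<eta> = tile \<eta>' \<Longrightarrow> pos \<eta> = pos \<eta>' \<Longrightarrow> \<eta> = \<eta>'"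
  using inj_onD[OF bij_betw_imp_inj_on[OF index_bij]] by auto

lemma index_ex: "\<tau> \<in> Tiles \<Longrightarrow> \<exists>\<eta>\<in>I. tile \<eta> = \<tau> \<and> pos \<eta> = k"
proof -
  assume "\<tau> \<in> Tiles"
  then have "(\<tau>, k) \<in> (\<lambda>\<eta>. (tile \<eta>, pos \<eta>)) ` I"
    using bij_betw_imp_surj_on[OF index_bij] by simp
  then show ?thesis by auto
qed

lemma d_pos: "\<tau> \<in> Tiles \<Longrightarrow> d \<tau> > 0"
  using area by (simp add: scales_area_def)

lemma amp_square: "\<tau> \<in> Tiles \<Longrightarrow> (amp \<tau>)\<^sup>2 = \<kappa> \<tau> * d \<tau>"
  using kappa[of \<tau>] d_pos[of \<tau>] by (simp add: amp_def)

lemma elem_tame: "\<eta> \<in> I \<Longrightarrow> tame (elem \<eta>)"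
proof -
  assume "\<eta> \<in> I"
  note \<tau> = tile_in[OF this]
  note [measurable] = scales_area_measurable[OF area[OF \<tau>]]
  show ?thesis
    unfolding elem_def[abs_def]
    by (intro tame_mult_right[where M = 1] tame_const_mult window_tame \<tau>) auto
qed

lemma atom_L2: "\<eta> \<in> I \<Longrightarrow> L2 (atom \<eta>)"
  unfolding atom_def by (intro plancherel elem_tame)

lemma elem_eq_cell_mode:
  assumes "\<eta> \<in> I"
  shows "elem \<eta> \<xi> = of_real (amp (tile \<eta>)) * G (tile \<eta>) \<xi> * cell_mode (pos \<eta>) (B (tile \<eta>) \<xi>)"
  using window_support[OF tile_in[OF assms], of \<xi>]
  by (cases "G (tile \<eta>) \<xi> = 0") (auto simp: elem_def cell_mode_def)

text \<open>Split the sum by tiles and apply the Cauchy-Schwarz inequality pointwise, with the windows as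
  one of the two factors. This leaves one trigonometric sum for each tile, and the modulations of
  a single tile are orthogonal.\<close>

lemma synthesis_bound_hat:
  assumes F: "finite F" "F \<subseteq> I"
  shows "energy (\<lambda>\<xi>. \<Sum>\<eta>\<in>F. c \<eta> * elem \<eta> \<xi>) \<le> 2 * (\<Sum>\<eta>\<in>F. (cmod (c \<eta>))\<^sup>2)"
proof -
  define S where "S = tile ` F"
  define R where "R = (\<lambda>\<tau>. {\<eta> \<in> F. tile \<eta> = \<tau>})"
  define P where "P = (\<lambda>\<tau> y. \<Sum>\<eta>\<in>R \<tau>. (c \<eta> * of_real (amp \<tau>)) * cell_mode (pos \<eta>) y)"
  have S: "finite S" "S \<subseteq> Tiles" using F tile_in by (auto simp: S_def)
  have R: "finite (R \<tau>)" "R \<tau> \<subseteq> I" for \<tau> using F by (auto simp: R_def)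
  have PL2: "L2 (P \<tau>)" for \<tau>
    unfolding P_def by (intro L2_sum L2_mult_const) simp
  have PB: "L2 (\<lambda>\<xi>. P \<tau> (B \<tau> \<xi>))" if "\<tau> \<in> S" for \<tau>
    using that S by (intro scales_area_L2[OF area PL2]) auto
  have split: "(\<Sum>\<eta>\<in>F. c \<eta> * elem \<eta> \<xi>) = (\<Sum>\<tau>\<in>S. G \<tau> \<xi> * P \<tau> (B \<tau> \<xi>))" for \<xi>
  proof -
    have "(\<Sum>\<eta>\<in>F. c \<eta> * elem \<eta> \<xi>) = (\<Sum>\<tau>\<in>S. \<Sum>\<eta>\<in>R \<tau>. c \<eta> * elem \<eta> \<xi>)"
      unfolding R_def using F S by (intro sum.group[symmetric]) (auto simp: S_def)
    also have "\<dots> = (\<Sum>\<tau>\<in>S. G \<tau> \<xi> * P \<tau> (B \<tau> \<xi>))"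
      unfolding P_def sum_distrib_left
      by (intro sum.cong refl) (use F in \<open>auto simp: elem_eq_cell_mode R_def\<close>)
    finally show ?thesis .
  qed
  have eP: "energy (P \<tau>) = (\<Sum>\<eta>\<in>R \<tau>. (cmod (c \<eta>))\<^sup>2) * (\<kappa> \<tau> * d \<tau>)" if "\<tau> \<in> S" for \<tau>
  proof -
    have "pos \<eta> = pos \<eta>' \<longleftrightarrow> \<eta> = \<eta>'" if "\<eta> \<in> R \<tau>" "\<eta>' \<in> R \<tau>" for \<eta> \<eta>'
      using that F index_inj[of \<eta> \<eta>'] by (auto simp: R_def)
    then have "energy (P \<tau>) = (\<Sum>\<eta>\<in>R \<tau>. (cmod (c \<eta> * of_real (amp \<tau>)))\<^sup>2)"
      unfolding P_def using R[of \<tau>]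
      by (intro energy_orthonormal_sum) (auto simp: cell_mode_orthonormal)
    also have "\<dots> = (\<Sum>\<eta>\<in>R \<tau>. (cmod (c \<eta>))\<^sup>2 * (\<kappa> \<tau> * d \<tau>))"
      using that S by (intro sum.cong refl) (auto simp: norm_mult power_mult_distrib amp_square)
    finally show ?thesis by (simp add: sum_distrib_right)
  qed
  have "energy (\<lambda>\<xi>. \<Sum>\<eta>\<in>F. c \<eta> * elem \<eta> \<xi>) \<le> (LINT \<xi>|lborel. (\<Sum>\<tau>\<in>S. (cmod (P \<tau> (B \<tau> \<xi>)))\<^sup>2))"
    unfolding energy_def
  proof (rule integral_mono)
    have "tame (\<lambda>\<xi>. \<Sum>\<eta>\<in>F. c \<eta> * elem \<eta> \<xi>)"
      using F by (intro tame_sum tame_const_mult elem_tame) auto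
    then show "integrable lborel (\<lambda>\<xi>. (cmod (\<Sum>\<eta>\<in>F. c \<eta> * elem \<eta> \<xi>))\<^sup>2)"
      by (intro L2_square_integrable tame_L2)
    show "integrable lborel (\<lambda>\<xi>. \<Sum>\<tau>\<in>S. (cmod (P \<tau> (B \<tau> \<xi>)))\<^sup>2)"
      using PB by (intro Bochner_Integration.integrable_sum L2_square_integrable)
    show "(cmod (\<Sum>\<eta>\<in>F. c \<eta> * elem \<eta> \<xi>))\<^sup>2 \<le> (\<Sum>\<tau>\<in>S. (cmod (P \<tau> (B \<tau> \<xi>)))\<^sup>2)" for \<xi>
    proof -
      have "(cmod (\<Sum>\<eta>\<in>F. c \<eta> * elem \<eta> \<xi>))\<^sup>2 \<le> (\<Sum>\<tau>\<in>S. cmod (G \<tau> \<xi>) * cmod (P \<tau> (B \<tau> \<xi>)))\<^sup>2"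
        unfolding split by (intro power_mono order_trans[OF norm_sum]) (auto simp: norm_mult)
      also have "\<dots> \<le> (\<Sum>\<tau>\<in>S. (cmod (G \<tau> \<xi>))\<^sup>2) * (\<Sum>\<tau>\<in>S. (cmod (P \<tau> (B \<tau> \<xi>)))\<^sup>2)"
        by (rule Cauchy_Schwarz_ineq_sum)
      also have "\<dots> \<le> 1 * (\<Sum>\<tau>\<in>S. (cmod (P \<tau> (B \<tau> \<xi>)))\<^sup>2)"
        by (intro mult_right_mono window_sum S sum_nonneg) auto
      finally show "(cmod (\<Sum>\<eta>\<in>F. c \<eta> * elem \<eta> \<xi>))\<^sup>2 \<le> (\<Sum>\<tau>\<in>S. (cmod (P \<tau> (B \<tau> \<xi>)))\<^sup>2)" by simp
    qed
  qed
  also have "\<dots> = (\<Sum>\<tau>\<in>S. energy (\<lambda>\<xi>. P \<tau> (B \<tau> \<xi>)))"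
    unfolding energy_def using PB by (intro Bochner_Integration.integral_sum L2_square_integrable)
  also have "\<dots> = (\<Sum>\<tau>\<in>S. \<kappa> \<tau> * (\<Sum>\<eta>\<in>R \<tau>. (cmod (c \<eta>))\<^sup>2))"
  proof (intro sum.cong refl)
    fix \<tau> assume \<tau>: "\<tau> \<in> S"
    then have "\<tau> \<in> Tiles" using S by auto
    then show "energy (\<lambda>\<xi>. P \<tau> (B \<tau> \<xi>)) = \<kappa> \<tau> * (\<Sum>\<eta>\<in>R \<tau>. (cmod (c \<eta>))\<^sup>2)"
      using scales_area_energy[OF area L2_measurable[OF PL2], of \<tau>] eP[OF \<tau>] d_pos[of \<tau>] by simp
  qed
  also have "\<dots> \<le> (\<Sum>\<tau>\<in>S. 2 * (\<Sum>\<eta>\<in>R \<tau>. (cmod (c \<eta>))\<^sup>2))"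
    using S kappa by (intro sum_mono mult_right_mono sum_nonneg) auto
  also have "\<dots> = 2 * (\<Sum>\<tau>\<in>S. \<Sum>\<eta>\<in>R \<tau>. (cmod (c \<eta>))\<^sup>2)"
    by (simp add: sum_distrib_left)
  also have "(\<Sum>\<tau>\<in>S. \<Sum>\<eta>\<in>R \<tau>. (cmod (c \<eta>))\<^sup>2) = (\<Sum>\<eta>\<in>F. (cmod (c \<eta>))\<^sup>2)"
    unfolding R_def using F S by (intro sum.group) (auto simp: S_def)
  finally show ?thesis .
qed

lemma synthesis_eq_inv_fourier:
  assumes "F \<subseteq> I"
  shows "(\<lambda>x. \<Sum>\<eta>\<in>F. c \<eta> * atom \<eta> x) = inv_fourier (\<lambda>\<xi>. \<Sum>\<eta>\<in>F. c \<eta> * elem \<eta> \<xi>)"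
proof
  fix x
  have "inv_fourier (\<lambda>\<xi>. \<Sum>\<eta>\<in>F. c \<eta> * elem \<eta> \<xi>) x = (\<Sum>\<eta>\<in>F. inv_fourier (\<lambda>\<xi>. c \<eta> * elem \<eta> \<xi>) x)"
    using assms by (intro inv_fourier_sum tame_const_mult elem_tame) auto
  then show "(\<Sum>\<eta>\<in>F. c \<eta> * atom \<eta> x) = inv_fourier (\<lambda>\<xi>. \<Sum>\<eta>\<in>F. c \<eta> * elem \<eta> \<xi>) x"
    by (simp add: inv_fourier_mult_const atom_def)
qed

lemma synthesis_bound:
  assumes F: "finite F" "F \<subseteq> I"
  shows "energy (\<lambda>x. \<Sum>\<eta>\<in>F. c \<eta> * atom \<eta> x) \<le> 2 * (\<Sum>\<eta>\<in>F. (cmod (c \<eta>))\<^sup>2)"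
proof -
  have "tame (\<lambda>\<xi>. \<Sum>\<eta>\<in>F. c \<eta> * elem \<eta> \<xi>)"
    using F by (intro tame_sum tame_const_mult elem_tame) auto
  then show ?thesis
    unfolding synthesis_eq_inv_fourier[OF F(2)]
    using synthesis_bound_hat[OF F, of c] by (simp add: plancherel)
qed

text \<open>Bessel's inequality is dual to the synthesis bound. With \<open>s\<close> the synthesis of the coefficients of
  \<open>f\<close> and \<open>A\<close> their square sum, \<open>\<langle>f, s\<rangle> = A\<close>; since \<open>energy s \<le> 2 * A\<close>, expanding
  \<open>0 \<le> energy (f - s / 2)\<close> gives the bound.\<close>

lemma bessel:
  assumes f: "L2 f" and F: "finite F" "F \<subseteq> I"
  shows "(\<Sum>\<eta>\<in>F. (cmod (L2_inner f (atom \<eta>)))\<^sup>2) \<le> 2 * energy f"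
proof -
  let ?c = "\<lambda>\<eta>. L2_inner f (atom \<eta>)"
  let ?A = "\<Sum>\<eta>\<in>F. (cmod (?c \<eta>))\<^sup>2"
  define s where "s = (\<lambda>x. \<Sum>\<eta>\<in>F. ?c \<eta> * atom \<eta> x)"
  have cL2: "L2 (\<lambda>x. ?c \<eta> * atom \<eta> x)" if "\<eta> \<in> F" for \<eta>
    using that F by (intro L2_mult_const atom_L2) auto
  have s: "L2 s" unfolding s_def by (intro L2_sum cL2)
  have "L2_inner f s = (\<Sum>\<eta>\<in>F. cnj (?c \<eta>) * ?c \<eta>)"
    unfolding s_def using cL2 f by (simp add: L2_inner_sum_right L2_inner_mult_right)
  also have "\<dots> = of_real ?A"
    by (simp only: of_real_sum complex_norm_square mult.commute)
  finally have fs: "Re (L2_inner f s) = ?A" by simp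
  have "0 \<le> energy (\<lambda>x. f x - 1/2 * s x)" by simp
  also have "\<dots> = energy f + energy s / 4 - ?A"
  proof -
    have "Re (L2_inner f (\<lambda>x. 1/2 * s x)) = ?A / 2"
      unfolding L2_inner_mult_right using fs by simp
    moreover have "energy (\<lambda>x. 1/2 * s x) = energy s / 4"
      unfolding energy_mult_const by (simp add: power2_eq_square)
    ultimately show ?thesis
      unfolding energy_diff[OF f L2_mult_const[OF s, of "1/2"]] by simp
  qed
  also have "energy s \<le> 2 * ?A"
    unfolding s_def by (rule synthesis_bound[OF F])
  finally show ?thesis by simp
qed

abbreviation frame_sum :: "(real \<times> real \<Rightarrow> complex) \<Rightarrow> 'i set \<Rightarrow> real \<times> real \<Rightarrow> complex" where
  "frame_sum g F \<xi> \<equiv> \<Sum>\<eta>\<in>F. L2_inner g (elem \<eta>) * elem \<eta> \<xi>"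

text \<open>With \<open>S\<close> the tiles that meet a frequency, the frame operator multiplies there by this factor.\<close>

abbreviation multiplier :: "'t set \<Rightarrow> real \<times> real \<Rightarrow> real" where
  "multiplier S \<xi> \<equiv> \<Sum>\<tau>\<in>S. \<kappa> \<tau> * (cmod (G \<tau> \<xi>))\<^sup>2"

lemma filterlim_positions:
  assumes "\<tau> \<in> Tiles"
  shows "filterlim (\<lambda>F. pos ` {\<eta> \<in> F. tile \<eta> = \<tau>}) (finite_subsets_at_top UNIV) (finite_subsets_at_top I)"
  unfolding filterlim_finite_subsets_at_top
proof (intro allI impI)
  fix X :: "(int \<times> int) set" assume X: "finite X \<and> X \<subseteq> UNIV"
  obtain ix where ix: "\<And>k. ix k \<in> I \<and> tile (ix k) = \<tau> \<and> pos (ix k) = k"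
    using index_ex[OF assms] by metis
  show "eventually (\<lambda>F. finite (pos ` {\<eta> \<in> F. tile \<eta> = \<tau>}) \<and> X \<subseteq> pos ` {\<eta> \<in> F. tile \<eta> = \<tau>}
      \<and> pos ` {\<eta> \<in> F. tile \<eta> = \<tau>} \<subseteq> UNIV) (finite_subsets_at_top I)"
    unfolding eventually_finite_subsets_at_top
  proof (intro exI[of _ "ix ` X"] conjI allI impI)
    show "finite (ix ` X)" "ix ` X \<subseteq> I" using X ix by auto
    fix F assume F: "finite F \<and> ix ` X \<subseteq> F \<and> F \<subseteq> I"
    show "finite (pos ` {\<eta> \<in> F. tile \<eta> = \<tau>})" using F by auto
    show "X \<subseteq> pos ` {\<eta> \<in> F. tile \<eta> = \<tau>}"
    proof
      fix k assume "k \<in> X"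
      then have "ix k \<in> {\<eta> \<in> F. tile \<eta> = \<tau>}" "pos (ix k) = k" using F ix by auto
      then show "k \<in> pos ` {\<eta> \<in> F. tile \<eta> = \<tau>}" by (metis imageI)
    qed
  qed simp
qed

text \<open>On one tile the frame series is a Fourier series on the cell, transported by \<open>B \<tau>\<close>.\<close>

lemma tile_series_converges:
  assumes g: "tame g" and \<tau>: "\<tau> \<in> Tiles"
  shows "((\<lambda>F. energy (\<lambda>\<xi>. frame_sum g {\<eta> \<in> F. tile \<eta> = \<tau>} \<xi>
      - of_real (\<kappa> \<tau> * (cmod (G \<tau> \<xi>))\<^sup>2) * g \<xi>)) \<longlongrightarrow> 0) (finite_subsets_at_top I)"
proof -
  note gm [measurable] = tame_measurable[OF g] tame_measurable[OF window_tame[OF \<tau>]]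
    inverse_measurable[OF \<tau>] scales_area_measurable[OF area[OF \<tau>]]
  obtain M where M: "M > 0" "\<And>\<xi>. cmod (G \<tau> \<xi>) \<le> M"
    using tameE[OF window_tame[OF \<tau>]] by metis
  obtain N where N: "N > 0" "\<And>\<xi>. cmod (g \<xi>) \<le> N"
    using tameE[OF g] by metis
  define h where "h = (\<lambda>y. g (B' \<tau> y) * cnj (G \<tau> (B' \<tau> y)))"
  have hB: "h (B \<tau> \<xi>) = g \<xi> * cnj (G \<tau> \<xi>)" for \<xi>
    by (simp add: h_def inverse_left[OF \<tau>])
  have supp: "h y = 0" if "y \<notin> unit_cell" for y
    using that window_support[OF \<tau>, of "B' \<tau> y"] by (auto simp: h_def inverse_right[OF \<tau>])
  have h: "tame h"
  proof (rule tameI[where M = "N * M" and R = 1])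
    show "norm y \<le> 1" if "h y \<noteq> 0" for y using that supp norm_le_of_unit_cell by metis
    show "cmod (h y) \<le> N * M" for y
      using mult_mono[OF N(2)[of "B' \<tau> y"] M(2)[of "B' \<tau> y"]] N(1) by (simp add: h_def norm_mult)
  qed (simp add: h_def)
  define D where "D = (\<lambda>K y. h y - (\<Sum>k\<in>K. L2_inner h (cell_mode k) * cell_mode k y))"
  have DL2: "L2 (D K)" for K
    unfolding D_def by (intro L2_diff L2_sum L2_mult_const) (simp_all add: tame_L2 h)
  have coeff: "L2_inner g (elem \<eta>) = of_real (amp \<tau> / d \<tau>) * L2_inner h (cell_mode (pos \<eta>))"
    if "\<eta> \<in> I" "tile \<eta> = \<tau>" for \<eta>
  proof -
    have "L2_inner g (elem \<eta>) = (LINT \<xi>|lborel. of_real (amp \<tau>) * (h (B \<tau> \<xi>) * cnj (cell_mode (pos \<eta>) (B \<tau> \<xi>))))"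
      unfolding L2_inner_def using that
      by (intro Bochner_Integration.integral_cong refl) (simp add: elem_eq_cell_mode hB)
    also have "\<dots> = of_real (amp \<tau>) * (LINT \<xi>|lborel. h (B \<tau> \<xi>) * cnj (cell_mode (pos \<eta>) (B \<tau> \<xi>)))"
      by simp
    also have "(LINT \<xi>|lborel. h (B \<tau> \<xi>) * cnj (cell_mode (pos \<eta>) (B \<tau> \<xi>)))
        = (1 / d \<tau>) *\<^sub>R (LINT y|lborel. h y * cnj (cell_mode (pos \<eta>) y))"
      using tame_measurable[OF h] tame_measurable[OF tame_cell_mode, of "pos \<eta>"]
      by (intro scales_area_integral[OF area[OF \<tau>]]) simp
    finally show ?thesis by (simp add: L2_inner_def scaleR_conv_of_real)
  qed
  let ?R = "\<lambda>F. {\<eta> \<in> F. tile \<eta> = \<tau>}"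
  let ?E = "\<lambda>F. energy (\<lambda>\<xi>. frame_sum g (?R F) \<xi> - of_real (\<kappa> \<tau> * (cmod (G \<tau> \<xi>))\<^sup>2) * g \<xi>)"
  have eq: "frame_sum g (?R F) \<xi> - of_real (\<kappa> \<tau> * (cmod (G \<tau> \<xi>))\<^sup>2) * g \<xi>
      = - of_real (\<kappa> \<tau>) * G \<tau> \<xi> * D (pos ` ?R F) (B \<tau> \<xi>)"
    if F: "F \<subseteq> I" for F \<xi>
  proof -
    have inj: "inj_on pos (?R F)"
    proof (rule inj_onI)
      fix \<eta> \<eta>' assume "\<eta> \<in> ?R F" "\<eta>' \<in> ?R F" "pos \<eta> = pos \<eta>'"
      then show "\<eta> = \<eta>'" using F by (intro index_inj) auto
    qed
    have a: "of_real (amp \<tau> / d \<tau>) * complex_of_real (amp \<tau>) = of_real (\<kappa> \<tau>)"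
      using amp_square[OF \<tau>] d_pos[OF \<tau>]
      by (simp add: power2_eq_square field_simps flip: of_real_mult)
    have "frame_sum g (?R F) \<xi>
        = (\<Sum>\<eta>\<in>?R F. (of_real (amp \<tau> / d \<tau>) * of_real (amp \<tau>)) * G \<tau> \<xi>
            * (L2_inner h (cell_mode (pos \<eta>)) * cell_mode (pos \<eta>) (B \<tau> \<xi>)))"
      using F by (intro sum.cong refl) (auto simp: coeff elem_eq_cell_mode)
    also have "\<dots> = of_real (\<kappa> \<tau>) * G \<tau> \<xi> * (\<Sum>\<eta>\<in>?R F. L2_inner h (cell_mode (pos \<eta>)) * cell_mode (pos \<eta>) (B \<tau> \<xi>))"
      unfolding a by (simp add: sum_distrib_left)
    also have "(\<Sum>\<eta>\<in>?R F. L2_inner h (cell_mode (pos \<eta>)) * cell_mode (pos \<eta>) (B \<tau> \<xi>))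
        = h (B \<tau> \<xi>) - D (pos ` ?R F) (B \<tau> \<xi>)"
      unfolding D_def by (simp add: sum.reindex[OF inj])
    also have "of_real (\<kappa> \<tau>) * G \<tau> \<xi> * (h (B \<tau> \<xi>) - D (pos ` ?R F) (B \<tau> \<xi>))
        = of_real (\<kappa> \<tau>) * (G \<tau> \<xi> * cnj (G \<tau> \<xi>)) * g \<xi>
          - of_real (\<kappa> \<tau>) * G \<tau> \<xi> * D (pos ` ?R F) (B \<tau> \<xi>)"
      unfolding hB by (simp add: algebra_simps)
    finally show ?thesis by (simp add: complex_norm_square[symmetric])
  qed
  have "((\<lambda>F. (\<kappa> \<tau> * M)\<^sup>2 * (energy (D (pos ` ?R F)) / d \<tau>)) \<longlongrightarrow> (\<kappa> \<tau> * M)\<^sup>2 * (0 / d \<tau>))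
      (finite_subsets_at_top I)"
    using filterlim_compose[OF fourier_series_converges[OF h] filterlim_positions[OF \<tau>]] supp d_pos[OF \<tau>]
    unfolding D_def by (intro tendsto_intros) auto
  then have lim: "((\<lambda>F. (\<kappa> \<tau> * M)\<^sup>2 * (energy (D (pos ` ?R F)) / d \<tau>)) \<longlongrightarrow> 0) (finite_subsets_at_top I)"
    by simp
  show ?thesis
  proof (rule tendsto_sandwich[OF _ _ tendsto_const lim])
    show "eventually (\<lambda>F. ?E F \<le> (\<kappa> \<tau> * M)\<^sup>2 * (energy (D (pos ` ?R F)) / d \<tau>))
        (finite_subsets_at_top I)"
    proof (rule eventually_finite_subsets_at_top_weakI)
      fix F assume F: "F \<subseteq> I"
      let ?D = "\<lambda>\<xi>. D (pos ` ?R F) (B \<tau> \<xi>)"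
      have D: "L2 ?D" by (rule scales_area_L2[OF area[OF \<tau>] DL2])
      note [measurable] = L2_measurable[OF D]
      have "energy (\<lambda>\<xi>. - of_real (\<kappa> \<tau>) * G \<tau> \<xi> * ?D \<xi>) \<le> energy (\<lambda>\<xi>. of_real (\<kappa> \<tau> * M) * ?D \<xi>)"
        using M kappa[OF \<tau>]
        by (intro energy_mono L2_mult_const D) (auto simp: norm_mult intro!: mult_mono)
      also have "\<dots> = (\<kappa> \<tau> * M)\<^sup>2 * (energy (D (pos ` ?R F)) / d \<tau>)"
        using scales_area_energy[OF area[OF \<tau>] L2_measurable[OF DL2]]
        by (simp add: energy_mult_const norm_mult power_mult_distrib)
      finally show "?E F \<le> (\<kappa> \<tau> * M)\<^sup>2 * (energy (D (pos ` ?R F)) / d \<tau>)"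
        by (simp only: eq[OF F])
    qed
  qed auto
qed

abbreviation frame_error :: "(real \<times> real \<Rightarrow> complex) \<Rightarrow> 't set \<Rightarrow> 'i set \<Rightarrow> real" where
  "frame_error g S F \<equiv> energy (\<lambda>\<xi>. frame_sum g F \<xi> - of_real (multiplier S \<xi>) * g \<xi>)"

lemma frame_series_converges:
  assumes g: "tame g" and S: "finite S" "S \<subseteq> Tiles"
    and out: "\<And>\<tau> \<xi>. \<tau> \<in> Tiles \<Longrightarrow> \<tau> \<notin> S \<Longrightarrow> g \<xi> * cnj (G \<tau> \<xi>) = 0"
  shows "((\<lambda>F. frame_error g S F) \<longlongrightarrow> 0) (finite_subsets_at_top I)"
proof -
  let ?R = "\<lambda>F \<tau>. {\<eta> \<in> F. tile \<eta> = \<tau>}"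
  define D where "D = (\<lambda>F \<tau> \<xi>. (frame_sum g (?R F \<tau>) \<xi>)
      - of_real (\<kappa> \<tau> * (cmod (G \<tau> \<xi>))\<^sup>2) * g \<xi>)"
  have "((\<lambda>F. real (card S) * (\<Sum>\<tau>\<in>S. energy (D F \<tau>))) \<longlongrightarrow> real (card S) * (\<Sum>\<tau>\<in>S. 0)) (finite_subsets_at_top I)"
    unfolding D_def using S by (intro tendsto_intros tile_series_converges g) auto
  then have lim: "((\<lambda>F. real (card S) * (\<Sum>\<tau>\<in>S. energy (D F \<tau>))) \<longlongrightarrow> 0) (finite_subsets_at_top I)"
    by simp
  show ?thesis
  proof (rule tendsto_sandwich[OF _ _ tendsto_const lim])
    show "eventually (\<lambda>F. frame_error g S F \<le> real (card S) * (\<Sum>\<tau>\<in>S. energy (D F \<tau>)))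
        (finite_subsets_at_top I)"
    proof (rule eventually_finite_subsets_at_top_weakI)
      fix F assume F: "finite F" "F \<subseteq> I"
      have zero: "L2_inner g (elem \<eta>) = 0" if "\<eta> \<in> F" "tile \<eta> \<notin> S" for \<eta>
      proof -
        have "g \<xi> * cnj (elem \<eta> \<xi>) = 0" for \<xi>
          using out[of "tile \<eta>" \<xi>] tile_in[of \<eta>] that F by (auto simp: elem_def)
        then have "(\<lambda>\<xi>. g \<xi> * cnj (elem \<eta> \<xi>)) = (\<lambda>\<xi>. 0)" by (rule ext)
        then show ?thesis by (simp only: L2_inner_def) simp
      qed
      have "frame_sum g F \<xi> = (\<Sum>\<tau>\<in>S. \<Sum>\<eta>\<in>?R F \<tau>. L2_inner g (elem \<eta>) * elem \<eta> \<xi>)" for \<xi>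
      proof -
        have "(\<Sum>\<tau>\<in>S. \<Sum>\<eta>\<in>?R F \<tau>. L2_inner g (elem \<eta>) * elem \<eta> \<xi>)
            = (\<Sum>\<tau>\<in>S. \<Sum>\<eta>\<in>{\<eta> \<in> {\<eta> \<in> F. tile \<eta> \<in> S}. tile \<eta> = \<tau>}. L2_inner g (elem \<eta>) * elem \<eta> \<xi>)"
          by (intro sum.cong) auto
        also have "\<dots> = (\<Sum>\<eta>\<in>{\<eta> \<in> F. tile \<eta> \<in> S}. L2_inner g (elem \<eta>) * elem \<eta> \<xi>)"
          using F S by (intro sum.group) auto
        also have "\<dots> = frame_sum g F \<xi>"
          using F zero by (intro sum.mono_neutral_left) auto
        finally show ?thesis ..
      qed
      then have eq: "frame_sum g F \<xi>
          - of_real (multiplier S \<xi>) * g \<xi> = (\<Sum>\<tau>\<in>S. D F \<tau> \<xi>)" for \<xi>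
        by (simp add: D_def sum_subtractf sum_distrib_right)
      have "L2 (D F \<tau>)" if \<tau>: "\<tau> \<in> S" for \<tau>
      proof -
        have t: "\<tau> \<in> Tiles" using \<tau> S by auto
        obtain M where M: "\<And>\<xi>. cmod (G \<tau> \<xi>) \<le> M"
          using tameE[OF window_tame[OF t]] by metis
        note [measurable] = tame_measurable[OF window_tame[OF t]]
        have "cmod (of_real (\<kappa> \<tau> * (cmod (G \<tau> \<xi>))\<^sup>2)) \<le> \<kappa> \<tau> * M\<^sup>2" for \<xi>
          using M[of \<xi>] kappa[OF t] by (auto simp: norm_mult norm_power intro!: mult_left_mono power_mono)
        then show ?thesis
          unfolding D_def using F
          by (intro tame_L2 tame_diff tame_sum tame_const_mult elem_tame tame_mult[OF g]) auto
      qed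
      then show "frame_error g S F \<le> real (card S) * (\<Sum>\<tau>\<in>S. energy (D F \<tau>))"
        unfolding eq using S by (intro energy_sum_le) auto
    qed
  qed auto
qed

text \<open>By Bessel's inequality only finitely many coefficients reach the threshold.\<close>

lemma thresholded_set_finite:
  assumes f: "L2 f" and \<beta>: "\<beta> > 0"
  shows "finite {\<eta> \<in> I. \<beta> \<le> cmod (L2_inner f (atom \<eta>))}"
proof (rule ccontr)
  let ?T = "{\<eta> \<in> I. \<beta> \<le> cmod (L2_inner f (atom \<eta>))}"
  assume inf: "infinite ?T"
  obtain n :: nat where n: "2 * energy f / \<beta>\<^sup>2 < real n"
    using reals_Archimedean2 by blast
  obtain F where F: "F \<subseteq> ?T" "finite F" "card F = n"
    using infinite_arbitrarily_large[OF inf] by blast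
  have "real n * \<beta>\<^sup>2 = (\<Sum>\<eta>\<in>F. \<beta>\<^sup>2)" using F by simp
  also have "\<dots> \<le> (\<Sum>\<eta>\<in>F. (cmod (L2_inner f (atom \<eta>)))\<^sup>2)"
    using F \<beta> by (intro sum_mono power_mono) auto
  also have "\<dots> \<le> 2 * energy f" using F by (intro bessel f) auto
  finally show False using n \<beta> by (simp add: field_simps)
qed

text \<open>A threshold below the nonzero coefficients of \<open>f\<close> on a large finite index set keeps all of
  these, so that hard thresholding reproduces the frame series of the band-limited part
  \<open>inv_fourier g\<close> of \<open>f\<close> up to \<open>\<epsilon>\<close>. The other errors are the deviation of the frame operator from
  the identity and the contribution of the missing part \<open>m\<close>, whatever indices are kept: for it
  Bessel's inequality and the synthesis bound suffice.\<close>

theorem hard_thresholding: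
  assumes g: "tame g" and S: "finite S" "S \<subseteq> Tiles"
    and out: "\<And>\<tau> \<xi>. \<tau> \<in> Tiles \<Longrightarrow> \<tau> \<notin> S \<Longrightarrow> g \<xi> * cnj (G \<tau> \<xi>) = 0"
    and m: "L2 m" and \<epsilon>: "\<epsilon> > 0"
    and f_def: "f = (\<lambda>x. inv_fourier g x - m x)"
  obtains \<beta> where "\<beta> > 0" "finite {\<eta> \<in> I. \<beta> \<le> cmod (L2_inner f (atom \<eta>))}"
    "energy (\<lambda>x. (\<Sum>\<eta>\<in>{\<eta> \<in> I. \<beta> \<le> cmod (L2_inner f (atom \<eta>))}. L2_inner f (atom \<eta>) * atom \<eta> x) - inv_fourier g x)
      \<le> \<epsilon> + 4 * energy (\<lambda>\<xi>. of_real ((multiplier S \<xi>) - 1) * g \<xi>) + 8 * energy m"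
proof -
  let ?m = "multiplier S"
  let ?c = "\<lambda>\<eta>. L2_inner f (atom \<eta>)"
  have u: "L2 (inv_fourier g)" by (rule plancherel[OF g])
  have f: "L2 f" unfolding f_def by (rule L2_diff[OF u m])
  have "eventually (\<lambda>F. frame_error g S F < \<epsilon> / 4)
      (finite_subsets_at_top I)"
    using frame_series_converges[OF g S out] \<epsilon> by (intro order_tendstoD) auto
  then obtain F0 where "finite F0 \<and> F0 \<subseteq> I \<and> (\<forall>F. finite F \<and> F0 \<subseteq> F \<and> F \<subseteq> I \<longrightarrow>
      frame_error g S F < \<epsilon> / 4)"
    unfolding eventually_finite_subsets_at_top ..
  then have F0: "finite F0" "F0 \<subseteq> I"
    and F0_le: "\<And>F. finite F \<Longrightarrow> F0 \<subseteq> F \<Longrightarrow> F \<subseteq> I \<Longrightarrow>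
      frame_error g S F < \<epsilon> / 4"
    by simp_all
  define \<beta> where "\<beta> = Min (insert 1 ((\<lambda>\<eta>. cmod (?c \<eta>)) ` {\<eta> \<in> F0. ?c \<eta> \<noteq> 0}))"
  have \<beta>: "\<beta> > 0" unfolding \<beta>_def using F0 by (subst Min_gr_iff) auto
  have small: "\<beta> \<le> cmod (?c \<eta>)" if "\<eta> \<in> F0" "?c \<eta> \<noteq> 0" for \<eta>
    unfolding \<beta>_def using F0 that by (intro Min_le) auto
  define T where "T = {\<eta> \<in> I. \<beta> \<le> cmod (?c \<eta>)}"
  have T: "finite T" unfolding T_def by (rule thresholded_set_finite[OF f \<beta>])
  define F where "F = T \<union> F0"
  have F: "finite F" "F \<subseteq> I" "F0 \<subseteq> F" using T F0 by (auto simp: F_def T_def)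
  have drop: "(\<Sum>\<eta>\<in>T. ?c \<eta> * atom \<eta> x) = (\<Sum>\<eta>\<in>F. ?c \<eta> * atom \<eta> x)" for x
  proof (rule sum.mono_neutral_left)
    show "\<forall>\<eta>\<in>F - T. ?c \<eta> * atom \<eta> x = 0"
      using small F0 by (auto simp: F_def T_def)
  qed (use F in \<open>auto simp: F_def\<close>)
  have cu: "L2_inner (inv_fourier g) (atom \<eta>) = L2_inner g (elem \<eta>)" if "\<eta> \<in> F" for \<eta>
    unfolding atom_def using that F by (intro plancherel_inner g elem_tame) auto
  have cf: "?c \<eta> = L2_inner g (elem \<eta>) - L2_inner m (atom \<eta>)" if "\<eta> \<in> F" for \<eta>
    unfolding f_def using that F cu[OF that] L2_inner_diff_left[OF u m atom_L2] by auto
  define A where "A = (\<lambda>\<xi>. frame_sum g F \<xi> - g \<xi>)"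
  define Bm where "Bm = (\<lambda>x. \<Sum>\<eta>\<in>F. L2_inner m (atom \<eta>) * atom \<eta> x)"
  have sum_tame: "tame (\<lambda>\<xi>. \<Sum>\<eta>\<in>F. L2_inner g (elem \<eta>) * elem \<eta> \<xi>)"
    using F by (intro tame_sum tame_const_mult elem_tame) auto
  have A: "tame A" unfolding A_def by (intro tame_diff sum_tame g)
  have Bm: "L2 Bm" unfolding Bm_def using F by (intro L2_sum L2_mult_const atom_L2) auto
  have decomp: "(\<Sum>\<eta>\<in>T. ?c \<eta> * atom \<eta> x) - inv_fourier g x = inv_fourier A x - Bm x" for x
  proof -
    have "(\<Sum>\<eta>\<in>F. ?c \<eta> * atom \<eta> x) = (\<Sum>\<eta>\<in>F. L2_inner g (elem \<eta>) * atom \<eta> x) - Bm x"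
      by (simp add: Bm_def cf left_diff_distrib sum_subtractf)
    moreover have "inv_fourier A x = (\<Sum>\<eta>\<in>F. L2_inner g (elem \<eta>) * atom \<eta> x) - inv_fourier g x"
      unfolding A_def inv_fourier_diff[OF sum_tame g]
      using fun_cong[OF synthesis_eq_inv_fourier[OF F(2)], of "\<lambda>\<eta>. L2_inner g (elem \<eta>)" x] by simp
    ultimately show ?thesis by (simp add: drop)
  qed
  have "energy A \<le> 2 * frame_error g S F
      + 2 * energy (\<lambda>\<xi>. of_real (?m \<xi> - 1) * g \<xi>)"
  proof -
    have mg: "tame (\<lambda>\<xi>. of_real (?m \<xi>) * g \<xi>)"
    proof -
      have "tame (\<lambda>\<xi>. of_real (\<kappa> \<tau>) * (cnj (G \<tau> \<xi>) * (G \<tau> \<xi> * g \<xi>)))" if \<tau>: "\<tau> \<in> S" for \<tau>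
      proof -
        have t: "\<tau> \<in> Tiles" using \<tau> S by auto
        obtain M where M: "\<And>\<xi>. cmod (G \<tau> \<xi>) \<le> M"
          using tameE[OF window_tame[OF t]] by metis
        note [measurable] = tame_measurable[OF window_tame[OF t]]
        show ?thesis
          by (intro tame_const_mult tame_mult[where M = M] g) (auto simp: M)
      qed
      then have "tame (\<lambda>\<xi>. \<Sum>\<tau>\<in>S. of_real (\<kappa> \<tau>) * (cnj (G \<tau> \<xi>) * (G \<tau> \<xi> * g \<xi>)))"
        by (rule tame_sum)
      moreover have "(\<Sum>\<tau>\<in>S. of_real (\<kappa> \<tau>) * (cnj (G \<tau> \<xi>) * (G \<tau> \<xi> * g \<xi>))) = of_real (?m \<xi>) * g \<xi>" for \<xi>
        by (simp only: of_real_sum of_real_mult complex_norm_square sum_distrib_left mult_ac)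
      ultimately show ?thesis by simp
    qed
    have Aeq: "A \<xi> = (frame_sum g F \<xi> - of_real (?m \<xi>) * g \<xi>) + of_real (?m \<xi> - 1) * g \<xi>" for \<xi>
      by (simp add: A_def algebra_simps)
    have "tame (\<lambda>\<xi>. of_real (?m \<xi> - 1) * g \<xi>)"
      using tame_diff[OF mg g] by (simp add: left_diff_distrib)
    then show ?thesis
      unfolding Aeq[abs_def] by (intro energy_add_le tame_L2 tame_diff sum_tame mg)
  qed
  also have "frame_error g S F \<le> \<epsilon> / 4"
    using F0_le[OF F(1,3,2)] by simp
  finally have EA: "energy A \<le> \<epsilon> / 2 + 2 * energy (\<lambda>\<xi>. of_real (?m \<xi> - 1) * g \<xi>)" by simp
  have EB: "energy Bm \<le> 4 * energy m"
    using synthesis_bound[OF F(1,2), of "\<lambda>\<eta>. L2_inner m (atom \<eta>)"] bessel[OF m F(1,2)]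
    by (simp add: Bm_def)
  have "energy (\<lambda>x. (\<Sum>\<eta>\<in>T. ?c \<eta> * atom \<eta> x) - inv_fourier g x) \<le> 2 * energy (inv_fourier A) + 2 * energy Bm"
    unfolding decomp by (intro energy_diff_le plancherel A Bm)
  also have "\<dots> \<le> \<epsilon> + 4 * energy (\<lambda>\<xi>. of_real (?m \<xi> - 1) * g \<xi>) + 8 * energy m"
    using EA EB by (simp add: plancherel A)
  finally show ?thesis
    using \<beta> T unfolding T_def by (intro that[of \<beta>]) auto
qed

end

section \<open>The shearlet system as a system of modulated tiles\<close>

datatype tile = ScalingTile | ConeTile cone nat int | SeamTile nat int

fun tile_of :: "shearlet_index \<Rightarrow> tile" where
  "tile_of (Coarse k) = ScalingTile"
| "tile_of (Cone \<iota> j l k) = ConeTile \<iota> j l"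
| "tile_of (Seam j l k) = SeamTile j l"

fun pos_of :: "shearlet_index \<Rightarrow> int \<times> int" where
  "pos_of (Coarse k) = k"
| "pos_of (Cone \<iota> j l k) = k"
| "pos_of (Seam j l k) = k"

definition scale_tiles :: "nat \<Rightarrow> tile set" where
  "scale_tiles j = ConeTile Hor j ` {- (2 ^ j)<..<2 ^ j} \<union> ConeTile Ver j ` {- (2 ^ j)<..<2 ^ j}
     \<union> SeamTile j ` {- (2 ^ j), 2 ^ j}"

definition tiles_upto :: "nat \<Rightarrow> tile set" where
  "tiles_upto J = insert ScalingTile (\<Union>j<J. scale_tiles j)"

definition tiles :: "tile set" where
  "tiles = insert ScalingTile (\<Union>j. scale_tiles j)"

fun tile_map :: "tile \<Rightarrow> real \<times> real \<Rightarrow> real \<times> real" where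
  "tile_map ScalingTile \<xi> = - \<xi>"
| "tile_map (ConeTile \<iota> j l) \<xi> = shear_coord \<iota> j l \<xi>"
| "tile_map (SeamTile j l) \<xi> = (if j = 0 then \<xi> else (1/2) *\<^sub>R shear_coord Hor j l \<xi>)"

fun tile_unmap :: "tile \<Rightarrow> real \<times> real \<Rightarrow> real \<times> real" where
  "tile_unmap ScalingTile y = - y"
| "tile_unmap (ConeTile Hor j l) y = (4 ^ j * fst y, 2 ^ j * (snd y + of_int l * fst y))"
| "tile_unmap (ConeTile Ver j l) y = (2 ^ j * (fst y + of_int l * snd y), 4 ^ j * snd y)"
| "tile_unmap (SeamTile j l) y =
     (if j = 0 then y else (4 ^ j * (2 * fst y), 2 ^ j * (2 * snd y + of_int l * (2 * fst y))))"

fun tile_det :: "tile \<Rightarrow> real" where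
  "tile_det ScalingTile = 1"
| "tile_det (ConeTile \<iota> j l) = 1 / (4 ^ j * 2 ^ j)"
| "tile_det (SeamTile j l) = (if j = 0 then 1 else 1 / (4 * (4 ^ j * 2 ^ j)))"

text \<open>The half-integer modulations of the seam elements with \<open>j \<ge> 1\<close> call for the factor
  \<open>2 powr (- 1)\<close>, but these elements carry the factor \<open>2 powr (- 1/2)\<close>. They contribute to the frame
  operator twice what a Parseval frame requires, and the system as given is a frame with bounds
  \<open>1\<close> and \<open>2\<close>.\<close>

fun tile_excess :: "tile \<Rightarrow> real" where
  "tile_excess (SeamTile j l) = (if j = 0 then 1 else 2)"
| "tile_excess _ = 1"

lemma two_powr_minus: "2 powr (- real j) = 1 / 2 ^ j"
  by (simp add: powr_minus_divide powr_realpow)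

lemma two_powr_minus_double: "2 powr (- 2 * real j) = 1 / 4 ^ j"
proof -
  have "2 powr (- 2 * real j) = 2 powr (- real j) * 2 powr (- real j)"
    by (simp flip: powr_add)
  also have "\<dots> = 1 / 4 ^ j"
    by (simp add: two_powr_minus power_mult_distrib[symmetric])
  finally show ?thesis .
qed

lemma shear_coord_Hor:
  "shear_coord Hor j l \<xi> = (fst \<xi> / 4 ^ j, snd \<xi> / 2 ^ j - of_int l * fst \<xi> / 4 ^ j)"
proof -
  have "(2::real) ^ j * 2 ^ j = 4 ^ j" by (simp add: power_mult_distrib[symmetric])
  then show ?thesis
    by (cases \<xi>) (simp add: shear_coord_def two_powr_minus power2_eq_square)
qed

lemma shear_coord_Ver:
  "shear_coord Ver j l \<xi> = (fst \<xi> / 2 ^ j - of_int l * snd \<xi> / 4 ^ j, snd \<xi> / 4 ^ j)"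
proof -
  have "(2::real) ^ j * 2 ^ j = 4 ^ j" by (simp add: power_mult_distrib[symmetric])
  then show ?thesis
    by (cases \<xi>) (simp add: shear_coord_def two_powr_minus power2_eq_square)
qed

lemma scales_area_tile_map: "scales_area (tile_map \<tau>) (tile_det \<tau>)"
proof (cases \<tau>)
  case ScalingTile
  have "scales_area (\<lambda>z. - z) 1"
    using scales_area_shear(1)[of "-1" "-1" 0] by (simp add: uminus_prod_def)
  moreover have "tile_map ScalingTile = (\<lambda>z. - z)" by (rule ext) simp
  ultimately show ?thesis using ScalingTile by simp
next
  case (ConeTile \<iota> j l)
  show ?thesis
  proof (cases \<iota>)
    case Hor
    have "tile_map (ConeTile Hor j l)
        = (\<lambda>z. (1 / 4 ^ j * fst z, (- of_int l / 4 ^ j) * fst z + 1 / 2 ^ j * snd z))"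
      by (rule ext) (simp add: shear_coord_Hor)
    then show ?thesis
      using scales_area_shear(1)[of "1 / 4 ^ j" "1 / 2 ^ j" "- of_int l / 4 ^ j"] ConeTile Hor
      by (simp add: abs_mult)
  next
    case Ver
    have "tile_map (ConeTile Ver j l)
        = (\<lambda>z. ((- of_int l / 4 ^ j) * snd z + 1 / 2 ^ j * fst z, 1 / 4 ^ j * snd z))"
      by (rule ext) (simp add: shear_coord_Ver)
    then show ?thesis
      using scales_area_shear(2)[of "1 / 2 ^ j" "1 / 4 ^ j" "- of_int l / 4 ^ j"] ConeTile Ver
      by (simp add: abs_mult mult.commute)
  qed
next
  case (SeamTile j l)
  show ?thesis
  proof (cases "j = 0")
    case True
    have "tile_map (SeamTile j l) = (\<lambda>z. z)" using True by (intro ext) simp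
    moreover have "scales_area (\<lambda>z. z) 1"
      using scales_area_shear(1)[of 1 1 0] by simp
    ultimately show ?thesis using SeamTile True by simp
  next
    case False
    have "tile_map (SeamTile j l)
        = (\<lambda>z. (1 / (2 * 4 ^ j) * fst z, (- of_int l / (2 * 4 ^ j)) * fst z + 1 / (2 * 2 ^ j) * snd z))"
      using False by (intro ext) (simp add: shear_coord_Hor diff_divide_distrib)
    then show ?thesis
      using scales_area_shear(1)[of "1 / (2 * 4 ^ j)" "1 / (2 * 2 ^ j)" "- of_int l / (2 * 4 ^ j)"]
        SeamTile False
      by (simp add: abs_mult)
  qed
qed

lemma tile_map_unmap: "tile_map \<tau> (tile_unmap \<tau> y) = y"
proof (cases \<tau>)
  case (ConeTile \<iota> j l)
  then show ?thesis
    by (cases \<iota>; cases y) (auto simp: shear_coord_Hor shear_coord_Ver)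
next
  case (SeamTile j l)
  then show ?thesis by (cases y) (auto simp: shear_coord_Hor)
qed simp

lemma tile_unmap_map: "tile_unmap \<tau> (tile_map \<tau> y) = y"
proof (cases \<tau>)
  case (ConeTile \<iota> j l)
  then show ?thesis
    by (cases \<iota>; cases y) (auto simp: shear_coord_Hor shear_coord_Ver)
next
  case (SeamTile j l)
  then show ?thesis by (cases y) (auto simp: shear_coord_Hor field_simps)
qed simp

lemma tile_unmap_measurable: "tile_unmap \<tau> \<in> borel_measurable borel"
proof -
  have "continuous_on UNIV (tile_unmap \<tau>)"
  proof (cases \<tau>)
    case (ConeTile \<iota> j l)
    then show ?thesis by (cases \<iota>) (auto intro!: continuous_intros)
  next
    case (SeamTile j l)
    then show ?thesis by (cases "j = 0") (auto intro!: continuous_intros)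
  qed (auto intro!: continuous_intros)
  then show ?thesis by (rule borel_measurable_continuous_onI)
qed

lemma shearlet_index_bij:
  "bij_betw (\<lambda>\<eta>. (tile_of \<eta>, pos_of \<eta>)) shearlet_indices (tiles \<times> UNIV)"
  unfolding bij_betw_def
proof
  show "inj_on (\<lambda>\<eta>. (tile_of \<eta>, pos_of \<eta>)) shearlet_indices"
  proof (rule inj_onI)
    fix \<eta> \<eta>' assume "(tile_of \<eta>, pos_of \<eta>) = (tile_of \<eta>', pos_of \<eta>')"
    then show "\<eta> = \<eta>'" by (cases \<eta>; cases \<eta>') auto
  qed
  have "(\<tau>, k) \<in> (\<lambda>\<eta>. (tile_of \<eta>, pos_of \<eta>)) ` shearlet_indices" if "\<tau> \<in> tiles" for \<tau> k
  proof (cases \<tau>)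
    case ScalingTile
    then show ?thesis
      by (intro image_eqI[of _ _ "Coarse k"]) (auto simp: shearlet_indices_def)
  next
    case (ConeTile \<iota> j l)
    then have "\<bar>l\<bar> < 2 ^ j" using that by (auto simp: tiles_def scale_tiles_def)
    then show ?thesis using ConeTile
      by (intro image_eqI[of _ _ "Cone \<iota> j l k"]) (auto simp: shearlet_indices_def)
  next
    case (SeamTile j l)
    then have "l = 2 ^ j \<or> l = - (2 ^ j)" using that by (auto simp: tiles_def scale_tiles_def)
    then show ?thesis using SeamTile
      by (intro image_eqI[of _ _ "Seam j l k"]) (auto simp: shearlet_indices_def)
  qed
  moreover have "tile_of \<eta> \<in> tiles" if "\<eta> \<in> shearlet_indices" for \<eta>
  proof (cases \<eta>)
    case (Cone \<iota> j l k)
    then show ?thesis using that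
      by (cases \<iota>) (auto simp: shearlet_indices_def tiles_def scale_tiles_def abs_less_iff image_iff
          intro!: exI[of _ j])
  qed (use that in \<open>auto simp: shearlet_indices_def tiles_def scale_tiles_def\<close>)
  ultimately show "(\<lambda>\<eta>. (tile_of \<eta>, pos_of \<eta>)) ` shearlet_indices = tiles \<times> UNIV"
    by auto
qed

lemma smooth_imp_continuous: "smooth f \<Longrightarrow> continuous_on UNIV f"
  unfolding smooth_def
  by (metis continuous_at_imp_continuous_on has_vector_derivative_continuous)

lemma AE_off_axes: "AE \<xi> in lborel. fst \<xi> \<noteq> (0::real) \<and> snd \<xi> \<noteq> (0::real)"
proof -
  have "negligible {\<xi> :: real \<times> real. (1, 0) \<bullet> \<xi> = 0}" "negligible {\<xi> :: real \<times> real. (0, 1) \<bullet> \<xi> = 0}"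
    by (rule negligible_hyperplane, simp add: zero_prod_def)+
  then have "AE \<xi> in lebesgue. \<xi> \<notin> {\<xi> :: real \<times> real. (1, 0) \<bullet> \<xi> = 0} \<union> {\<xi>. (0, 1) \<bullet> \<xi> = 0}"
    by (intro AE_not_in null_sets.Un) (simp_all add: negligible_iff_null_sets)
  then have "AE \<xi> in lebesgue. fst \<xi> \<noteq> (0::real) \<and> snd \<xi> \<noteq> (0::real)"
    by (rule eventually_mono) (auto simp: inner_prod_def)
  then show ?thesis
    by (subst (asm) AE_completion_iff) auto
qed

locale shearlet_data =
  fixes \<nu> :: "real \<Rightarrow> real" and V :: "real \<Rightarrow> complex"
  assumes nu_smooth: "smooth \<nu>"
    and nu_0: "\<And>x. x \<le> 0 \<Longrightarrow> \<nu> x = 0"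
    and nu_1: "\<And>x. x \<ge> 1 \<Longrightarrow> \<nu> x = 1"
    and V_smooth: "smooth V"
    and V_supp: "supp V \<subseteq> {-1..1}"
    and V_sum: "\<And>u. u \<in> {-1..1} \<Longrightarrow> (\<Sum>k\<in>{-1..1::int}. (cmod (V (u + of_int k)))\<^sup>2) = 1"
begin

lemma nu_measurable [measurable]: "\<nu> \<in> borel_measurable borel"
  by (intro borel_measurable_continuous_onI smooth_imp_continuous nu_smooth)

lemma V_measurable [measurable]: "V \<in> borel_measurable borel"
  by (intro borel_measurable_continuous_onI smooth_imp_continuous V_smooth)

subsection \<open>The radial partition\<close>

lemma phi_hat_measurable [measurable]: "meyer_phi_hat \<nu> \<in> borel_measurable borel"
  unfolding meyer_phi_hat_def[abs_def] by measurable

lemma abs_phi_hat_le_1: "\<bar>meyer_phi_hat \<nu> x\<bar> \<le> 1"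
  by (simp add: meyer_phi_hat_def)

lemma phi_hat_near_0: "\<bar>x\<bar> \<le> 1/16 \<Longrightarrow> meyer_phi_hat \<nu> x = 1"
  by (simp add: meyer_phi_hat_def)

lemma phi_hat_support: "meyer_phi_hat \<nu> x \<noteq> 0 \<Longrightarrow> \<bar>x\<bar> \<le> 1/8"
  by (auto simp: meyer_phi_hat_def split: if_splits)

lemma scaling_hat_measurable [measurable]: "scaling_hat \<nu> \<in> borel_measurable borel"
  unfolding scaling_hat_def[abs_def] by measurable

lemma abs_scaling_hat_le_1: "\<bar>scaling_hat \<nu> \<xi>\<bar> \<le> 1"
  using mult_mono[OF abs_phi_hat_le_1[of "fst \<xi>"] abs_phi_hat_le_1[of "snd \<xi>"]]
  by (simp add: scaling_hat_def abs_mult)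

lemma scaling_hat_near_0: "\<bar>fst \<xi>\<bar> \<le> 1/16 \<Longrightarrow> \<bar>snd \<xi>\<bar> \<le> 1/16 \<Longrightarrow> scaling_hat \<nu> \<xi> = 1"
  by (simp add: scaling_hat_def phi_hat_near_0)

lemma scaling_hat_support: "scaling_hat \<nu> \<xi> \<noteq> 0 \<Longrightarrow> \<bar>fst \<xi>\<bar> \<le> 1/8 \<and> \<bar>snd \<xi>\<bar> \<le> 1/8"
  using phi_hat_support by (auto simp: scaling_hat_def)

text \<open>This makes the radicand of \<open>corona\<close> nonnegative, although \<open>\<nu>\<close> may leave the unit interval.\<close>

lemma scaling_hat_quarter: "scaling_hat \<nu> \<xi> \<noteq> 0 \<Longrightarrow> scaling_hat \<nu> ((1/4) *\<^sub>R \<xi>) = 1"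
  using scaling_hat_support[of \<xi>] by (intro scaling_hat_near_0) auto

lemma corona_square: "(corona \<nu> \<xi>)\<^sup>2 = (scaling_hat \<nu> ((1/4) *\<^sub>R \<xi>))\<^sup>2 - (scaling_hat \<nu> \<xi>)\<^sup>2"
proof -
  have "(scaling_hat \<nu> \<xi>)\<^sup>2 \<le> (scaling_hat \<nu> ((1/4) *\<^sub>R \<xi>))\<^sup>2"
    using scaling_hat_quarter[of \<xi>] abs_scaling_hat_le_1[of \<xi>]
    by (cases "scaling_hat \<nu> \<xi> = 0") (simp_all add: abs_square_le_1)
  then show ?thesis by (simp add: corona_def)
qed

lemma corona_measurable [measurable]: "corona \<nu> \<in> borel_measurable borel"
  unfolding corona_def[abs_def] by measurable

lemma abs_corona_le_1: "\<bar>corona \<nu> \<xi>\<bar> \<le> 1"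
proof -
  have "(corona \<nu> \<xi>)\<^sup>2 \<le> 1"
    using corona_square[of \<xi>] abs_scaling_hat_le_1[of "(1/4) *\<^sub>R \<xi>"] zero_le_power2[of "scaling_hat \<nu> \<xi>"]
    unfolding abs_square_le_1[symmetric] by linarith
  then show ?thesis by (simp add: abs_square_le_1)
qed

lemma corona_support: "corona \<nu> \<xi> \<noteq> 0 \<Longrightarrow> \<bar>fst \<xi>\<bar> \<le> 1/2 \<and> \<bar>snd \<xi>\<bar> \<le> 1/2"
proof -
  assume "corona \<nu> \<xi> \<noteq> 0"
  then have "scaling_hat \<nu> ((1/4) *\<^sub>R \<xi>) \<noteq> 0 \<or> scaling_hat \<nu> \<xi> \<noteq> 0"
    by (auto simp: corona_def)
  then have "scaling_hat \<nu> ((1/4) *\<^sub>R \<xi>) \<noteq> 0"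
    using scaling_hat_quarter[of \<xi>] by auto
  from scaling_hat_support[OF this] show ?thesis by auto
qed

lemma corona_near_0: "\<bar>fst \<xi>\<bar> \<le> 1/16 \<Longrightarrow> \<bar>snd \<xi>\<bar> \<le> 1/16 \<Longrightarrow> corona \<nu> \<xi> = 0"
  by (simp add: corona_def scaling_hat_near_0)

lemma corona_telescope:
  "(scaling_hat \<nu> \<xi>)\<^sup>2 + (\<Sum>j<J. (corona \<nu> ((1 / 4 ^ j) *\<^sub>R \<xi>))\<^sup>2) = (scaling_hat \<nu> ((1 / 4 ^ J) *\<^sub>R \<xi>))\<^sup>2"
  by (induction J) (simp_all add: corona_square add.assoc[symmetric])

subsection \<open>The angular partition\<close>

lemma V_zero:
  assumes "\<bar>x\<bar> \<ge> 1" shows "V x = 0"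
proof -
  have "open (V -` (- {0}))"
    using smooth_imp_continuous[OF V_smooth] by (intro open_vimage) auto
  moreover have "V -` (- {0}) \<subseteq> {-1..1}"
    using V_supp closure_subset[of "{x. V x \<noteq> 0}"] by (auto simp: supp_def)
  ultimately have "V -` (- {0}) \<subseteq> interior {-1..1}"
    by (intro interior_maximal)
  then have *: "V -` (- {0}) \<subseteq> {-1<..<1}" by simp
  show ?thesis
  proof (rule ccontr)
    assume "V x \<noteq> 0"
    then have "x \<in> {-1<..<1}" using * by blast
    then show False using assms by auto
  qed
qed

lemma norm_V_le_1: "cmod (V x) \<le> 1"
proof (cases "\<bar>x\<bar> \<ge> 1")
  case False
  then have "(cmod (V (x + of_int 0)))\<^sup>2 \<le> (\<Sum>k\<in>{-1..1::int}. (cmod (V (x + of_int k)))\<^sup>2)"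
    by (intro member_le_sum) auto
  also have "\<dots> = 1" using False by (intro V_sum) auto
  finally show ?thesis using power2_le_imp_le[of "cmod (V x)" 1] by simp
qed (simp add: V_zero)

lemma angular_sum:
  assumes "\<bar>u\<bar> \<le> 1"
  shows "(\<Sum>l\<in>{- (2 ^ j)..2 ^ j::int}. (cmod (V (2 ^ j * u - of_int l)))\<^sup>2) = 1"
proof -
  define x where "x = 2 ^ j * u"
  define n where "n = \<lfloor>x\<rfloor>"
  have "\<bar>x\<bar> \<le> 2 ^ j" using assms mult_left_mono[OF assms, of "2 ^ j"] by (simp add: x_def abs_mult)
  then have x: "x \<le> of_int (2 ^ j)" "of_int (- (2 ^ j)) \<le> x" by auto
  have n: "of_int n \<le> x" "x < of_int n + 1" by (auto simp: n_def)
  \<comment> \<open>At the ends of the range \<open>n - 1\<close> or \<open>n + 1\<close> may fall outside of it, but then its term vanishes.\<close>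
  have far: "V (x - of_int l) = 0" if "l \<notin> {- (2 ^ j)..2 ^ j} \<inter> {n - 1..n + 1}" for l
  proof (rule V_zero)
    have "l > n + 1 \<or> l < n - 1 \<or> l > 2 ^ j \<or> l < - (2 ^ j)" using that by auto
    then consider "l > n + 1" | "l < n - 1" | "l > 2 ^ j" | "l < - (2 ^ j)" by blast
    then show "1 \<le> \<bar>x - of_int l\<bar>"
    proof cases
      case 1
      then have "of_int (n + 2) \<le> (of_int l :: real)" by (simp only: of_int_le_iff)
      then show ?thesis using n by simp
    next
      case 2
      then have "of_int l \<le> (of_int (n - 2) :: real)" by (simp only: of_int_le_iff)
      then show ?thesis using n by simp
    next
      case 3
      then have "of_int (2 ^ j + 1) \<le> (of_int l :: real)" by (simp only: of_int_le_iff)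
      then show ?thesis using x(1) by simp
    next
      case 4
      then have "of_int l \<le> (of_int (- (2 ^ j) - 1) :: real)" by (simp only: of_int_le_iff)
      then show ?thesis using x(2) by simp
    qed
  qed
  have "(\<Sum>l\<in>{- (2 ^ j)..2 ^ j}. (cmod (V (x - of_int l)))\<^sup>2)
      = (\<Sum>l\<in>{- (2 ^ j)..2 ^ j} \<inter> {n - 1..n + 1}. (cmod (V (x - of_int l)))\<^sup>2)"
    using far by (intro sum.mono_neutral_right) auto
  also have "\<dots> = (\<Sum>l\<in>{n - 1..n + 1}. (cmod (V (x - of_int l)))\<^sup>2)"
    using far by (intro sum.mono_neutral_left) auto
  also have "\<dots> = (\<Sum>k\<in>{-1..1::int}. (cmod (V ((x - of_int n) + of_int k)))\<^sup>2)"
    by (rule sum.reindex_bij_witness[of _ "\<lambda>k. n - k" "\<lambda>l. n - l"]) (auto simp: algebra_simps)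
  also have "\<dots> = 1" using n by (intro V_sum) auto
  finally show ?thesis by (simp add: x_def)
qed

lemma V_outside_cone:
  assumes "\<bar>t\<bar> \<ge> 1" "l \<in> {- (2 ^ j)<..<2 ^ j}"
  shows "V (2 ^ j * t - of_int l) = 0"
proof (rule V_zero)
  have "\<bar>l\<bar> \<le> 2 ^ j - 1" using assms(2) by auto
  then have "\<bar>real_of_int l\<bar> \<le> 2 ^ j - 1"
    using of_int_le_iff[of "\<bar>l\<bar>" "2 ^ j - 1", where ?'a = real] by simp
  moreover have "2 ^ j \<le> \<bar>2 ^ j * t\<bar>"
    using mult_left_mono[OF assms(1), of "2 ^ j"] by (simp add: abs_mult)
  ultimately show "1 \<le> \<bar>2 ^ j * t - of_int l\<bar>" by linarith
qed

lemma cone_range_split: "{- (2 ^ j)..2 ^ j::int} = {- (2 ^ j), 2 ^ j} \<union> {- (2 ^ j)<..<2 ^ j}"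
proof -
  have "(0::int) < 2 ^ j" by simp
  then show ?thesis by auto
qed

lemma angular_sum_split:
  assumes "\<bar>u\<bar> \<le> 1"
  shows "(\<Sum>l\<in>{- (2 ^ j)<..<2 ^ j::int}. (cmod (V (2 ^ j * u - of_int l)))\<^sup>2)
    + (\<Sum>l\<in>{- (2 ^ j), 2 ^ j::int}. (cmod (V (2 ^ j * u - of_int l)))\<^sup>2) = 1"
proof -
  have "(\<Sum>l\<in>{- (2 ^ j), 2 ^ j} \<union> {- (2 ^ j)<..<2 ^ j}. (cmod (V (2 ^ j * u - of_int l)))\<^sup>2)
      = (\<Sum>l\<in>{- (2 ^ j), 2 ^ j}. (cmod (V (2 ^ j * u - of_int l)))\<^sup>2)
        + (\<Sum>l\<in>{- (2 ^ j)<..<2 ^ j}. (cmod (V (2 ^ j * u - of_int l)))\<^sup>2)"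
    by (rule sum.union_disjoint) auto
  then show ?thesis
    using angular_sum[OF assms, of j] unfolding cone_range_split by linarith
qed

subsection \<open>The windows\<close>

text \<open>Off the coordinate axes the windows are the Fourier transforms of the shearlets without their
  constants and modulations. On the axes all but the scaling window are set to zero, so that the
  support property and the bound for the sum of squares hold everywhere.\<close>

fun window :: "tile \<Rightarrow> real \<times> real \<Rightarrow> complex" where
  "window ScalingTile \<xi> = of_real (scaling_hat \<nu> \<xi>)"
| "window (ConeTile Hor j l) \<xi> = (if fst \<xi> = 0 \<or> snd \<xi> = 0 then 0
     else of_real (corona \<nu> ((1 / 4 ^ j) *\<^sub>R \<xi>)) * V (2 ^ j * (snd \<xi> / fst \<xi>) - of_int l))"
| "window (ConeTile Ver j l) \<xi> = (if fst \<xi> = 0 \<or> snd \<xi> = 0 then 0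
     else of_real (corona \<nu> ((1 / 4 ^ j) *\<^sub>R \<xi>)) * V (2 ^ j * (fst \<xi> / snd \<xi>) - of_int l))"
| "window (SeamTile j l) \<xi> = (if fst \<xi> = 0 \<or> snd \<xi> = 0 then 0
     else of_real (corona \<nu> ((1 / 4 ^ j) *\<^sub>R \<xi>)) * seam_V V j l \<xi>)"

lemma seam_V_measurable [measurable]: "seam_V V j l \<in> borel_measurable borel"
  unfolding seam_V_def[abs_def] by measurable

lemma window_measurable: "window \<tau> \<in> borel_measurable borel"
proof (cases \<tau>)
  case (ConeTile \<iota> j l)
  show ?thesis
  proof (cases \<iota>)
    case Hor
    have "(\<lambda>\<xi>. window (ConeTile Hor j l) \<xi>) \<in> borel_measurable borel"
      unfolding window.simps by measurable
    then show ?thesis by (simp only: ConeTile Hor)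
  next
    case Ver
    have "(\<lambda>\<xi>. window (ConeTile Ver j l) \<xi>) \<in> borel_measurable borel"
      unfolding window.simps by measurable
    then show ?thesis by (simp only: ConeTile Ver)
  qed
next
  case ScalingTile
  have "(\<lambda>\<xi>. window ScalingTile \<xi>) \<in> borel_measurable borel"
    unfolding window.simps by measurable
  then show ?thesis by (simp only: ScalingTile)
next
  case (SeamTile j l)
  have "(\<lambda>\<xi>. window (SeamTile j l) \<xi>) \<in> borel_measurable borel"
    unfolding window.simps by measurable
  then show ?thesis by (simp only: SeamTile)
qed

lemma norm_window_le_1: "cmod (window \<tau> \<xi>) \<le> 1"
proof -
  have 1: "\<bar>corona \<nu> \<zeta>\<bar> * cmod (V x) \<le> 1" for \<zeta> x
    using mult_mono[OF abs_corona_le_1[of \<zeta>] norm_V_le_1[of x]] by simp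
  show ?thesis
    by (cases "(\<tau>, \<xi>)" rule: window.cases)
      (simp_all add: 1 abs_scaling_hat_le_1 seam_V_def norm_mult)
qed

fun tile_scale :: "tile \<Rightarrow> nat" where
  "tile_scale ScalingTile = 0"
| "tile_scale (ConeTile \<iota> j l) = j"
| "tile_scale (SeamTile j l) = j"

lemma window_radial_support:
  assumes "window \<tau> \<xi> \<noteq> 0"
  shows "\<bar>fst \<xi>\<bar> \<le> 4 ^ tile_scale \<tau> / 2 \<and> \<bar>snd \<xi>\<bar> \<le> 4 ^ tile_scale \<tau> / 2"
proof -
  have 1: "\<bar>fst \<xi>\<bar> \<le> 4 ^ j / 2 \<and> \<bar>snd \<xi>\<bar> \<le> 4 ^ j / 2" if "corona \<nu> ((1 / 4 ^ j) *\<^sub>R \<xi>) \<noteq> 0" for j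
    using corona_support[OF that] by (simp add: field_simps)
  show ?thesis
    using assms 1 scaling_hat_support[of \<xi>]
    by (cases "(\<tau>, \<xi>)" rule: window.cases) (auto split: if_splits)
qed

lemma window_tame: "tame (window \<tau>)"
proof (rule tameI[OF window_measurable norm_window_le_1, where R = "4 ^ tile_scale \<tau>"])
  fix \<xi> assume "window \<tau> \<xi> \<noteq> 0"
  then show "norm \<xi> \<le> 4 ^ tile_scale \<tau>"
    using window_radial_support[of \<tau> \<xi>] norm_Pair_le[of "fst \<xi>" "snd \<xi>"] by simp
qed

text \<open>In the sheared coordinates one component is the dilated frequency and the other is this
  component times the argument of \<open>V\<close>. On the vertical part of a seam tile the roles are exchanged,
  up to a sign.\<close>

lemma window_support_unit_cell:
  assumes \<tau>: "\<tau> \<in> tiles" and w: "window \<tau> \<xi> \<noteq> 0"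
  shows "tile_map \<tau> \<xi> \<in> unit_cell"
proof -
  have prod: "\<bar>a * t\<bar> \<le> 1/2" if "\<bar>a\<bar> \<le> 1/2" "V t \<noteq> 0" for a t :: real
  proof -
    have "\<bar>t\<bar> \<le> 1" using V_zero[of t] that(2) by (cases "\<bar>t\<bar> \<ge> 1") auto
    then show ?thesis using mult_mono[OF that(1), of "\<bar>t\<bar>" 1] by (simp add: abs_mult)
  qed
  have four: "(2::real) ^ j * 2 ^ j = 4 ^ j" for j
    by (simp add: power_mult_distrib[symmetric])
  show ?thesis
  proof (cases \<tau>)
    case ScalingTile
    then show ?thesis using w scaling_hat_support[of \<xi>] by (auto simp: unit_cell_def)
  next
    case (ConeTile \<iota> j l)
    have rad: "\<bar>fst \<xi> / 4 ^ j\<bar> \<le> 1/2" "\<bar>snd \<xi> / 4 ^ j\<bar> \<le> 1/2"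
      using window_radial_support[OF w] ConeTile by (auto simp: field_simps)
    show ?thesis
    proof (cases \<iota>)
      case Hor
      have nz: "fst \<xi> \<noteq> 0" "V (2 ^ j * (snd \<xi> / fst \<xi>) - of_int l) \<noteq> 0"
        using w ConeTile Hor by (auto split: if_splits)
      have "snd \<xi> / 2 ^ j - of_int l * fst \<xi> / 4 ^ j = fst \<xi> / 4 ^ j * (2 ^ j * (snd \<xi> / fst \<xi>) - of_int l)"
        using nz(1) by (simp add: field_simps four[symmetric])
      then show ?thesis
        using ConeTile Hor rad prod[OF rad(1) nz(2)] by (simp add: shear_coord_Hor unit_cell_def)
    next
      case Ver
      have nz: "snd \<xi> \<noteq> 0" "V (2 ^ j * (fst \<xi> / snd \<xi>) - of_int l) \<noteq> 0"
        using w ConeTile Ver by (auto split: if_splits)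
      have "fst \<xi> / 2 ^ j - of_int l * snd \<xi> / 4 ^ j = snd \<xi> / 4 ^ j * (2 ^ j * (fst \<xi> / snd \<xi>) - of_int l)"
        using nz(1) by (simp add: field_simps four[symmetric])
      then show ?thesis
        using ConeTile Ver rad prod[OF rad(2) nz(2)] by (simp add: shear_coord_Ver unit_cell_def)
    qed
  next
    case (SeamTile j l)
    have rad: "\<bar>fst \<xi> / 4 ^ j\<bar> \<le> 1/2" "\<bar>snd \<xi> / 4 ^ j\<bar> \<le> 1/2"
      using window_radial_support[OF w] SeamTile by (auto simp: field_simps)
    have nz: "fst \<xi> \<noteq> 0" "snd \<xi> \<noteq> 0" "seam_V V j l \<xi> \<noteq> 0"
      using w SeamTile by (auto split: if_splits)
    have "\<bar>snd \<xi> / 2 ^ j - of_int l * fst \<xi> / 4 ^ j\<bar> \<le> 1/2"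
    proof (cases "\<bar>snd \<xi> / fst \<xi>\<bar> \<le> 1")
      case True
      then have v: "V (2 ^ j * (snd \<xi> / fst \<xi>) - of_int l) \<noteq> 0" using nz by (simp add: seam_V_def)
      have "snd \<xi> / 2 ^ j - of_int l * fst \<xi> / 4 ^ j = fst \<xi> / 4 ^ j * (2 ^ j * (snd \<xi> / fst \<xi>) - of_int l)"
        using nz(1) by (simp add: field_simps four[symmetric])
      then show ?thesis using prod[OF rad(1) v] by simp
    next
      case False
      then have v: "V (2 ^ j * (fst \<xi> / snd \<xi>) - of_int l) \<noteq> 0" using nz by (simp add: seam_V_def)
      have "l = 2 ^ j \<or> l = - (2 ^ j)"
        using \<tau> SeamTile by (auto simp: tiles_def scale_tiles_def)
      then have "\<bar>snd \<xi> / 2 ^ j - of_int l * fst \<xi> / 4 ^ j\<bar> = \<bar>snd \<xi> / 4 ^ j * (2 ^ j * (fst \<xi> / snd \<xi>) - of_int l)\<bar>"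
      proof
        assume l: "l = 2 ^ j"
        have "snd \<xi> / 2 ^ j - of_int l * fst \<xi> / 4 ^ j = - (snd \<xi> / 4 ^ j * (2 ^ j * (fst \<xi> / snd \<xi>) - of_int l))"
          using nz by (simp add: l field_simps four[symmetric])
        then show ?thesis by simp
      next
        assume l: "l = - (2 ^ j)"
        have "snd \<xi> / 2 ^ j - of_int l * fst \<xi> / 4 ^ j = snd \<xi> / 4 ^ j * (2 ^ j * (fst \<xi> / snd \<xi>) - of_int l)"
          using nz by (simp add: l field_simps four[symmetric])
        then show ?thesis by simp
      qed
      then show ?thesis using prod[OF rad(2) v] by simp
    qed
    then show ?thesis using SeamTile rad by (auto simp: shear_coord_Hor unit_cell_def)
  qed
qed

lemma scale_tiles_sum:
  assumes "fst \<xi> \<noteq> 0" "snd \<xi> \<noteq> 0"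
  shows "(\<Sum>\<tau>\<in>scale_tiles j. (cmod (window \<tau> \<xi>))\<^sup>2) = (corona \<nu> ((1 / 4 ^ j) *\<^sub>R \<xi>))\<^sup>2"
proof -
  let ?C = "(corona \<nu> ((1 / 4 ^ j) *\<^sub>R \<xi>))\<^sup>2"
  let ?L = "{- (2 ^ j)<..<2 ^ j::int}"
  let ?h = "\<Sum>l\<in>?L. (cmod (V (2 ^ j * (snd \<xi> / fst \<xi>) - of_int l)))\<^sup>2"
  let ?v = "\<Sum>l\<in>?L. (cmod (V (2 ^ j * (fst \<xi> / snd \<xi>) - of_int l)))\<^sup>2"
  let ?s = "\<Sum>l\<in>{- (2 ^ j), 2 ^ j::int}. (cmod (seam_V V j l \<xi>))\<^sup>2"
  have "(\<Sum>\<tau>\<in>scale_tiles j. (cmod (window \<tau> \<xi>))\<^sup>2)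
      = (\<Sum>\<tau>\<in>ConeTile Hor j ` ?L. (cmod (window \<tau> \<xi>))\<^sup>2) + (\<Sum>\<tau>\<in>ConeTile Ver j ` ?L. (cmod (window \<tau> \<xi>))\<^sup>2)
        + (\<Sum>\<tau>\<in>SeamTile j ` {- (2 ^ j), 2 ^ j}. (cmod (window \<tau> \<xi>))\<^sup>2)"
    unfolding scale_tiles_def by (subst sum.union_disjoint; auto)+
  also have "\<dots> = ?C * ?h + ?C * ?v + ?C * ?s"
    using assms unfolding sum_distrib_left
    by (subst sum.reindex, force simp: inj_on_def)+
      (simp add: norm_mult power_mult_distrib del: sum.insert)
  also have "\<dots> = ?C * (?h + ?v + ?s)" by (simp add: distrib_left)
  also have "?h + ?v + ?s = 1"
  proof (cases "\<bar>snd \<xi> / fst \<xi>\<bar> \<le> 1")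
    case True
    then have "1 \<le> \<bar>fst \<xi> / snd \<xi>\<bar>" using assms by (simp add: abs_divide field_simps)
    then have "?v = 0" by (intro sum.neutral ballI) (simp only: V_outside_cone, simp)
    moreover have "?h + ?s = 1"
      using angular_sum_split[OF True, of j] True by (simp add: seam_V_def del: sum.insert)
    ultimately show ?thesis by simp
  next
    case False
    then have "\<bar>fst \<xi> / snd \<xi>\<bar> \<le> 1" using assms by (simp add: abs_divide field_simps)
    then have "?v + ?s = 1"
      using angular_sum_split[of "fst \<xi> / snd \<xi>" j] False by (simp add: seam_V_def del: sum.insert)
    moreover have "1 \<le> \<bar>snd \<xi> / fst \<xi>\<bar>" using False by linarith
    then have "?h = 0" by (intro sum.neutral ballI) (simp only: V_outside_cone, simp)
    ultimately show ?thesis by simp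
  qed
  finally show ?thesis by simp
qed

lemma finite_scale_tiles: "finite (scale_tiles j)"
  by (simp add: scale_tiles_def)

lemma finite_tiles_upto: "finite (tiles_upto J)"
  by (simp add: tiles_upto_def finite_scale_tiles)

lemma tiles_upto_subset: "tiles_upto J \<subseteq> tiles"
  by (auto simp: tiles_upto_def tiles_def)

lemma tiles_upto_sum_split:
  fixes p :: "tile \<Rightarrow> real"
  shows "(\<Sum>\<tau>\<in>tiles_upto J. p \<tau>) = p ScalingTile + (\<Sum>j<J. \<Sum>\<tau>\<in>scale_tiles j. p \<tau>)"
proof -
  have "(\<Sum>\<tau>\<in>(\<Union>j<J. scale_tiles j). p \<tau>) = (\<Sum>j<J. \<Sum>\<tau>\<in>scale_tiles j. p \<tau>)"
    by (intro sum.UNION_disjoint) (auto simp: finite_scale_tiles, auto simp: scale_tiles_def)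
  moreover have "ScalingTile \<notin> (\<Union>j<J. scale_tiles j)" by (auto simp: scale_tiles_def)
  ultimately show ?thesis
    unfolding tiles_upto_def by (simp add: finite_scale_tiles)
qed

lemma tiles_upto_sum:
  assumes "fst \<xi> \<noteq> 0" "snd \<xi> \<noteq> 0"
  shows "(\<Sum>\<tau>\<in>tiles_upto J. (cmod (window \<tau> \<xi>))\<^sup>2) = (scaling_hat \<nu> ((1 / 4 ^ J) *\<^sub>R \<xi>))\<^sup>2"
  unfolding tiles_upto_sum_split scale_tiles_sum[OF assms] corona_telescope[symmetric]
  by simp

lemma window_on_axes:
  "fst \<xi> = 0 \<or> snd \<xi> = 0 \<Longrightarrow> \<tau> \<noteq> ScalingTile \<Longrightarrow> window \<tau> \<xi> = 0"
  by (cases "(\<tau>, \<xi>)" rule: window.cases) auto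

lemma tiles_upto_sum_le_1: "(\<Sum>\<tau>\<in>tiles_upto J. (cmod (window \<tau> \<xi>))\<^sup>2) \<le> 1"
proof (cases "fst \<xi> = 0 \<or> snd \<xi> = 0")
  case True
  have "(\<Sum>\<tau>\<in>tiles_upto J. (cmod (window \<tau> \<xi>))\<^sup>2) = (\<Sum>\<tau>\<in>{ScalingTile}. (cmod (window \<tau> \<xi>))\<^sup>2)"
    using True finite_tiles_upto
    by (intro sum.mono_neutral_right) (auto simp: window_on_axes tiles_upto_def)
  then show ?thesis by (simp add: abs_square_le_1 abs_scaling_hat_le_1)
next
  case False
  then show ?thesis by (simp add: tiles_upto_sum abs_square_le_1 abs_scaling_hat_le_1)
qed

lemma in_tiles_upto:
  assumes "\<tau> \<in> tiles" "tile_scale \<tau> < J"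
  shows "\<tau> \<in> tiles_upto J"
proof -
  have scale: "tile_scale \<tau> = j" if "\<tau> \<in> scale_tiles j" for j
    using that by (auto simp: scale_tiles_def)
  consider "\<tau> = ScalingTile" | j where "\<tau> \<in> scale_tiles j"
    using assms(1) by (auto simp: tiles_def)
  then show ?thesis
  proof cases
    case (2 j)
    then have "j < J" using scale assms(2) by blast
    then show ?thesis using 2 unfolding tiles_upto_def by blast
  qed (simp add: tiles_upto_def)
qed

lemma finite_tiles_bounded_scale:
  assumes "finite S" "S \<subseteq> tiles"
  obtains J where "S \<subseteq> tiles_upto J"
proof
  show "S \<subseteq> tiles_upto (Suc (Max (insert 0 (tile_scale ` S))))"
  proof
    fix \<tau> assume \<tau>: "\<tau> \<in> S"
    then have "tile_scale \<tau> < Suc (Max (insert 0 (tile_scale ` S)))"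
      using assms by (auto simp: less_Suc_eq_le intro!: Max_ge)
    then show "\<tau> \<in> tiles_upto (Suc (Max (insert 0 (tile_scale ` S))))"
      using \<tau> assms(2) by (intro in_tiles_upto) auto
  qed
qed

end

sublocale shearlet_data \<subseteq> tile_system shearlet_indices tiles tile_of pos_of window tile_map tile_unmap tile_det tile_excess
proof
  fix S and \<xi> :: "real \<times> real" assume S: "finite S" "S \<subseteq> tiles"
  obtain J where J: "S \<subseteq> tiles_upto J"
    using finite_tiles_bounded_scale[OF S] .
  have "(\<Sum>\<tau>\<in>S. (cmod (window \<tau> \<xi>))\<^sup>2) \<le> (\<Sum>\<tau>\<in>tiles_upto J. (cmod (window \<tau> \<xi>))\<^sup>2)"
    using J finite_tiles_upto by (intro sum_mono2) auto
  then show "(\<Sum>\<tau>\<in>S. (cmod (window \<tau> \<xi>))\<^sup>2) \<le> 1"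
    using tiles_upto_sum_le_1[where J = J and \<xi> = \<xi>] by linarith
next
  fix \<tau> show "0 < tile_excess \<tau> \<and> tile_excess \<tau> \<le> 2"
    by (cases \<tau>) auto
qed (auto simp: shearlet_index_bij window_tame scales_area_tile_map tile_unmap_measurable
    tile_map_unmap tile_unmap_map window_support_unit_cell)

subsection \<open>The elements of the system\<close>

lemma inv_fourier_cong_AE:
  assumes "f \<in> borel_measurable borel" "g \<in> borel_measurable borel" "AE \<xi> in lborel. f \<xi> = g \<xi>"
  shows "inv_fourier f = inv_fourier g"
proof
  fix x
  note [measurable] = assms(1,2)
  show "inv_fourier f x = inv_fourier g x"
    unfolding inv_fourier_def using assms(3) by (intro integral_cong_AE) auto
qed

lemma cone_indicator_measurable [measurable]:
  "(\<lambda>\<xi>::real \<times> real. of_bool (\<bar>snd \<xi>\<bar> \<le> 2 * \<bar>fst \<xi>\<bar>) :: complex) \<in> borel_measurable borel"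
proof -
  have "(\<lambda>\<xi>::real \<times> real. if \<bar>snd \<xi>\<bar> \<le> 2 * \<bar>fst \<xi>\<bar> then 1 else 0 :: complex) \<in> borel_measurable borel"
    by measurable
  then show ?thesis by (simp add: of_bool_def)
qed

context shearlet_data
begin

lemma cone_V_eq: "cone_V V Hor p = V (snd p / fst p)" "cone_V V Ver p = V (fst p / snd p)"
  by (cases p; simp)+

lemma cone_V_measurable [measurable]: "cone_V V \<iota> \<in> borel_measurable borel"
  by (cases \<iota>) (simp_all add: cone_V_eq[abs_def])

lemma shear_coord_measurable [measurable]: "shear_coord \<iota> j l \<in> borel_measurable borel"
proof -
  have "tile_map (ConeTile \<iota> j l) = shear_coord \<iota> j l" by (rule ext) simp
  then show ?thesis
    using scales_area_measurable[OF scales_area_tile_map[of "ConeTile \<iota> j l"]] by simp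
qed

lemma shear_quotient:
  assumes "fst \<xi> \<noteq> 0" "snd \<xi> \<noteq> 0"
  shows "cone_V V Hor (shear_coord Hor j l \<xi>) = V (2 ^ j * (snd \<xi> / fst \<xi>) - of_int l)"
    and "cone_V V Ver (shear_coord Ver j l \<xi>) = V (2 ^ j * (fst \<xi> / snd \<xi>) - of_int l)"
proof -
  have four: "(4::real) ^ j = 2 ^ j * 2 ^ j" by (simp add: power_mult_distrib[symmetric])
  have "(snd \<xi> / 2 ^ j - of_int l * fst \<xi> / 4 ^ j) / (fst \<xi> / 4 ^ j) = 2 ^ j * (snd \<xi> / fst \<xi>) - of_int l"
    using assms by (simp add: four field_simps)
  then show "cone_V V Hor (shear_coord Hor j l \<xi>) = V (2 ^ j * (snd \<xi> / fst \<xi>) - of_int l)"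
    by (simp only: cone_V_eq shear_coord_Hor fst_conv snd_conv)
  have "(fst \<xi> / 2 ^ j - of_int l * snd \<xi> / 4 ^ j) / (snd \<xi> / 4 ^ j) = 2 ^ j * (fst \<xi> / snd \<xi>) - of_int l"
    using assms by (simp add: four field_simps)
  then show "cone_V V Ver (shear_coord Ver j l \<xi>) = V (2 ^ j * (fst \<xi> / snd \<xi>) - of_int l)"
    by (simp only: cone_V_eq shear_coord_Ver fst_conv snd_conv)
qed

lemma amp_tiles:
  "amp ScalingTile = 1"
  "amp (ConeTile \<iota> j l) = 2 powr (- (3 * real j / 2))"
  "amp (SeamTile j l) = (if j = 0 then 1 else 2 powr (- (3 * real j / 2) - 1/2))"
proof -
  have "(2 powr (- (3 * real j / 2)))\<^sup>2 = 2 powr (- real j) * 2 powr (- 2 * real j)"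
    by (simp add: power2_eq_square flip: powr_add)
  then have sq: "(2 powr (- (3 * real j / 2)))\<^sup>2 = 1 / (4 ^ j * 2 ^ j)"
    unfolding two_powr_minus two_powr_minus_double by simp
  then show "amp (ConeTile \<iota> j l) = 2 powr (- (3 * real j / 2))"
    unfolding amp_def by (intro real_sqrt_unique) auto
  have "(2 powr (- (3 * real j / 2) - 1/2))\<^sup>2 = (2 powr (- (3 * real j / 2)))\<^sup>2 * (2 powr (- 1))"
    unfolding power2_eq_square powr_add[symmetric] by (rule arg_cong[where f = "(powr) 2"]) simp
  then have "(2 powr (- (3 * real j / 2) - 1/2))\<^sup>2 = 2 * (1 / (4 * (4 ^ j * 2 ^ j)))"
    unfolding sq by (simp add: powr_minus_divide)
  then show "amp (SeamTile j l) = (if j = 0 then 1 else 2 powr (- (3 * real j / 2) - 1/2))"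
    unfolding amp_def by (cases "j = 0") (auto intro!: real_sqrt_unique)
qed (simp add: amp_def)

lemma cone_shearlet_eq_atom: "inv_fourier (cone_shearlet_hat \<nu> V \<iota> j l k) = inv_fourier (elem (Cone \<iota> j l k))"
proof (rule inv_fourier_cong_AE)
  show "cone_shearlet_hat \<nu> V \<iota> j l k \<in> borel_measurable borel"
    unfolding cone_shearlet_hat_def[abs_def] by measurable
  have [measurable]: "window (ConeTile \<iota> j l) \<in> borel_measurable borel"
    by (rule window_measurable)
  show "elem (Cone \<iota> j l k) \<in> borel_measurable borel"
    unfolding elem_def[abs_def] tile_of.simps pos_of.simps tile_map.simps by measurable
  show "AE \<xi> in lborel. cone_shearlet_hat \<nu> V \<iota> j l k \<xi> = elem (Cone \<iota> j l k) \<xi>"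
    using AE_off_axes
  proof (rule eventually_mono)
    fix \<xi> :: "real \<times> real" assume "fst \<xi> \<noteq> 0 \<and> snd \<xi> \<noteq> 0"
    then show "cone_shearlet_hat \<nu> V \<iota> j l k \<xi> = elem (Cone \<iota> j l k) \<xi>"
      by (cases \<iota>) (simp_all only: cone_shearlet_hat_def elem_def tile_of.simps pos_of.simps
          window.simps tile_map.simps amp_tiles shear_quotient two_powr_minus_double
          character_def of_real_mult if_False simp_thms mult.assoc)
  qed
qed

lemma seam_shearlet_eq_atom: "inv_fourier (seam_shearlet_hat \<nu> V j l k) = inv_fourier (elem (Seam j l k))"
proof (rule inv_fourier_cong_AE)
  show "seam_shearlet_hat \<nu> V j l k \<in> borel_measurable borel"
    unfolding seam_shearlet_hat_def[abs_def] by measurable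
  have [measurable]: "window (SeamTile j l) \<in> borel_measurable borel"
    by (rule window_measurable)
  have [measurable]: "tile_map (SeamTile j l) \<in> borel_measurable borel"
    by (rule scales_area_measurable[OF scales_area_tile_map])
  show "elem (Seam j l k) \<in> borel_measurable borel"
    unfolding elem_def[abs_def] tile_of.simps pos_of.simps by measurable
  show "AE \<xi> in lborel. seam_shearlet_hat \<nu> V j l k \<xi> = elem (Seam j l k) \<xi>"
    using AE_off_axes
  proof (rule eventually_mono)
    fix \<xi> :: "real \<times> real" assume nz: "fst \<xi> \<noteq> 0 \<and> snd \<xi> \<noteq> 0"
    show "seam_shearlet_hat \<nu> V j l k \<xi> = elem (Seam j l k) \<xi>"
    proof (cases "j = 0")
      case True
      then show ?thesis using nz
        by (simp add: seam_shearlet_hat_def elem_def amp_tiles character_def)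
    next
      case False
      have "2 * pi * ((1/2) *\<^sub>R shear_coord Hor j l \<xi> \<bullet> lattice k) = pi * (shear_coord Hor j l \<xi> \<bullet> lattice k)"
        by simp
      then show ?thesis using nz False
        by (simp only: seam_shearlet_hat_def elem_def tile_of.simps pos_of.simps
            window.simps tile_map.simps amp_tiles two_powr_minus_double
            character_def of_real_mult if_False simp_thms mult.assoc)
    qed
  qed
qed

lemma shearlet_eq_atom: "shearlet \<nu> V \<eta> = atom \<eta>"
proof (cases \<eta>)
  case (Coarse k)
  have "shearlet \<nu> V (Coarse k) x = atom (Coarse k) x" for x
    unfolding shearlet.simps atom_def inv_fourier_def
    by (intro Bochner_Integration.integral_cong refl)
      (simp add: elem_def amp_tiles character_def cis_mult inner_diff_left inner_commute algebra_simps)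
  then show ?thesis using Coarse by auto
next
  case (Cone \<iota> j l k)
  have "shearlet \<nu> V (Cone \<iota> j l k) x = atom (Cone \<iota> j l k) x" for x
    by (simp add: cone_shearlet_eq_atom atom_def)
  then show ?thesis using Cone by auto
next
  case (Seam j l k)
  have "shearlet \<nu> V (Seam j l k) x = atom (Seam j l k) x" for x
    by (simp add: seam_shearlet_eq_atom atom_def)
  then show ?thesis using Seam by auto
qed

subsection \<open>The frame operator away from the seams\<close>

text \<open>In the vertical cone the support of \<open>V\<close> confines a seam tile with \<open>j \<ge> 1\<close> to frequencies at which
  \<open>\<xi>\<^sub>1 / \<xi>\<^sub>2\<close> is within \<open>2 powr (- j) \<le> 1/2\<close> of \<open>1\<close> or \<open>- 1\<close>. So the seams, the only tiles with excess,
  stay away from the vertical axis.\<close>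

lemma seam_window_near_vertical_axis:
  assumes "l \<in> {- (2 ^ j), 2 ^ j}" "j \<noteq> 0" "2 * \<bar>fst \<xi>\<bar> < \<bar>snd \<xi>\<bar>"
  shows "window (SeamTile j l) \<xi> = 0"
proof (cases "fst \<xi> = 0 \<or> snd \<xi> = 0")
  case False
  then have t: "\<bar>fst \<xi> / snd \<xi>\<bar> < 1/2" using assms(3) by (simp add: abs_divide field_simps)
  define x where "x = 2 ^ j * (fst \<xi> / snd \<xi>)"
  have "\<bar>x\<bar> \<le> 2 ^ j * (1/2)"
    unfolding x_def abs_mult using t by (intro mult_mono) auto
  then have x: "\<bar>x\<bar> \<le> 2 ^ j / 2" by simp
  have "(2::real) ^ 1 \<le> 2 ^ j" using assms(2) by (intro power_increasing) auto
  moreover have "\<bar>real_of_int l\<bar> = 2 ^ j" using assms(1) by auto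
  ultimately have "1 \<le> \<bar>x - of_int l\<bar>" using x by simp
  then have "V (2 ^ j * (fst \<xi> / snd \<xi>) - of_int l) = 0" unfolding x_def by (rule V_zero)
  moreover have "\<not> \<bar>snd \<xi> / fst \<xi>\<bar> \<le> 1"
    using False assms(3) by (simp add: abs_divide field_simps)
  ultimately show ?thesis by (simp add: seam_V_def)
qed simp

text \<open>The deviation from the identity of the frame operator restricted to scales below \<open>J\<close>.\<close>

abbreviation excess :: "nat \<Rightarrow> real \<times> real \<Rightarrow> real" where
  "excess J \<xi> \<equiv> multiplier (tiles_upto J) \<xi> - 1"

lemma abs_excess_le_1:
  "\<bar>excess J \<xi>\<bar> \<le> 1"
proof -
  have ex: "0 \<le> tile_excess \<tau>" "tile_excess \<tau> \<le> 2" for \<tau>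
    by (cases \<tau>; simp)+
  have "0 \<le> (\<Sum>\<tau>\<in>tiles_upto J. tile_excess \<tau> * (cmod (window \<tau> \<xi>))\<^sup>2)"
    using ex by (intro sum_nonneg mult_nonneg_nonneg) auto
  moreover have "(\<Sum>\<tau>\<in>tiles_upto J. tile_excess \<tau> * (cmod (window \<tau> \<xi>))\<^sup>2)
      \<le> (\<Sum>\<tau>\<in>tiles_upto J. 2 * (cmod (window \<tau> \<xi>))\<^sup>2)"
    using ex by (intro sum_mono mult_right_mono) auto
  ultimately show ?thesis
    using tiles_upto_sum_le_1[where J = J and \<xi> = \<xi>] by (simp add: sum_distrib_left[symmetric])
qed

lemma excess_near_vertical_axis:
  assumes "\<bar>fst \<xi>\<bar> \<le> 4 ^ J / 16" "\<bar>snd \<xi>\<bar> \<le> 4 ^ J / 16" "fst \<xi> \<noteq> 0" "snd \<xi> \<noteq> 0"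
    and near: "2 * \<bar>fst \<xi>\<bar> < \<bar>snd \<xi>\<bar>"
  shows "excess J \<xi> = 0"
proof -
  have "scaling_hat \<nu> ((1 / 4 ^ J) *\<^sub>R \<xi>) = 1"
    using assms by (intro scaling_hat_near_0) (auto simp: field_simps)
  then have one: "(\<Sum>\<tau>\<in>tiles_upto J. (cmod (window \<tau> \<xi>))\<^sup>2) = 1"
    using tiles_upto_sum[OF assms(3,4), of J] by simp
  have "tile_excess \<tau> * (cmod (window \<tau> \<xi>))\<^sup>2 = (cmod (window \<tau> \<xi>))\<^sup>2" if "\<tau> \<in> tiles_upto J" for \<tau>
  proof (cases \<tau>)
    case (SeamTile j l)
    then have "l \<in> {- (2 ^ j), 2 ^ j}" using that by (auto simp: tiles_upto_def scale_tiles_def)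
    then show ?thesis
      using seam_window_near_vertical_axis[OF _ _ near, of l j] SeamTile by (cases "j = 0") auto
  qed simp_all
  then have "(\<Sum>\<tau>\<in>tiles_upto J. tile_excess \<tau> * (cmod (window \<tau> \<xi>))\<^sup>2)
      = (\<Sum>\<tau>\<in>tiles_upto J. (cmod (window \<tau> \<xi>))\<^sup>2)"
    by (rule sum.cong[OF refl])
  then show ?thesis using one by simp
qed

lemma window_vanishes_at_fine_scales:
  assumes "\<tau> \<in> tiles" "\<tau> \<notin> tiles_upto J" "\<bar>fst \<xi>\<bar> \<le> 4 ^ J / 16" "\<bar>snd \<xi>\<bar> \<le> 4 ^ J / 16"
  shows "window \<tau> \<xi> = 0"
proof -
  have J: "J \<le> tile_scale \<tau>" using in_tiles_upto[OF assms(1), of J] assms(2) by linarith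
  have "(4::real) ^ J \<le> 4 ^ tile_scale \<tau>" using J by (intro power_increasing) auto
  then have "\<bar>fst \<xi>\<bar> \<le> 4 ^ tile_scale \<tau> / 16" "\<bar>snd \<xi>\<bar> \<le> 4 ^ tile_scale \<tau> / 16"
    using assms(3,4) by linarith+
  then have "corona \<nu> ((1 / 4 ^ tile_scale \<tau>) *\<^sub>R \<xi>) = 0"
    by (intro corona_near_0) (auto simp: field_simps)
  moreover have "\<tau> \<noteq> ScalingTile" using assms(2) by (auto simp: tiles_upto_def)
  ultimately show ?thesis
    by (cases "(\<tau>, \<xi>)" rule: window.cases) auto
qed

abbreviation kept :: "(real \<times> real \<Rightarrow> complex) \<Rightarrow> real \<Rightarrow> shearlet_index \<Rightarrow> complex" where
  "kept f \<beta> \<equiv> restrict_seq (threshold_set \<nu> V f \<beta>) (analysis \<nu> V f)"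

text \<open>Only finitely many coefficients survive, so the synthesis is a finite sum; the excess of the frame
  operator is seen only in the cone that contains the seams.\<close>

theorem shearlet_hard_thresholding:
  assumes g: "tame g" and m: "L2 m" and \<epsilon>: "\<epsilon> > 0"
    and f_def: "f = (\<lambda>x. inv_fourier g x - m x)"
  obtains \<beta> L where "\<beta> > 0"
    "is_synthesis \<nu> V (kept f \<beta>) L"
    "L2 (\<lambda>x. L x - inv_fourier g x)"
    "energy (\<lambda>x. L x - inv_fourier g x)
      \<le> \<epsilon> + 4 * energy (\<lambda>\<xi>. of_bool (\<bar>snd \<xi>\<bar> \<le> 2 * \<bar>fst \<xi>\<bar>) * g \<xi>) + 8 * energy m"
proof -
  obtain R where R: "\<And>\<xi>. g \<xi> \<noteq> 0 \<Longrightarrow> norm \<xi> \<le> R" using tameE[OF g] by metis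
  obtain J where "16 * R < 4 ^ J" using real_arch_pow[of 4 "16 * R"] by auto
  then have J: "\<bar>fst \<xi>\<bar> \<le> 4 ^ J / 16" "\<bar>snd \<xi>\<bar> \<le> 4 ^ J / 16" if "g \<xi> \<noteq> 0" for \<xi>
    using R[OF that] norm_fst_le[of "fst \<xi>" "snd \<xi>"] norm_snd_le[of "snd \<xi>" "fst \<xi>"] by auto
  have out: "g \<xi> * cnj (window \<tau> \<xi>) = 0" if "\<tau> \<in> tiles" "\<tau> \<notin> tiles_upto J" for \<tau> \<xi>
    using window_vanishes_at_fine_scales[OF that J] by (cases "g \<xi> = 0") auto
  let ?T = "\<lambda>\<beta>. {\<eta> \<in> shearlet_indices. \<beta> \<le> cmod (L2_inner f (atom \<eta>))}"
  let ?e = "excess J"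
  obtain \<beta> where \<beta>: "\<beta> > 0" "finite (?T \<beta>)"
    and le: "energy (\<lambda>x. (\<Sum>\<eta>\<in>?T \<beta>. L2_inner f (atom \<eta>) * atom \<eta> x) - inv_fourier g x)
      \<le> \<epsilon> + 4 * energy (\<lambda>\<xi>. of_real (?e \<xi>) * g \<xi>) + 8 * energy m"
    by (rule hard_thresholding[OF g finite_tiles_upto tiles_upto_subset out m \<epsilon> f_def])
  define L where "L = (\<lambda>x. \<Sum>\<eta>\<in>?T \<beta>. L2_inner f (atom \<eta>) * atom \<eta> x)"
  have T: "threshold_set \<nu> V f \<beta> = ?T \<beta>"
    by (simp add: threshold_set_def shearlet_eq_atom)
  have LL2: "L2 L" unfolding L_def by (intro L2_sum L2_mult_const atom_L2) auto
  have syn: "is_synthesis \<nu> V (kept f \<beta>) L"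
    unfolding is_synthesis_def has_L2_sum_def
  proof (intro conjI ballI)
    fix \<eta> assume "\<eta> \<in> shearlet_indices"
    then show "L2 (\<lambda>x. kept f \<beta> \<eta> * shearlet \<nu> V \<eta> x)"
      unfolding shearlet_eq_atom by (intro L2_mult_const atom_L2)
  next
    show "((\<lambda>F. L2_norm (\<lambda>x. (\<Sum>\<eta>\<in>F. kept f \<beta> \<eta> * shearlet \<nu> V \<eta> x) - L x))
        \<longlongrightarrow> 0) (finite_subsets_at_top shearlet_indices)"
    proof (rule tendsto_eventually, unfold eventually_finite_subsets_at_top,
        intro exI[of _ "?T \<beta>"] conjI allI impI)
      fix F assume F: "finite F \<and> ?T \<beta> \<subseteq> F \<and> F \<subseteq> shearlet_indices"
      have "(\<Sum>\<eta>\<in>F. kept f \<beta> \<eta> * shearlet \<nu> V \<eta> x) = L x" for x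
        unfolding L_def T shearlet_eq_atom using F
        by (intro sum.mono_neutral_cong_right)
          (auto simp: restrict_seq_def analysis_def shearlet_eq_atom)
      then show "L2_norm (\<lambda>x. (\<Sum>\<eta>\<in>F. kept f \<beta> \<eta> * shearlet \<nu> V \<eta> x) - L x) = 0"
        by (simp add: L2_norm_def)
    qed (use \<beta> in auto)
  qed (rule LL2)
  have "energy (\<lambda>\<xi>. of_real (?e \<xi>) * g \<xi>) \<le> energy (\<lambda>\<xi>. of_bool (\<bar>snd \<xi>\<bar> \<le> 2 * \<bar>fst \<xi>\<bar>) * g \<xi>)"
  proof -
    note [measurable] = window_measurable tame_measurable[OF g]
    have b: "tame (\<lambda>\<xi>. of_bool (\<bar>snd \<xi>\<bar> \<le> 2 * \<bar>fst \<xi>\<bar>) * g \<xi>)"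
      by (rule tame_mult[OF g cone_indicator_measurable, where M = 1]) simp
    have ae: "AE \<xi> in lborel. (cmod (of_real (?e \<xi>) * g \<xi>))\<^sup>2 \<le> (cmod (of_bool (\<bar>snd \<xi>\<bar> \<le> 2 * \<bar>fst \<xi>\<bar>) * g \<xi>))\<^sup>2"
      using AE_off_axes
    proof (rule eventually_mono)
      fix \<xi> :: "real \<times> real" assume nz: "fst \<xi> \<noteq> 0 \<and> snd \<xi> \<noteq> 0"
      show "(cmod (of_real (?e \<xi>) * g \<xi>))\<^sup>2 \<le> (cmod (of_bool (\<bar>snd \<xi>\<bar> \<le> 2 * \<bar>fst \<xi>\<bar>) * g \<xi>))\<^sup>2"
      proof (cases "g \<xi> = 0")
        case False
        note J = J[OF False]
        show ?thesis
        proof (cases "\<bar>snd \<xi>\<bar> \<le> 2 * \<bar>fst \<xi>\<bar>")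
          case True
          have "cmod (of_real (?e \<xi>)) * cmod (g \<xi>) \<le> 1 * cmod (g \<xi>)"
            using abs_excess_le_1 by (intro mult_right_mono) (simp_all only: norm_of_real norm_ge_zero)
          then show ?thesis using True by (intro power_mono) (simp_all add: norm_mult)
        next
          case False
          then have "?e \<xi> = 0" using nz by (intro excess_near_vertical_axis J) auto
          then show ?thesis by simp
        qed
      qed simp
    qed
    have et: "tame (\<lambda>\<xi>. of_real (?e \<xi>) * g \<xi>)"
    proof (rule tame_mult[OF g, where M = 1])
      show "(\<lambda>\<xi>. complex_of_real (?e \<xi>)) \<in> borel_measurable borel" by measurable
      show "cmod (complex_of_real (?e \<xi>)) \<le> 1" for \<xi>
        unfolding norm_of_real by (rule abs_excess_le_1)
    qed
    show ?thesis
      unfolding energy_def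
      using ae tame_L2[OF b] tame_L2[OF et] by (intro integral_mono_AE L2_square_integrable)
  qed
  then have "energy (\<lambda>x. L x - inv_fourier g x)
      \<le> \<epsilon> + 4 * energy (\<lambda>\<xi>. of_bool (\<bar>snd \<xi>\<bar> \<le> 2 * \<bar>fst \<xi>\<bar>) * g \<xi>) + 8 * energy m"
    using le unfolding L_def by linarith
  then show ?thesis
    using that[OF \<beta>(1) syn L2_diff[OF LL2 plancherel(1)[OF g]]] by blast
qed

end

section \<open>The filtered line\<close>

lemma energy_tensor:
  fixes p q :: "real \<Rightarrow> complex"
  assumes "L2 p" "L2 q"
  shows "L2 (\<lambda>z. p (fst z) * q (snd z))" "energy (\<lambda>z. p (fst z) * q (snd z)) = energy p * energy q"
proof -
  note [measurable] = L2_measurable[OF assms(1)] L2_measurable[OF assms(2)]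
  have "(\<integral>\<^sup>+z. ennreal ((cmod (p (fst z) * q (snd z)))\<^sup>2) \<partial>lborel)
      = (\<integral>\<^sup>+z. ennreal ((cmod (p (fst z)))\<^sup>2) * ennreal ((cmod (q (snd z)))\<^sup>2) \<partial>lborel)"
    by (simp add: norm_mult power_mult_distrib ennreal_mult)
  also have "\<dots> = (\<integral>\<^sup>+x. ennreal ((cmod (p x))\<^sup>2) \<partial>lborel) * (\<integral>\<^sup>+y. ennreal ((cmod (q y))\<^sup>2) \<partial>lborel)"
    by (rule nn_integral_tensor) auto
  also have "\<dots> = ennreal (energy p * energy q)"
    by (simp add: nn_integral_eq_energy assms ennreal_mult)
  finally have *: "(\<integral>\<^sup>+z. ennreal ((cmod (p (fst z) * q (snd z)))\<^sup>2) \<partial>lborel) = ennreal (energy p * energy q)" .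
  show "L2 (\<lambda>z. p (fst z) * q (snd z))" "energy (\<lambda>z. p (fst z) * q (snd z)) = energy p * energy q"
    by (rule L2I_nn_integral[OF _ *]; simp)+
qed

lemma energy_pos:
  fixes f :: "'a::euclidean_space \<Rightarrow> complex"
  assumes "L2 f" "open S" "S \<noteq> {}" "\<And>x. x \<in> S \<Longrightarrow> f x \<noteq> 0"
  shows "energy f > 0"
proof (rule ccontr)
  assume "\<not> energy f > 0"
  then have "energy f = 0" using energy_nonneg[of f] by linarith
  then have "AE x in lborel. (cmod (f x))\<^sup>2 = 0"
    using L2_square_integrable[OF assms(1)]
    unfolding energy_def by (subst (asm) integral_nonneg_eq_0_iff_AE) auto
  then have "AE x in lborel. x \<notin> S"
    by (rule eventually_mono) (use assms(4) in auto)
  then have "AE x in lebesgue. x \<notin> S"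
    by (rule AE_completion)
  then have "negligible S"
    using assms(2) AE_iff_null_sets[of S lebesgue] by (simp add: negligible_iff_null_sets)
  then show False using open_not_negligible[OF assms(2,3)] by simp
qed

lemma norm_inv_fourier_le:
  assumes "g \<in> borel_measurable borel"
  shows "cmod (inv_fourier g x) \<le> (LINT \<xi>|lborel. cmod (g \<xi>))"
proof -
  have "cmod (inv_fourier g x) \<le> (LINT \<xi>|lborel. cmod (g \<xi> * cis (2 * pi * (x \<bullet> \<xi>))))"
    unfolding inv_fourier_def by (rule integral_norm_bound)
  then show ?thesis by (simp add: norm_mult)
qed

lemma energy_reflect:
  fixes f :: "real \<Rightarrow> complex"
  shows "energy (\<lambda>x. f (- x)) = energy f"
  unfolding energy_def
  using lborel_integral_real_affine[of "-1" "\<lambda>x. (cmod (f x))\<^sup>2" 0] by simp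

lemma L2_reflect:
  fixes f :: "real \<Rightarrow> complex"
  shows "L2 f \<Longrightarrow> L2 (\<lambda>x. f (- x))"
  unfolding L2_def
  using lborel_integrable_real_affine[of "\<lambda>x. (cmod (f x))\<^sup>2" "-1" 0] by (auto intro: measurable_compose)

lemma energy_dilate:
  fixes f :: "real \<Rightarrow> complex"
  assumes "c > 0"
  shows "energy (\<lambda>x. f (x / c)) = c * energy f"
  unfolding energy_def
  using lborel_integral_real_affine[of c "\<lambda>x. (cmod (f (x / c)))\<^sup>2" 0] assms by simp

text \<open>Moving the transform to the other factor of the inner product.\<close>

lemma inner_inv_fourier:
  fixes p q :: "real \<Rightarrow> complex"
  assumes p: "tame p" and q: "tame q"
  shows "L2_inner (inv_fourier p) q = (LINT \<xi>|lborel. p \<xi> * cnj (inv_fourier q (- \<xi>)))"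
proof -
  let ?F = "\<lambda>x \<xi>. cnj (q x) * (p \<xi> * cis (2 * pi * (x * \<xi>)))"
  note [measurable] = tame_measurable[OF p] tame_measurable[OF q]
  have "tame (\<lambda>z. (cnj (q (fst z)) * p (snd z)) * cis (2 * pi * (fst z * snd z)))"
    using tame_tensor[OF tame_cnj[OF q] p] by (rule tame_mult_right[where M = 1]) auto
  from tame_integrable[OF this] have "integrable (lborel \<Otimes>\<^sub>M lborel) (case_prod ?F)"
    by (simp add: lborel_prod case_prod_beta' mult.assoc)
  then have "(LINT x|lborel. LINT \<xi>|lborel. ?F x \<xi>) = (LINT \<xi>|lborel. LINT x|lborel. ?F x \<xi>)"
    by (rule lborel_pair.Fubini_integral[symmetric])
  moreover have "(LINT x|lborel. LINT \<xi>|lborel. ?F x \<xi>) = L2_inner (inv_fourier p) q"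
    unfolding L2_inner_def by (simp add: inv_fourier_def mult.commute)
  moreover have "(LINT x|lborel. ?F x \<xi>) = p \<xi> * cnj (inv_fourier q (- \<xi>))" for \<xi>
  proof -
    have "(LINT x|lborel. ?F x \<xi>) = p \<xi> * (LINT x|lborel. cnj (q x * cis (2 * pi * ((- \<xi>) \<bullet> x))))"
      by (subst integral_mult_right_zero[symmetric])
        (simp add: cis_cnj ac_simps)
    also have "(LINT x|lborel. cnj (q x * cis (2 * pi * ((- \<xi>) \<bullet> x)))) = cnj (inv_fourier q (- \<xi>))"
      unfolding inv_fourier_def by (rule Bochner_Integration.integral_cnj)
    finally show ?thesis .
  qed
  ultimately show ?thesis by simp
qed

locale line_model = shearlet_data +
  fixes \<rho> :: real and w :: "real \<Rightarrow> real"
  assumes w_smooth: "smooth w"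
    and w_range: "\<And>x. w x \<in> {0..1}"
    and w_supp: "supp w \<subseteq> {-\<rho>..\<rho>}"
    and w_nonzero: "\<exists>x. w x \<noteq> 0"
begin

definition wc :: "real \<Rightarrow> complex" where
  "wc x = of_real (w x)"

definition what :: "real \<Rightarrow> complex" where
  "what \<xi> = inv_fourier wc (- \<xi>)"

lemma w_outside: "x \<notin> {-\<rho>..\<rho>} \<Longrightarrow> w x = 0"
  using w_supp closure_subset[of "{x. w x \<noteq> 0}"] by (auto simp: supp_def)

lemma w_measurable [measurable]: "w \<in> borel_measurable borel"
  by (intro borel_measurable_continuous_onI smooth_imp_continuous w_smooth)

lemma norm_wc_le_1: "cmod (wc x) \<le> 1"
  using w_range[of x] by (simp add: wc_def)

lemma wc_tame: "tame wc"
proof (rule tameI[OF _ norm_wc_le_1, where R = "\<bar>\<rho>\<bar>"])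
  show "wc \<in> borel_measurable borel" unfolding wc_def[abs_def] by measurable
  show "norm x \<le> \<bar>\<rho>\<bar>" if "wc x \<noteq> 0" for x
  proof -
    have "x \<in> {-\<rho>..\<rho>}" using w_outside[of x] that by (cases "x \<in> {-\<rho>..\<rho>}") (auto simp: wc_def)
    then show ?thesis by auto
  qed
qed

lemma what_measurable [measurable]: "what \<in> borel_measurable borel"
proof -
  note [measurable] = inv_fourier_measurable[OF tame_measurable[OF wc_tame]]
  show ?thesis unfolding what_def[abs_def] by measurable
qed

lemma norm_what_le: "cmod (what \<xi>) \<le> (LINT x|lborel. cmod (wc x))"
  unfolding what_def by (rule norm_inv_fourier_le[OF tame_measurable[OF wc_tame]])

lemma what_L2: "L2 what"
  unfolding what_def[abs_def] by (intro L2_reflect plancherel_real wc_tame)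

lemma energy_what: "energy what = energy wc"
  unfolding what_def[abs_def] energy_reflect by (rule plancherel_real[OF wc_tame])

lemma energy_wc_pos: "energy wc > 0"
proof (rule energy_pos[of _ "w -` (- {0})"])
  show "open (w -` (- {0}))"
    using smooth_imp_continuous[OF w_smooth] by (intro open_vimage) auto
qed (use w_nonzero in \<open>auto simp: wc_def tame_L2 wc_tame\<close>)

subsection \<open>The band filter\<close>

lemma meyer_W_measurable [measurable]: "meyer_W \<nu> \<in> borel_measurable borel"
  unfolding meyer_W_def[abs_def] by measurable

lemma norm_meyer_W_le_1: "cmod (meyer_W \<nu> x) \<le> 1"
  by (simp add: meyer_W_def norm_mult)

lemma meyer_W_support: "meyer_W \<nu> x \<noteq> 0 \<Longrightarrow> 1/16 \<le> \<bar>x\<bar> \<and> \<bar>x\<bar> \<le> 1/4"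
  by (auto simp: meyer_W_def split: if_splits)

lemma meyer_W2_eq:
  "meyer_W2 \<nu> MV \<zeta> = of_real (meyer_phi_hat \<nu> (fst \<zeta>)) * meyer_W \<nu> (snd \<zeta>)"
  "meyer_W2 \<nu> MH \<zeta> = meyer_W \<nu> (fst \<zeta>) * of_real (meyer_phi_hat \<nu> (snd \<zeta>))"
  "meyer_W2 \<nu> MD \<zeta> = meyer_W \<nu> (fst \<zeta>) * meyer_W \<nu> (snd \<zeta>)"
  by (cases \<zeta>; simp)+

lemma norm_meyer_W2_le_1: "cmod (meyer_W2 \<nu> \<iota> \<zeta>) \<le> 1"
  using mult_mono[OF abs_phi_hat_le_1[of "fst \<zeta>"] norm_meyer_W_le_1[of "snd \<zeta>"]]
    mult_mono[OF norm_meyer_W_le_1[of "fst \<zeta>"] abs_phi_hat_le_1[of "snd \<zeta>"]]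
    mult_mono[OF norm_meyer_W_le_1[of "fst \<zeta>"] norm_meyer_W_le_1[of "snd \<zeta>"]]
  by (cases \<iota>) (simp_all add: meyer_W2_eq norm_mult)

lemma meyer_W2_support:
  assumes "meyer_W2 \<nu> \<iota> \<zeta> \<noteq> 0"
  shows "\<bar>fst \<zeta>\<bar> \<le> 1/4 \<and> \<bar>snd \<zeta>\<bar> \<le> 1/4 \<and> (1/16 \<le> \<bar>fst \<zeta>\<bar> \<or> 1/16 \<le> \<bar>snd \<zeta>\<bar>)"
  using assms meyer_W_support[of "fst \<zeta>"] meyer_W_support[of "snd \<zeta>"]
    phi_hat_support[of "fst \<zeta>"] phi_hat_support[of "snd \<zeta>"]
  by (cases \<iota>) (auto simp: meyer_W2_eq)

lemma two_powr_band: "2 powr (- 2 * real j - 1) = 1 / (2 * 4 ^ j)"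
proof -
  have "2 powr (- 2 * real j - 1) = 2 powr (- 2 * real j) * 2 powr (- 1)"
    unfolding powr_add[symmetric] by (rule arg_cong[where f = "(powr) 2"]) simp
  then show ?thesis unfolding two_powr_minus_double by (simp add: powr_minus_divide)
qed

lemma band_filter_eq:
  "band_filter \<nu> j \<xi> =
    (meyer_W2 \<nu> MH ((1 / 4 ^ j) *\<^sub>R \<xi>) + meyer_W2 \<nu> MH ((1 / (2 * 4 ^ j)) *\<^sub>R \<xi>))
    + ((meyer_W2 \<nu> MV ((1 / 4 ^ j) *\<^sub>R \<xi>) + meyer_W2 \<nu> MV ((1 / (2 * 4 ^ j)) *\<^sub>R \<xi>))
    + (meyer_W2 \<nu> MD ((1 / 4 ^ j) *\<^sub>R \<xi>) + meyer_W2 \<nu> MD ((1 / (2 * 4 ^ j)) *\<^sub>R \<xi>)))"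
  unfolding band_filter_def two_powr_minus_double two_powr_band by simp

lemma band_filter_measurable [measurable]: "band_filter \<nu> j \<in> borel_measurable borel"
  unfolding band_filter_eq[abs_def] meyer_W2_eq by measurable

lemma norm_band_filter_le: "cmod (band_filter \<nu> j \<xi>) \<le> 6"
proof -
  have "cmod (a + b) \<le> 2" if "cmod a \<le> 1" "cmod b \<le> 1" for a b :: complex
    using norm_triangle_ineq[of a b] that by linarith
  note two = this[OF norm_meyer_W2_le_1 norm_meyer_W2_le_1]
  show ?thesis
    unfolding band_filter_eq
    by (intro order_trans[OF norm_triangle_ineq] order_trans[OF add_mono[OF two order_trans[OF norm_triangle_ineq add_mono[OF two two]]]])
      simp
qed

lemma band_filter_support:
  assumes "band_filter \<nu> j \<xi> \<noteq> 0"
  shows "\<bar>fst \<xi>\<bar> \<le> 4 ^ j / 2" "\<bar>snd \<xi>\<bar> \<le> 4 ^ j / 2"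
    "4 ^ j / 16 \<le> \<bar>fst \<xi>\<bar> \<or> 4 ^ j / 16 \<le> \<bar>snd \<xi>\<bar>"
proof -
  obtain \<iota> where "meyer_W2 \<nu> \<iota> ((1 / 4 ^ j) *\<^sub>R \<xi>) \<noteq> 0 \<or> meyer_W2 \<nu> \<iota> ((1 / (2 * 4 ^ j)) *\<^sub>R \<xi>) \<noteq> 0"
    using assms unfolding band_filter_eq by force
  then have "\<exists>c\<in>{4 ^ j, 2 * 4 ^ j}. \<bar>fst \<xi>\<bar> \<le> c / 4 \<and> \<bar>snd \<xi>\<bar> \<le> c / 4 \<and> (c / 16 \<le> \<bar>fst \<xi>\<bar> \<or> c / 16 \<le> \<bar>snd \<xi>\<bar>)"
  proof
    assume "meyer_W2 \<nu> \<iota> ((1 / 4 ^ j) *\<^sub>R \<xi>) \<noteq> 0"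
    from meyer_W2_support[OF this] show ?thesis
      by (intro bexI[of _ "4 ^ j"]) (auto simp: field_simps)
  next
    assume "meyer_W2 \<nu> \<iota> ((1 / (2 * 4 ^ j)) *\<^sub>R \<xi>) \<noteq> 0"
    from meyer_W2_support[OF this] show ?thesis
      by (intro bexI[of _ "2 * 4 ^ j"]) (auto simp: field_simps)
  qed
  then show "\<bar>fst \<xi>\<bar> \<le> 4 ^ j / 2" "\<bar>snd \<xi>\<bar> \<le> 4 ^ j / 2"
    "4 ^ j / 16 \<le> \<bar>fst \<xi>\<bar> \<or> 4 ^ j / 16 \<le> \<bar>snd \<xi>\<bar>"
    by (auto simp: field_simps)
qed

text \<open>The band filter at scale zero, restricted to the vertical axis.\<close>

definition profile :: "real \<Rightarrow> complex" where
  "profile t = meyer_W \<nu> t + meyer_W \<nu> (t / 2)"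

lemma profile_tame: "tame profile"
proof (rule tameI[where M = 2 and R = 1])
  show "profile \<in> borel_measurable borel" unfolding profile_def[abs_def] by measurable
  show "cmod (profile t) \<le> 2" for t
    using norm_triangle_ineq[of "meyer_W \<nu> t" "meyer_W \<nu> (t / 2)"]
      norm_meyer_W_le_1[of t] norm_meyer_W_le_1[of "t / 2"] by (simp add: profile_def)
  show "norm t \<le> 1" if "profile t \<noteq> 0" for t
  proof -
    have "meyer_W \<nu> t \<noteq> 0 \<or> meyer_W \<nu> (t / 2) \<noteq> 0" using that by (auto simp: profile_def)
    then show ?thesis using meyer_W_support[of t] meyer_W_support[of "t / 2"] by auto
  qed
qed

lemma energy_profile_pos: "energy profile > 0"
proof -
  define s where "s = (\<lambda>t. sin (pi / 2 * \<nu> (16 * t - 1)))"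
  have cs: "continuous_on UNIV s"
    unfolding s_def
    by (intro continuous_intros continuous_on_compose2[OF smooth_imp_continuous[OF nu_smooth]]) auto
  define S where "S = {1/16<..<1/8} \<inter> s -` (- {0})"
  have o: "open (s -` (- {0}))" using cs by (intro open_vimage) auto
  have "1/8 \<in> s -` (- {0})" using nu_1[of 1] by (simp add: s_def)
  then obtain e where e: "e > 0" "ball (1/8) e \<subseteq> s -` (- {0})"
    using o open_contains_ball by blast
  \<comment> \<open>Just below \<open>1/8\<close> the second summand of the profile vanishes and the sine is close to one.\<close>
  define t where "t = max (1/8 - e / 2) (3/32)"
  have "t \<in> S" using e by (auto simp: S_def t_def dist_real_def subset_eq max_def split: if_splits)
  then have "S \<noteq> {}" by auto
  moreover have "open S" unfolding S_def using o by auto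
  moreover have "profile t \<noteq> 0" if "t \<in> S" for t
  proof -
    have "meyer_W \<nu> (t / 2) = 0" using meyer_W_support[of "t / 2"] that by (auto simp: S_def)
    moreover have "meyer_W \<nu> t = cis (- (16 * pi * t / 3)) * of_real (s t)"
      using that by (simp add: meyer_W_def s_def S_def)
    moreover have "s t \<noteq> 0" using that by (simp add: S_def)
    ultimately show ?thesis by (simp add: profile_def)
  qed
  ultimately show ?thesis by (intro energy_pos[OF tame_L2[OF profile_tame]])
qed

lemma band_filter_near_vertical_axis:
  assumes "\<bar>fst \<xi>\<bar> < 4 ^ j / 32"
  shows "band_filter \<nu> j \<xi> = profile (snd \<xi> / 4 ^ j)"
proof -
  have *: "meyer_phi_hat \<nu> (fst \<xi> / 4 ^ j) = 1" "meyer_phi_hat \<nu> (fst \<xi> / (2 * 4 ^ j)) = 1"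
    using assms by (auto intro!: phi_hat_near_0 simp: field_simps)
  have "\<bar>fst \<xi> / 4 ^ j\<bar> < 1/16" "\<bar>fst \<xi> / (2 * 4 ^ j)\<bar> < 1/16"
    using assms by (auto simp: field_simps)
  then have "meyer_W \<nu> (fst \<xi> / 4 ^ j) = 0" "meyer_W \<nu> (fst \<xi> / (2 * 4 ^ j)) = 0"
    using meyer_W_support[of "fst \<xi> / 4 ^ j"] meyer_W_support[of "fst \<xi> / (2 * 4 ^ j)"]
    by fastforce+
  then show ?thesis
    unfolding band_filter_eq meyer_W2_eq using * by (simp add: profile_def mult.commute)
qed

subsection \<open>The filtered line on the frequency side\<close>

definition line_hat :: "nat \<Rightarrow> real \<times> real \<Rightarrow> complex" where
  "line_hat j \<xi> = what (fst \<xi>) * band_filter \<nu> j \<xi>"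

lemma band_filter_tame: "tame (band_filter \<nu> j)"
proof (rule tameI[OF band_filter_measurable norm_band_filter_le, where R = "4 ^ j"])
  show "norm \<xi> \<le> 4 ^ j" if "band_filter \<nu> j \<xi> \<noteq> 0" for \<xi>
    using band_filter_support(1,2)[OF that] norm_Pair_le[of "fst \<xi>" "snd \<xi>"] by simp
qed

lemma line_hat_tame: "tame (line_hat j)"
  unfolding line_hat_def[abs_def]
  by (rule tame_mult[OF band_filter_tame _ norm_what_le]) measurable

lemma filtered_line_eq: "filtered_line \<nu> \<rho> w j x = inv_fourier (line_hat j) x"
proof -
  let ?F = "\<lambda>y \<xi>. wc y * (band_filter \<nu> j \<xi> * cis (2 * pi * ((x - (y, 0)) \<bullet> \<xi>)))"
  note [measurable] = tame_measurable[OF wc_tame]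
  have "(\<lambda>z::real \<times> real \<times> real. 2 * pi * ((x - (fst z, 0)) \<bullet> snd z)) \<in> borel_measurable borel"
    by (intro borel_measurable_continuous_onI continuous_intros)
  then have [measurable]: "(\<lambda>z::real \<times> real \<times> real. cis (2 * pi * ((x - (fst z, 0)) \<bullet> snd z))) \<in> borel_measurable borel"
    by measurable
  have "tame (\<lambda>z. (wc (fst z) * band_filter \<nu> j (snd z)) * cis (2 * pi * ((x - (fst z, 0)) \<bullet> snd z)))"
    using tame_tensor[OF wc_tame band_filter_tame] by (rule tame_mult_right[where M = 1]) auto
  from tame_integrable[OF this] have int: "integrable (lborel \<Otimes>\<^sub>M lborel) (case_prod ?F)"
    by (simp add: lborel_prod case_prod_beta' mult.assoc)
  have "filtered_line \<nu> \<rho> w j x = (LINT y|lborel. LINT \<xi>|lborel. ?F y \<xi>)"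
    unfolding filtered_line_def line_dist_def set_lebesgue_integral_def
  proof (rule Bochner_Integration.integral_cong[OF refl])
    fix y
    show "indicat_real {-\<rho>..\<rho>} y *\<^sub>R (of_real (w y) * inv_fourier (band_filter \<nu> j) (x - (y, 0)))
        = (LINT \<xi>|lborel. ?F y \<xi>)"
      using w_outside[of y] by (simp add: inv_fourier_def wc_def indicator_def)
  qed
  also have "\<dots> = (LINT \<xi>|lborel. LINT y|lborel. ?F y \<xi>)"
    using lborel_pair.Fubini_integral[OF int] by simp
  also have "\<dots> = inv_fourier (line_hat j) x"
    unfolding inv_fourier_def[of "line_hat j"]
  proof (rule Bochner_Integration.integral_cong[OF refl])
    fix \<xi>
    have "(LINT y|lborel. ?F y \<xi>)
        = (LINT y|lborel. (band_filter \<nu> j \<xi> * cis (2 * pi * (x \<bullet> \<xi>))) * (wc y * cis (2 * pi * ((- fst \<xi>) \<bullet> y))))"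
      by (intro Bochner_Integration.integral_cong refl)
        (simp add: inner_prod_def cis_mult algebra_simps)
    also have "\<dots> = line_hat j \<xi> * cis (2 * pi * (x \<bullet> \<xi>))"
      by (simp add: line_hat_def what_def inv_fourier_def)
    finally show "(LINT y|lborel. ?F y \<xi>) = line_hat j \<xi> * cis (2 * pi * (x \<bullet> \<xi>))" .
  qed
  finally show ?thesis .
qed

text \<open>Below \<open>4 ^ j / 32\<close> in the first variable the spectrum is a tensor product; \<open>low j\<close> is the
  part of the spectrum of \<open>w\<close> that enters there, and \<open>tail j\<close> is the energy of the rest.\<close>

definition low :: "nat \<Rightarrow> real \<Rightarrow> complex" where
  "low j t = (if \<bar>t\<bar> < 4 ^ j / 32 then what t else 0)"

definition high :: "nat \<Rightarrow> real \<Rightarrow> complex" where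
  "high j t = (if \<bar>t\<bar> < 4 ^ j / 32 then 0 else what t)"

definition tail :: "nat \<Rightarrow> real" where
  "tail j = energy (high j)"

lemma low_tame: "tame (low j)"
proof (rule tameI[where M = "LINT x|lborel. cmod (wc x)" and R = "4 ^ j / 32"])
  show "low j \<in> borel_measurable borel" unfolding low_def[abs_def] by measurable
  show "cmod (low j t) \<le> (LINT x|lborel. cmod (wc x))" for t
    using norm_what_le[of t] by (auto simp: low_def)
  show "norm t \<le> 4 ^ j / 32" if "low j t \<noteq> 0" for t
    using that by (auto simp: low_def split: if_splits)
qed

lemma high_L2: "L2 (high j)"
proof (rule L2_dominated[OF what_L2, of _ 1])
  show "high j \<in> borel_measurable borel" unfolding high_def[abs_def] by measurable
qed (simp add: high_def)

lemma energy_low: "energy (low j) = energy wc - tail j"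
proof -
  have "energy what = (LINT t|lborel. (cmod (low j t))\<^sup>2 + (cmod (high j t))\<^sup>2)"
    unfolding energy_def by (intro Bochner_Integration.integral_cong refl) (simp add: low_def high_def)
  also have "\<dots> = energy (low j) + tail j"
    unfolding energy_def tail_def
    by (intro Bochner_Integration.integral_add L2_square_integrable tame_L2 low_tame high_L2)
  finally show ?thesis by (simp add: energy_what)
qed

lemma tail_tendsto_0: "tail \<longlonglongrightarrow> 0"
proof -
  have "(\<lambda>j. energy (high j)) \<longlonglongrightarrow> (LINT t|(lborel :: real measure). 0)"
    unfolding energy_def
  proof (rule integral_dominated_convergence[where w = "\<lambda>t. (cmod (what t))\<^sup>2"])
    have "(\<lambda>j. (cmod (high j t))\<^sup>2) \<longlonglongrightarrow> 0" for t
    proof (rule tendsto_eventually)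
      obtain n where n: "32 * \<bar>t\<bar> < 4 ^ n" using real_arch_pow[of 4 "32 * \<bar>t\<bar>"] by auto
      show "eventually (\<lambda>j. (cmod (high j t))\<^sup>2 = 0) sequentially"
      proof (rule eventually_sequentiallyI[of n])
        fix j assume "n \<le> j"
        then have "(4::real) ^ n \<le> 4 ^ j" by (intro power_increasing) auto
        then have "\<bar>t\<bar> < 4 ^ j / 32" using n by linarith
        then show "(cmod (high j t))\<^sup>2 = 0" by (simp add: high_def)
      qed
    qed
    then show "AE t in lborel. (\<lambda>j. (cmod (high j t))\<^sup>2) \<longlonglongrightarrow> 0" by simp
    show "(\<lambda>t. (cmod (high j t))\<^sup>2) \<in> borel_measurable lborel" for j
      using L2_measurable[OF high_L2] by measurable
  qed (auto simp: L2_square_integrable[OF what_L2] high_def)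
  then show ?thesis by (simp add: tail_def[abs_def])
qed

definition main_hat :: "nat \<Rightarrow> real \<times> real \<Rightarrow> complex" where
  "main_hat j \<xi> = low j (fst \<xi>) * profile (snd \<xi> / 4 ^ j)"

definition rest_hat :: "nat \<Rightarrow> real \<times> real \<Rightarrow> complex" where
  "rest_hat j \<xi> = high j (fst \<xi>) * band_filter \<nu> j \<xi>"

lemma line_hat_split: "line_hat j \<xi> = main_hat j \<xi> + rest_hat j \<xi>"
  using band_filter_near_vertical_axis[of \<xi> j]
  by (auto simp: line_hat_def main_hat_def rest_hat_def low_def high_def)

lemma profile_dilate_tame: "tame (\<lambda>t. profile (t / 4 ^ j))"
proof -
  obtain M R where M: "\<And>t. cmod (profile t) \<le> M" "\<And>t. profile t \<noteq> 0 \<Longrightarrow> norm t \<le> R"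
    using tameE[OF profile_tame] by metis
  note [measurable] = tame_measurable[OF profile_tame]
  show ?thesis
  proof (rule tameI[where M = M and R = "4 ^ j * R"])
    show "norm t \<le> 4 ^ j * R" if "profile (t / 4 ^ j) \<noteq> 0" for t
      using M(2)[OF that] by (simp add: field_simps)
  qed (use M in auto)
qed

lemma main_hat_tame: "tame (main_hat j)"
  unfolding main_hat_def[abs_def] by (rule tame_tensor[OF low_tame profile_dilate_tame])

lemma rest_hat_tame: "tame (rest_hat j)"
  using tame_diff[OF line_hat_tame main_hat_tame, of j j] by (simp add: line_hat_split)

lemma energy_profile_dilate: "energy (\<lambda>t. profile (t / 4 ^ j)) = 4 ^ j * energy profile"
  by (rule energy_dilate) simp

lemma energy_main_hat: "energy (main_hat j) = (energy wc - tail j) * (4 ^ j * energy profile)"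
  unfolding main_hat_def[abs_def]
  using energy_tensor(2)[OF tame_L2[OF low_tame] tame_L2[OF profile_dilate_tame]]
  by (simp add: energy_low energy_profile_dilate)

lemma energy_rest_hat_le: "energy (rest_hat j) \<le> 36 * 4 ^ j * tail j"
proof -
  define b :: "real \<Rightarrow> complex" where "b = (\<lambda>t. 6 * indicator {- (4 ^ j / 2)..4 ^ j / 2} t)"
  have b: "tame b"
    by (rule tameI[where M = 6 and R = "4 ^ j / 2"]) (auto simp: b_def indicator_def abs_le_iff)
  have "energy b = (LINT t|lborel. 36 * indicator {- (4 ^ j / 2)..4 ^ j / 2 :: real} t)"
    unfolding energy_def b_def
    by (intro Bochner_Integration.integral_cong refl) (simp add: indicator_def)
  also have "\<dots> = 36 * 4 ^ j" by simp
  finally have eb: "energy b = 36 * 4 ^ j" .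
  have "energy (rest_hat j) \<le> energy (\<lambda>\<xi>. high j (fst \<xi>) * b (snd \<xi>))"
  proof (rule energy_mono[OF energy_tensor(1)[OF high_L2 tame_L2[OF b]] tame_measurable[OF rest_hat_tame]])
    fix \<xi> :: "real \<times> real"
    have "cmod (band_filter \<nu> j \<xi>) \<le> cmod (b (snd \<xi>))"
      using norm_band_filter_le[of j \<xi>] band_filter_support(2)[of j \<xi>]
      by (cases "band_filter \<nu> j \<xi> = 0") (auto simp: b_def indicator_def abs_le_iff)
    then show "cmod (rest_hat j \<xi>) \<le> cmod (high j (fst \<xi>) * b (snd \<xi>))"
      unfolding rest_hat_def norm_mult by (intro mult_left_mono) auto
  qed
  also have "\<dots> = tail j * (36 * 4 ^ j)"
    using energy_tensor(2)[OF high_L2 tame_L2[OF b]] by (simp add: tail_def eb)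
  finally show ?thesis by (simp add: mult.commute)
qed

lemma energy_line_ge: "(energy wc - tail j) * (4 ^ j * energy profile) \<le> energy (line_hat j)"
  unfolding energy_main_hat[symmetric]
proof (rule energy_mono[OF tame_L2[OF line_hat_tame] tame_measurable[OF main_hat_tame]])
  show "cmod (main_hat j \<xi>) \<le> cmod (line_hat j \<xi>)" for \<xi>
    using line_hat_split[of j \<xi>] by (auto simp: main_hat_def rest_hat_def low_def high_def)
qed

text \<open>The band filter keeps \<open>line_hat j\<close> away from the origin, so in the cone that contains the seams
  the first variable is large.\<close>

lemma energy_line_on_seam_cone:
  "energy (\<lambda>\<xi>. of_bool (\<bar>snd \<xi>\<bar> \<le> 2 * \<bar>fst \<xi>\<bar>) * line_hat j \<xi>) \<le> 36 * 4 ^ j * tail j"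
proof -
  note [measurable] = tame_measurable[OF line_hat_tame]
  have "energy (\<lambda>\<xi>. of_bool (\<bar>snd \<xi>\<bar> \<le> 2 * \<bar>fst \<xi>\<bar>) * line_hat j \<xi>) \<le> energy (rest_hat j)"
  proof (rule energy_mono[OF tame_L2[OF rest_hat_tame]])
    fix \<xi> :: "real \<times> real"
    show "cmod (of_bool (\<bar>snd \<xi>\<bar> \<le> 2 * \<bar>fst \<xi>\<bar>) * line_hat j \<xi>) \<le> cmod (rest_hat j \<xi>)"
    proof (cases "\<bar>snd \<xi>\<bar> \<le> 2 * \<bar>fst \<xi>\<bar> \<and> band_filter \<nu> j \<xi> \<noteq> 0")
      case True
      then have "\<not> \<bar>fst \<xi>\<bar> < 4 ^ j / 32" using band_filter_support(3)[of j \<xi>] by auto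
      then show ?thesis by (simp add: line_hat_def rest_hat_def high_def)
    qed (auto simp: line_hat_def)
  qed measurable
  then show ?thesis using energy_rest_hat_le[of j] by linarith
qed

subsection \<open>The masked part\<close>

text \<open>In place of Fourier inversion: as \<open>what\<close> is the transform of \<open>wc\<close>, moving \<open>inv_fourier\<close> across the
  inner product of \<open>inv_fourier (low j)\<close> and \<open>wc\<close> shows that this product equals \<open>energy (low j)\<close>.
  Expanding the square leaves the energy that \<open>low j\<close> misses.\<close>

lemma energy_low_recovers_w: "energy (\<lambda>x. inv_fourier (low j) x - wc x) = tail j"
proof -
  have "L2_inner (inv_fourier (low j)) wc = (LINT t|lborel. low j t * cnj (what t))"
    using inner_inv_fourier[OF low_tame wc_tame] by (simp add: what_def)
  also have "\<dots> = L2_inner (low j) (low j)"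
    unfolding L2_inner_def by (intro Bochner_Integration.integral_cong refl) (simp add: low_def)
  also have "\<dots> = of_real (energy (low j))" by (rule L2_inner_self)
  finally have "Re (L2_inner (inv_fourier (low j)) wc) = energy (low j)" by simp
  then show ?thesis
    using energy_diff[OF plancherel_real(1)[OF low_tame] tame_L2[OF wc_tame], of j]
    by (simp add: plancherel_real(2)[OF low_tame] energy_low)
qed

lemma mask_sets [measurable]: "mask h \<in> sets borel"
proof -
  have "closed {x :: real \<times> real. \<bar>fst x\<bar> \<le> h}"
    by (intro closed_Collect_le continuous_intros)
  then show ?thesis unfolding mask_def by (rule borel_closed)
qed

lemma masked_L2:
  assumes "L2 f" shows "L2 (\<lambda>x. indicator (mask h) x * f x)"
proof (rule L2_dominated[OF assms, of _ 1])
  show "(\<lambda>x. indicator (mask h) x * f x) \<in> borel_measurable borel"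
    using L2_measurable[OF assms] by measurable
qed (simp add: indicator_def)

text \<open>The mask depends on the first variable only, and the main part of the filtered line is a tensor
  product. Its first factor is close to \<open>w\<close>, which is at most one on an interval of length \<open>2 * h\<close>;
  its second factor carries the energy of order \<open>4 ^ j\<close>, the order of the energy of the whole line.\<close>

lemma energy_masked_line_le:
  assumes "h \<ge> 0"
  shows "energy (\<lambda>x. indicator (mask h) x * inv_fourier (line_hat j) x)
    \<le> 4 ^ j * (energy profile * (8 * h + 4 * tail j) + 72 * tail j)"
proof -
  let ?I = "indicator {-h..h} :: real \<Rightarrow> complex"
  let ?P = "inv_fourier (\<lambda>t. profile (t / 4 ^ j))"
  define q where "q = (\<lambda>x. ?I x * inv_fourier (low j) x)"
  have low: "L2 (inv_fourier (low j))" by (rule plancherel_real[OF low_tame])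
  note [measurable] = L2_measurable[OF low] tame_measurable[OF wc_tame]
  have cut: "L2 (\<lambda>x. ?I x * f x)" "energy (\<lambda>x. ?I x * f x) \<le> energy f" if "L2 f" for f
  proof -
    note [measurable] = L2_measurable[OF that]
    show "L2 (\<lambda>x. ?I x * f x)" by (rule L2_dominated[OF that, of _ 1]) (auto simp: indicator_def)
    show "energy (\<lambda>x. ?I x * f x) \<le> energy f" by (rule energy_mono[OF that]) (auto simp: indicator_def)
  qed
  have d: "L2 (\<lambda>x. inv_fourier (low j) x - wc x)" by (intro L2_diff low tame_L2 wc_tame)
  have "energy (\<lambda>x. ?I x * wc x) \<le> (LINT x|lborel. indicator {-h..h} x)"
    unfolding energy_def
  proof (rule integral_mono)
    show "(cmod (?I x * wc x))\<^sup>2 \<le> indicator {-h..h} x" for x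
      using norm_wc_le_1[of x] by (auto simp: indicator_def abs_square_le_1)
    show "integrable lborel (\<lambda>x. (cmod (?I x * wc x))\<^sup>2)"
      by (rule L2_square_integrable[OF cut(1)[OF tame_L2[OF wc_tame]]])
    show "integrable lborel (indicator {-h..h} :: real \<Rightarrow> real)"
      by (intro integrable_real_indicator) (auto simp: emeasure_lborel_Icc_eq)
  qed
  also have "\<dots> = 2 * h" using assms by simp
  finally have ew: "energy (\<lambda>x. ?I x * wc x) \<le> 2 * h" .
  have "q = (\<lambda>x. ?I x * wc x + ?I x * (inv_fourier (low j) x - wc x))"
    by (simp add: q_def algebra_simps)
  then have "energy q \<le> 2 * energy (\<lambda>x. ?I x * wc x) + 2 * energy (\<lambda>x. ?I x * (inv_fourier (low j) x - wc x))"
    by (simp only:) (intro energy_add_le cut d tame_L2 wc_tame)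
  also have "\<dots> \<le> 2 * (2 * h) + 2 * tail j"
    using ew cut(2)[OF d] energy_low_recovers_w[of j] by linarith
  finally have eq: "energy q \<le> 4 * h + 2 * tail j" by simp
  have qL2: "L2 q" unfolding q_def by (rule cut(1)[OF low])
  have P: "L2 ?P" "energy ?P = 4 ^ j * energy profile"
    using plancherel_real[OF profile_dilate_tame] by (simp_all add: energy_profile_dilate)
  define A where "A = (\<lambda>x. q (fst x) * ?P (snd x))"
  define R where "R = (\<lambda>x. indicator (mask h) x * inv_fourier (rest_hat j) x)"
  have A: "L2 A" "energy A = energy q * (4 ^ j * energy profile)"
    unfolding A_def using energy_tensor[OF qL2 P(1)] P(2) by simp_all
  have rest: "L2 (inv_fourier (rest_hat j))" "energy (inv_fourier (rest_hat j)) = energy (rest_hat j)"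
    by (rule plancherel[OF rest_hat_tame])+
  have R: "L2 R" unfolding R_def by (rule masked_L2[OF rest(1)])
  have "energy R \<le> energy (inv_fourier (rest_hat j))"
    by (rule energy_mono[OF rest(1) L2_measurable[OF R]]) (simp add: R_def indicator_def)
  then have eR: "energy R \<le> 36 * 4 ^ j * tail j"
    using rest(2) energy_rest_hat_le[of j] by linarith
  have "(\<lambda>x. indicator (mask h) x * inv_fourier (line_hat j) x) = (\<lambda>x. A x + R x)"
  proof
    fix x
    have "inv_fourier (line_hat j) x = inv_fourier (main_hat j) x + inv_fourier (rest_hat j) x"
      using inv_fourier_add[OF main_hat_tame rest_hat_tame, of j j x] by (simp add: line_hat_split[symmetric])
    moreover have "inv_fourier (main_hat j) x = inv_fourier (low j) (fst x) * ?P (snd x)"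
      unfolding main_hat_def[abs_def] by (rule inv_fourier_tensor[OF low_tame profile_dilate_tame])
    moreover have "indicator (mask h) x = ?I (fst x)"
      by (auto simp: mask_def indicator_def abs_le_iff)
    ultimately show "indicator (mask h) x * inv_fourier (line_hat j) x = A x + R x"
      by (simp add: A_def R_def q_def algebra_simps)
  qed
  then have "energy (\<lambda>x. indicator (mask h) x * inv_fourier (line_hat j) x) \<le> 2 * energy A + 2 * energy R"
    by (simp only:) (intro energy_add_le A R)
  also have "\<dots> \<le> 2 * ((4 * h + 2 * tail j) * (4 ^ j * energy profile)) + 2 * (36 * 4 ^ j * tail j)"
    unfolding A(2) using eq eR by (intro add_mono mult_left_mono mult_right_mono) auto
  also have "\<dots> = 4 ^ j * (energy profile * (8 * h + 4 * tail j) + 72 * tail j)"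
    by (simp add: algebra_simps)
  finally show ?thesis .
qed

end

section \<open>Recovery of the filtered line\<close>

theorem theorem5p8:
  fixes \<nu> w :: "real \<Rightarrow> real" and V :: "real \<Rightarrow> complex"
    and \<rho> :: real and h :: "nat \<Rightarrow> real"
  assumes nu_smooth: "smooth \<nu>"
    and nu_sym: "\<And>x. \<nu> x + \<nu> (1 - x) = 1"
    and nu_0: "\<And>x. x \<le> 0 \<Longrightarrow> \<nu> x = 0"
    and nu_1: "\<And>x. x \<ge> 1 \<Longrightarrow> \<nu> x = 1"
    and V_L2: "L2 V"
    and V_smooth: "smooth V"
    and V_supp: "supp V \<subseteq> {-1..1}"
    and V_sum: "\<And>u. u \<in> {-1..1} \<Longrightarrow> (\<Sum>k\<in>{-1..1::int}. (cmod (V (u + of_int k)))\<^sup>2) = 1"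
    and rho_pos: "\<rho> > 0"
    and w_smooth: "smooth w"
    and w_range: "\<And>x. w x \<in> {0..1}"
    and w_supp: "supp w \<subseteq> {-\<rho>..\<rho>}"
    and w_nonzero: "\<exists>x. w x \<noteq> 0"
    and h_pos: "\<And>j. h j > 0"
    and h_rho: "\<And>j. h j < \<rho>"
    and h_small: "h \<in> o(\<lambda>j. 2 powr (- real j))"
  defines "wL \<equiv> filtered_line \<nu> \<rho> w"
    and "f \<equiv> (\<lambda>j. proj_known (h j) (filtered_line \<nu> \<rho> w j))"
  shows "\<exists>\<beta> :: nat \<Rightarrow> real. (\<forall>j. \<beta> j > 0) \<and>
           (\<exists>L. (\<forall>j. is_synthesis \<nu> V
                       (restrict_seq (threshold_set \<nu> V (f j) (\<beta> j)) (analysis \<nu> V (f j)))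
                       (L j)) \<and>
                (\<lambda>j. L2_norm (\<lambda>x. L j x - wL j x) / L2_norm (wL j)) \<longlonglongrightarrow> 0)"
proof -
  interpret line_model \<nu> V \<rho> w
    by unfold_locales (fact nu_smooth nu_0 nu_1 V_smooth V_supp V_sum w_smooth w_range w_supp w_nonzero)+
  let ?g = line_hat
  let ?m = "\<lambda>j x. indicator (mask (h j)) x * inv_fourier (?g j) x"
  let ?P = "energy profile"
  have wL: "wL j = inv_fourier (?g j)" for j
    unfolding wL_def by (rule ext) (rule filtered_line_eq)
  have f: "f j = (\<lambda>x. inv_fourier (?g j) x - ?m j x)" for j
    unfolding f_def proj_known_def by (rule ext) (simp add: filtered_line_eq left_diff_distrib)
  have mL2: "L2 (?m j)" for j
    by (intro masked_L2 plancherel line_hat_tame)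
  \<comment> \<open>The energy of the line grows like \<open>4 ^ j\<close>, so the frame series may stop at the absolute error \<open>1\<close>.\<close>
  define good where "good = (\<lambda>j \<beta> L. \<beta> > 0
      \<and> is_synthesis \<nu> V (kept (f j) \<beta>) L
      \<and> energy (\<lambda>x. L x - wL j x)
        \<le> 1 + 4 * energy (\<lambda>\<xi>. of_bool (\<bar>snd \<xi>\<bar> \<le> 2 * \<bar>fst \<xi>\<bar>) * ?g j \<xi>) + 8 * energy (?m j))"
  have "\<exists>\<beta> L. good j \<beta> L" for j
  proof -
    obtain \<beta> L where "\<beta> > 0"
      "is_synthesis \<nu> V (kept (f j) \<beta>) L"
      "energy (\<lambda>x. L x - inv_fourier (?g j) x)
        \<le> 1 + 4 * energy (\<lambda>\<xi>. of_bool (\<bar>snd \<xi>\<bar> \<le> 2 * \<bar>fst \<xi>\<bar>) * ?g j \<xi>) + 8 * energy (?m j)"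
      by (rule shearlet_hard_thresholding[OF line_hat_tame mL2 zero_less_one f])
    then show ?thesis unfolding good_def wL by (intro exI conjI)
  qed
  then obtain \<beta> L where "good j (\<beta> j) (L j)" for j
    by metis
  then have \<beta>: "\<And>j. \<beta> j > 0"
    and syn: "\<And>j. is_synthesis \<nu> V (kept (f j) (\<beta> j)) (L j)"
    and le: "\<And>j. energy (\<lambda>x. L j x - wL j x)
        \<le> 1 + 4 * energy (\<lambda>\<xi>. of_bool (\<bar>snd \<xi>\<bar> \<le> 2 * \<bar>fst \<xi>\<bar>) * ?g j \<xi>) + 8 * energy (?m j)"
    unfolding good_def by blast+
  define err where "err = (\<lambda>j. (1 / 4) ^ j + 144 * tail j + 8 * (?P * (8 * h j + 4 * tail j) + 72 * tail j))"
  define den where "den = (\<lambda>j. (energy wc - tail j) * ?P)"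
  have num: "energy (\<lambda>x. L j x - wL j x) \<le> 4 ^ j * err j" for j
  proof -
    have "energy (\<lambda>x. L j x - wL j x) \<le> 1 + 4 * (36 * 4 ^ j * tail j)
        + 8 * (4 ^ j * (?P * (8 * h j + 4 * tail j) + 72 * tail j))"
      using le[of j] energy_line_on_seam_cone[of j] energy_masked_line_le[of "h j" j] h_pos[of j] by linarith
    also have "\<dots> = 4 ^ j * err j"
      by (simp add: err_def algebra_simps power_one_over)
    finally show ?thesis .
  qed
  have low: "4 ^ j * den j \<le> energy (wL j)" for j
    using energy_line_ge[of j] plancherel(2)[OF line_hat_tame, of j]
    by (simp add: wL den_def mult_ac)
  have "(\<lambda>j. 2 powr (- real j)) \<in> O(\<lambda>_. 1)"
  proof (rule bigoI[where c = 1])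
    have "2 powr (- real j) \<le> 2 powr 0" for j by (intro powr_mono) auto
    then show "eventually (\<lambda>j. norm (2 powr (- real j)) \<le> 1 * norm (1::real)) at_top" by simp
  qed
  with h_small have "h \<in> o(\<lambda>_. 1)" by (rule landau_o.small_big_trans)
  then have h0: "h \<longlonglongrightarrow> 0" using smalloD_tendsto by fastforce
  have "(\<lambda>j. (1 / 4 :: real) ^ j) \<longlonglongrightarrow> 0" by (rule LIMSEQ_realpow_zero) auto
  moreover have "(\<lambda>j. 144 * tail j + 8 * (?P * (8 * h j + 4 * tail j) + 72 * tail j))
      \<longlonglongrightarrow> 144 * 0 + 8 * (?P * (8 * 0 + 4 * 0) + 72 * 0)"
    by (intro tendsto_intros tail_tendsto_0 h0)
  ultimately have "err \<longlonglongrightarrow> 0 + (144 * 0 + 8 * (?P * (8 * 0 + 4 * 0) + 72 * 0))"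
    unfolding err_def add.assoc by (rule tendsto_add)
  then have err0: "err \<longlonglongrightarrow> 0" by simp
  have "den \<longlonglongrightarrow> (energy wc - 0) * ?P"
    unfolding den_def by (intro tendsto_intros tail_tendsto_0)
  then have denlim: "den \<longlonglongrightarrow> energy wc * ?P" by simp
  have pos: "energy wc * ?P > 0" using energy_wc_pos energy_profile_pos by simp
  have "(\<lambda>j. sqrt (err j / den j)) \<longlonglongrightarrow> sqrt (0 / (energy wc * ?P))"
    using pos by (intro tendsto_intros err0 denlim) auto
  then have lim: "(\<lambda>j. sqrt (err j / den j)) \<longlonglongrightarrow> 0" by simp
  have "eventually (\<lambda>j. den j > 0) sequentially"
    using order_tendstoD(1)[OF denlim pos] .
  then have "eventually (\<lambda>j. L2_norm (\<lambda>x. L j x - wL j x) / L2_norm (wL j) \<le> sqrt (err j / den j)) sequentially"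
  proof (rule eventually_mono)
    fix j assume d: "den j > 0"
    then have wpos: "energy (wL j) > 0" using low[of j] by (intro less_le_trans[OF _ low]) simp
    have "energy (\<lambda>x. L j x - wL j x) / energy (wL j) \<le> (4 ^ j * err j) / (4 ^ j * den j)"
      using num[of j] low[of j] d order_trans[OF energy_nonneg num[of j]]
      by (intro frac_le) auto
    also have "\<dots> = err j / den j" by simp
    finally show "L2_norm (\<lambda>x. L j x - wL j x) / L2_norm (wL j) \<le> sqrt (err j / den j)"
      unfolding L2_norm_eq_sqrt_energy real_sqrt_divide[symmetric] by (rule real_sqrt_le_mono)
  qed
  then have "(\<lambda>j. L2_norm (\<lambda>x. L j x - wL j x) / L2_norm (wL j)) \<longlonglongrightarrow> 0"
    by (intro tendsto_sandwich[OF _ _ tendsto_const lim])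
      (auto simp: L2_norm_eq_sqrt_energy)
  then show ?thesis using \<beta> syn by blast
qed

end
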